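(* Let $(\lambda_j)_{j\ge 1}$ and $(\mu_j)_{j\ge 1}$ be two sequences of real numbers tending to zero such that $$|\lambda_1|>|\mu_1|>|\lambda_2|>|\mu_2|>\dots\to 0 .$$ Then there exists a unique real valued sequence $c=(c_n)_{n\ge 0}$ such that $\Gamma_c$ and $\Gamma_{\tilde c}$ are compact selfadjoint operators on $\ell^2(\mathbb Z_+)$, the sequence of non zero eigenvalues of $\Gamma_c$ is $(\lambda_j)_{j\ge 1}$, and the sequence of non zero eigenvalues of $\Gamma_{\tilde c}$ is $(\mu_j)_{j\ge 1}$. Furthermore, for this $c$, the kernel of $\Gamma_c$ is reduced to zero if and only if both of the following conditions hold: $$\sum_{j=1}^\infty\left(1-\frac{\mu_j^2}{\lambda_j^2}\right)=\infty,\qquad \sup_{N}\frac{1}{\lambda_{N+1}^2}\prod_{j=1}^N\frac{\mu_j^2}{\lambda_j^2}=\infty .$$ Moreover, in that case, the kernel of $\Gamma_{\tilde c}$ is also reduced to $0$.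
   Context: $\mathbb Z_+=\{0,1,2,\dots\}$. For a sequence $c=(c_n)_{n\ge0}$ of complex numbers, the Hankel operator $\Gamma_c$ is formally defined on $\ell^2(\mathbb Z_+)$ by $\Gamma_c(x)_n=\sum_{p=0}^\infty c_{n+p}x_p$ for $x=(x_n)_{n\ge 0}$. The shifted sequence is $\tilde c_n:=c_{n+1}$, $n\in\mathbb Z_+$, so $\Gamma_{\tilde c}(x)_n=\sum_{p\ge 0}c_{n+p+1}x_p$. Non zero eigenvalues are listed repeated according to their multiplicity. *)

theory Defs
  imports "HOL-Analysis.Analysis"
begin

definition square_summable :: "(nat \<Rightarrow> complex) \<Rightarrow> bool" where
  "square_summable x \<longleftrightarrow> summable (\<lambda>n. (cmod (x n))\<^sup>2)"

lemma square_summable_zero: "square_summable (\<lambda>n. 0)"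
  by (simp add: square_summable_def)

typedef ell2 = "{x. square_summable x}"
  morphisms coord Abs_ell2
  using square_summable_zero by blast

lemma square_summable_coord [simp]: "square_summable (coord x)"
  using coord by blast

lemma coord_Abs_ell2: "square_summable x \<Longrightarrow> coord (Abs_ell2 x) = x"
  by (simp add: Abs_ell2_inverse)

lemma ell2_eqI: "(\<And>n. coord x n = coord y n) \<Longrightarrow> x = y"
  by (metis coord_inject ext)

lemma square_summable_add:
  assumes "square_summable x" "square_summable y"
  shows "square_summable (\<lambda>n. x n + y n)"
  unfolding square_summable_def
proof (rule summable_comparison_test')
  show "summable (\<lambda>n. 2 * ((cmod (x n))\<^sup>2 + (cmod (y n))\<^sup>2))"
    using assms by (intro summable_mult summable_add) (auto simp: square_summable_def)
  fix n :: nat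
  have "(cmod (x n + y n))\<^sup>2 \<le> (cmod (x n) + cmod (y n))\<^sup>2"
    by (intro power_mono norm_triangle_ineq) auto
  also have "\<dots> \<le> 2 * ((cmod (x n))\<^sup>2 + (cmod (y n))\<^sup>2)"
    using zero_le_power2[of "cmod (x n) - cmod (y n)"] by (simp add: power2_sum power2_diff)
  finally show "norm ((cmod (x n + y n))\<^sup>2) \<le> 2 * ((cmod (x n))\<^sup>2 + (cmod (y n))\<^sup>2)"
    by simp
qed

lemma square_summable_scale:
  "square_summable x \<Longrightarrow> square_summable (\<lambda>n. a * x n)"
  by (simp add: square_summable_def norm_mult power_mult_distrib summable_mult)

lemma square_summable_uminus: "square_summable x \<Longrightarrow> square_summable (\<lambda>n. - x n)"
  by (simp add: square_summable_def)

lemma square_summable_diff: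
  "square_summable x \<Longrightarrow> square_summable y \<Longrightarrow> square_summable (\<lambda>n. x n - y n)"
  using square_summable_add[of x "\<lambda>n. - y n"] square_summable_uminus[of y] by simp

lemma summable_mult_cnj:
  assumes "square_summable x" "square_summable y"
  shows "summable (\<lambda>n. x n * cnj (y n))"
proof (rule summable_comparison_test')
  show "summable (\<lambda>n. (cmod (x n))\<^sup>2 + (cmod (y n))\<^sup>2)"
    using assms by (intro summable_add) (auto simp: square_summable_def)
  fix n :: nat
  have "2 * (cmod (x n) * cmod (y n)) \<le> (cmod (x n))\<^sup>2 + (cmod (y n))\<^sup>2"
    using zero_le_power2[of "cmod (x n) - cmod (y n)"] by (simp add: power2_diff)
  moreover have "0 \<le> cmod (x n) * cmod (y n)"
    by simp
  ultimately show "norm (x n * cnj (y n)) \<le> (cmod (x n))\<^sup>2 + (cmod (y n))\<^sup>2"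
    unfolding norm_mult complex_mod_cnj by linarith
qed

instantiation ell2 :: real_vector
begin

definition "0 = Abs_ell2 (\<lambda>n. 0)"
definition "x + y = Abs_ell2 (\<lambda>n. coord x n + coord y n)"
definition "- x = Abs_ell2 (\<lambda>n. - coord x n)" for x :: ell2
definition "x - y = Abs_ell2 (\<lambda>n. coord x n - coord y n)"
definition "r *\<^sub>R x = Abs_ell2 (\<lambda>n. complex_of_real r * coord x n)"

lemma coord_zero [simp]: "coord 0 n = 0"
  by (simp add: zero_ell2_def coord_Abs_ell2 square_summable_zero)

lemma coord_add [simp]: "coord (x + y) n = coord x n + coord y n"
  by (simp add: plus_ell2_def coord_Abs_ell2 square_summable_add)

lemma coord_uminus [simp]: "coord (- x) n = - coord x n"
  by (simp add: uminus_ell2_def coord_Abs_ell2 square_summable_uminus)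

lemma coord_diff [simp]: "coord (x - y) n = coord x n - coord y n"
  by (simp add: minus_ell2_def coord_Abs_ell2 square_summable_diff)

lemma coord_scaleR [simp]: "coord (r *\<^sub>R x) n = complex_of_real r * coord x n"
  by (simp add: scaleR_ell2_def coord_Abs_ell2 square_summable_scale)

instance
  by standard (auto intro!: ell2_eqI simp: algebra_simps)

end

definition cinner :: "ell2 \<Rightarrow> ell2 \<Rightarrow> complex" where
  "cinner x y = (\<Sum>n. coord x n * cnj (coord y n))"

lemma cinner_sums: "(\<lambda>n. coord x n * cnj (coord y n)) sums cinner x y"
  by (simp add: cinner_def summable_sums summable_mult_cnj)

lemma cinner_commute: "cinner y x = cnj (cinner x y)"
proof -
  have "(\<lambda>n. cnj (coord x n * cnj (coord y n))) sums cnj (cinner x y)"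
    using cinner_sums by (simp only: sums_cnj)
  then have "(\<lambda>n. coord y n * cnj (coord x n)) sums cnj (cinner x y)"
    by (simp add: mult.commute)
  then show ?thesis
    using cinner_sums sums_unique2 by blast
qed

lemma cinner_add_left: "cinner (x + y) z = cinner x z + cinner y z"
  using sums_add[OF cinner_sums[of x z] cinner_sums[of y z]] cinner_sums[of "x + y" z]
  by (simp add: distrib_right sums_unique2)

lemma cinner_scaleR_left: "cinner (r *\<^sub>R x) y = complex_of_real r * cinner x y"
  using sums_mult[OF cinner_sums[of x y], of "complex_of_real r"] cinner_sums[of "r *\<^sub>R x" y]
  by (simp add: mult.assoc sums_unique2)

lemma Re_cinner_self_sums: "(\<lambda>n. (cmod (coord x n))\<^sup>2) sums Re (cinner x x)"
proof -
  have "Re (z * cnj z) = (cmod z)\<^sup>2" for z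
    by (simp only: complex_norm_square[symmetric] Re_complex_of_real)
  then show ?thesis
    using sums_Re[OF cinner_sums[of x x]] by simp
qed

text \<open>
  The norm is the usual one, since \<open>Re (cinner x x)\<close> is the sum of the \<open>(cmod (coord x n))\<^sup>2\<close>.
\<close>

instantiation ell2 :: real_inner
begin

definition "inner x y = Re (cinner x y)"
definition "norm x = sqrt (Re (cinner x x))"
definition "sgn x = x /\<^sub>R norm x" for x :: ell2
definition "dist x y = norm (x - y)" for x y :: ell2
definition "(uniformity :: (ell2 \<times> ell2) filter) =
  (INF e\<in>{0<..}. principal {(x, y). dist x y < e})"
definition "open U \<longleftrightarrow> (\<forall>x\<in>U. eventually (\<lambda>(x', y). x' = x \<longrightarrow> y \<in> U) uniformity)"
  for U :: "ell2 set"

instance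
proof
  fix x y z :: ell2 and r :: real
  show "inner x y = inner y x"
    by (simp add: inner_ell2_def cinner_commute[of x y])
  show "inner (x + y) z = inner x z + inner y z"
    by (simp add: inner_ell2_def cinner_add_left)
  show "inner (r *\<^sub>R x) y = r * inner x y"
    by (simp add: inner_ell2_def cinner_scaleR_left)
  show "0 \<le> inner x x"
    unfolding inner_ell2_def by (rule sums_le[OF _ sums_zero Re_cinner_self_sums]) simp
  show "inner x x = 0 \<longleftrightarrow> x = 0"
  proof
    assume "inner x x = 0"
    then have "(\<lambda>n. (cmod (coord x n))\<^sup>2) sums 0"
      using Re_cinner_self_sums[of x] by (simp add: inner_ell2_def)
    then have "\<forall>n. (cmod (coord x n))\<^sup>2 = 0"
      using suminf_eq_zero_iff[of "\<lambda>n. (cmod (coord x n))\<^sup>2"]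
      by (simp add: sums_iff)
    then show "x = 0"
      by (auto intro: ell2_eqI)
  qed (simp add: inner_ell2_def cinner_def)
  show "norm x = sqrt (inner x x)"
    by (simp add: norm_ell2_def inner_ell2_def)
qed (rule sgn_ell2_def dist_ell2_def uniformity_ell2_def open_ell2_def)+

end

definition scaleC :: "complex \<Rightarrow> ell2 \<Rightarrow> ell2"  (infixr "*\<^sub>C" 75) where
  "a *\<^sub>C x = Abs_ell2 (\<lambda>n. a * coord x n)"

lemma coord_scaleC [simp]: "coord (a *\<^sub>C x) n = a * coord x n"
  by (simp add: scaleC_def coord_Abs_ell2 square_summable_scale)

global_interpretation ell2: vector_space scaleC
  by standard (auto intro!: ell2_eqI simp: algebra_simps)

definition compact_operator :: "(ell2 \<Rightarrow> ell2) \<Rightarrow> bool" where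
  "compact_operator T \<longleftrightarrow>
     Vector_Spaces.linear scaleC scaleC T \<and> compact (closure (T ` cball 0 1))"

definition selfadjoint :: "(ell2 \<Rightarrow> ell2) \<Rightarrow> bool" where
  "selfadjoint T \<longleftrightarrow> (\<forall>x y. cinner (T x) y = cinner x (T y))"

definition null_space :: "(ell2 \<Rightarrow> ell2) \<Rightarrow> ell2 set" where
  "null_space T = {x. T x = 0}"

definition eigenspace :: "(ell2 \<Rightarrow> ell2) \<Rightarrow> complex \<Rightarrow> ell2 set" where
  "eigenspace T z = {x. T x = z *\<^sub>C x}"

text \<open>
  The basis is required to exist explicitly because \<open>ell2.dim\<close> is \<open>0\<close> also on
  infinite-dimensional subspaces. Multiplicity \<open>0\<close> means that \<open>z\<close> is not an eigenvalue.
\<close>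

definition has_multiplicity :: "(ell2 \<Rightarrow> ell2) \<Rightarrow> complex \<Rightarrow> nat \<Rightarrow> bool" where
  "has_multiplicity T z k \<longleftrightarrow>
     (\<exists>B. finite B \<and> card B = k \<and> ell2.independent B \<and> ell2.span B = eigenspace T z)"

definition nonzero_eigenvalue_sequence :: "(ell2 \<Rightarrow> ell2) \<Rightarrow> (nat \<Rightarrow> real) \<Rightarrow> bool" where
  "nonzero_eigenvalue_sequence T l \<longleftrightarrow>
     (\<forall>j. l j \<noteq> 0) \<and>
     (\<forall>z. z \<noteq> 0 \<longrightarrow>
        finite {j. complex_of_real (l j) = z} \<and>
        has_multiplicity T z (card {j. complex_of_real (l j) = z}))"

definition hankel_seq :: "(nat \<Rightarrow> complex) \<Rightarrow> (nat \<Rightarrow> complex) \<Rightarrow> nat \<Rightarrow> complex" where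
  "hankel_seq c x n = (\<Sum>p. c (n + p) * x p)"

text \<open>
  The formal expression defines an operator on the whole of \<open>ell2\<close> if all the series converge and
  the resulting sequences are square-summable. Only then is the function \<open>Hankel c\<close> below
  meaningful.
\<close>

definition hankel_defined :: "(nat \<Rightarrow> complex) \<Rightarrow> bool" where
  "hankel_defined c \<longleftrightarrow>
     (\<forall>x. (\<forall>n. summable (\<lambda>p. c (n + p) * coord x p)) \<and>
          square_summable (hankel_seq c (coord x)))"

definition Hankel :: "(nat \<Rightarrow> complex) \<Rightarrow> ell2 \<Rightarrow> ell2" where
  "Hankel c x = Abs_ell2 (hankel_seq c (coord x))"

definition compact_selfadjoint_Hankel :: "(nat \<Rightarrow> complex) \<Rightarrow> bool" where
  "compact_selfadjoint_Hankel c \<longleftrightarrow>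
     hankel_defined c \<and> compact_operator (Hankel c) \<and> selfadjoint (Hankel c)"

definition shift :: "(nat \<Rightarrow> complex) \<Rightarrow> nat \<Rightarrow> complex" where
  "shift c n = c (n + 1)"

definition realizes_spectra ::
    "(nat \<Rightarrow> complex) \<Rightarrow> (nat \<Rightarrow> real) \<Rightarrow> (nat \<Rightarrow> real) \<Rightarrow> bool" where
  "realizes_spectra c l m \<longleftrightarrow>
     compact_selfadjoint_Hankel c \<and> compact_selfadjoint_Hankel (shift c) \<and>
     nonzero_eigenvalue_sequence (Hankel c) l \<and>
     nonzero_eigenvalue_sequence (Hankel (shift c)) m"

end

theory Submission
  imports Defs
begin

text \<open>
  Let \<open>e\<^sub>j\<close> be normalized eigenvectors of the Hankel operator \<open>\<Gamma>\<close> and \<open>u = \<Gamma> \<delta>\<close> with \<open>\<delta>\<close> the first unit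
  vector. As \<open>\<Gamma>'\<close> is \<open>\<Gamma>\<close> followed by the backward shift, \<open>\<Gamma>'\<^sup>2 = \<Gamma>\<^sup>2 - (\<cdot>|u) u\<close>, so that the weights
  \<open>a\<^sub>j = |(u|e\<^sub>j)|\<^sup>2\<close> satisfy \<open>\<Sum>\<^sub>j a\<^sub>j / (\<lambda>\<^sub>j\<^sup>2 - \<mu>\<^sub>k\<^sup>2) = 1\<close> for all \<open>k\<close> and \<open>\<Sum>\<^sub>j a\<^sub>j / \<lambda>\<^sub>j\<^sup>2 \<le> 1\<close>. Cancelling zeros
  against poles in the Stieltjes transform shows that these conditions determine the weights. In
  the basis \<open>e\<^sub>j\<close> they determine \<open>\<Gamma>'\<close>, hence the shift, hence the sequence.

  Conversely the weights are limits of residues of finite products. Let \<open>\<Lambda>\<close> be the diagonal operator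
  with entries \<open>\<lambda>\<^sub>j\<close>, let \<open>u\<close> have coordinates \<open>sqrt a\<^sub>j\<close>, and let \<open>G\<close> be the square root of
  \<open>\<Lambda>\<^sup>2 - (\<cdot>|u) u\<close> with eigenvalues \<open>\<mu>\<^sub>k\<close>. Then \<open>G = \<Lambda> D = B \<Lambda>\<close> with a contraction \<open>D\<close> and its adjoint \<open>B\<close>,
  and \<open>D B = 1 - (\<cdot>|q) q\<close> with \<open>\<Lambda> q = u\<close>. The map \<open>h \<mapsto> ((h|D\<^sup>n q))\<^sub>n\<close> carries \<open>\<Lambda>\<close> and \<open>G\<close> to the two Hankel
  operators as soon as it is isometric, which means \<open>B\<^sup>n \<rightarrow> 0\<close> strongly. A limit point of the precompact
  orbit \<open>B\<^sup>n \<Lambda> h = \<Lambda> D\<^sup>n h\<close> is recurrent for the contraction \<open>B\<close>; recurrence forces all \<open>\<Lambda>\<^sup>k w\<close> with odd \<open>k\<close>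
  to be orthogonal to \<open>u\<close>, and \<open>u\<close> is cyclic for \<open>\<Lambda>\<^sup>2\<close>, so \<open>w = 0\<close>.

  The kernel of \<open>\<Gamma>\<close> is shift invariant, and it is trivial exactly if \<open>\<delta>\<close> lies in the closure of the
  range of \<open>\<Gamma>\<close> but not in the range. The two conditions express this through the sums of
  \<open>a\<^sub>j / \<lambda>\<^sub>j\<^sup>2\<close> and \<open>a\<^sub>j / \<lambda>\<^sub>j\<^sup>4\<close>.
\<close>

section \<open>Interlacing sequences\<close>

text \<open>For \<open>j < n\<close> this is the coefficient at the pole \<open>x j\<close> in the
  expansion of \<open>\<Prod>k<n. (y k - z) / (x k - z)\<close>, a rational function of
  \<open>z\<close> with value 1 at infinity.\<close>

definition residue :: "(nat \<Rightarrow> real) \<Rightarrow> (nat \<Rightarrow> real) \<Rightarrow> nat \<Rightarrow> nat \<Rightarrow> real" where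
  "residue x y n j = (x j - y j) * (\<Prod>k\<in>{..<n} - {j}. (y k - x j) / (x k - x j))"

lemma residue_Suc_less:
  assumes "j < n"
  shows "residue x y (Suc n) j = residue x y n j * ((y n - x j) / (x n - x j))"
proof -
  have "{..<Suc n} - {j} = insert n ({..<n} - {j})"
    using assms by auto
  then show ?thesis
    by (simp add: residue_def)
qed

lemma residue_Suc_self:
  "residue x y (Suc n) n = (x n - y n) * (\<Prod>k<n. (y k - x n) / (x k - x n))"
proof -
  have "{..<Suc n} - {n} = {..<n}"
    by auto
  then show ?thesis
    by (simp add: residue_def)
qed

text \<open>Induction on the number of factors: the factor \<open>(y n - z) / (x n - z)\<close>
  rescales the old coefficients and creates a pole at \<open>x n\<close>, whose coefficient comes
  from the induction hypothesis at \<open>z = x n\<close>.\<close>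

lemma residue_partial_fractions:
  assumes "inj_on x {..<n}" "z \<notin> x ` {..<n}"
  shows "1 - (\<Sum>j<n. residue x y n j / (x j - z)) = (\<Prod>k<n. (y k - z) / (x k - z))"
  using assms
proof (induction n arbitrary: z)
  case (Suc n)
  have inj: "inj_on x {..<n}" and xn: "x n \<notin> x ` {..<n}"
    using Suc.prems(1) by (auto simp: lessThan_Suc)
  have z: "z \<notin> x ` {..<n}" "z \<noteq> x n"
    using Suc.prems(2) by (auto simp: lessThan_Suc)
  define s where "s = (\<Sum>j<n. residue x y n j / (x j - z))"
  define t where "t = (\<Sum>j<n. residue x y n j / (x j - x n))"
  have IH: "1 - s = (\<Prod>k<n. (y k - z) / (x k - z))"
    using Suc.IH[OF inj z(1)] by (simp add: s_def)
  have IHn: "1 - t = (\<Prod>k<n. (y k - x n) / (x k - x n))"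
    using Suc.IH[OF inj xn] by (simp add: t_def)
  have eqn: "residue x y (Suc n) j / (x j - z) =
      residue x y n j / (x j - z) * ((y n - z) / (x n - z))
      + residue x y n j / (x j - x n) * ((x n - y n) / (x n - z))" if "j < n" for j
  proof -
    have "x j \<noteq> z" "x j \<noteq> x n"
      using that z(1) xn by (metis image_eqI lessThan_iff)+
    then have ne: "x j - z \<noteq> 0" "x n - x j \<noteq> 0" "x n - z \<noteq> 0" "x j - x n \<noteq> 0"
      using z(2) by auto
    show ?thesis
      unfolding residue_Suc_less[OF that]
      using ne by (simp add: divide_simps) (simp add: algebra_simps)
  qed
  have "(\<Sum>j<n. residue x y (Suc n) j / (x j - z)) =
      s * ((y n - z) / (x n - z)) + t * ((x n - y n) / (x n - z))"
    unfolding s_def t_def sum_distrib_right sum.distrib[symmetric]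
    by (rule sum.cong) (auto simp: eqn)
  then have "1 - (\<Sum>j<Suc n. residue x y (Suc n) j / (x j - z)) =
      1 - s * ((y n - z) / (x n - z)) - t * ((x n - y n) / (x n - z))
      - (x n - y n) * (1 - t) / (x n - z)"
    by (simp add: residue_Suc_self IHn)
  also have "\<dots> = (1 - s) * ((y n - z) / (x n - z))"
    using z by (simp add: divide_simps) (simp add: algebra_simps)
  finally show ?case
    by (simp add: IH)
qed auto

text \<open>
  The rational function that is \<open>1\<close> minus the Stieltjes transform of the weights gets multiplied
  by \<open>(p k - z) / (r k - z)\<close>, which cancels its zero \<open>r k\<close>.
\<close>

lemma sums_cancel_zeros:
  fixes a x p r :: "nat \<Rightarrow> real"
  assumes one: "\<And>k. k < n \<Longrightarrow> (\<lambda>j. a j / (x j - r k)) sums 1"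
    and inj: "inj_on r {..<n}" and r: "\<And>k. k < n \<Longrightarrow> r k \<notin> range x"
    and z: "z \<notin> r ` {..<n}" "z \<notin> range x" and s: "(\<lambda>j. a j / (x j - z)) sums s"
  shows "(\<lambda>j. a j * (\<Prod>k<n. (p k - x j) / (r k - x j)) / (x j - z)) sums
      (1 - (1 - s) * (\<Prod>k<n. (p k - z) / (r k - z)))"
  using one inj r z s
proof (induction n arbitrary: z s)
  case (Suc n)
  define w where "w j = a j * (\<Prod>k<n. (p k - x j) / (r k - x j))" for j
  have inj: "inj_on r {..<n}" and rn: "r n \<notin> r ` {..<n}"
    using Suc.prems(2) by (auto simp: lessThan_Suc)
  have z: "z \<notin> r ` {..<n}" "z \<noteq> r n" "\<And>j. z \<noteq> x j"
    using Suc.prems(4,5) by (auto simp: lessThan_Suc)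
  have rx: "r n \<noteq> x j" for j
    using Suc.prems(3)[of n] by auto
  define t where "t = 1 - (1 - s) * (\<Prod>k<n. (p k - z) / (r k - z))"
  have wz: "(\<lambda>j. w j / (x j - z)) sums t"
    unfolding w_def t_def using Suc.prems inj z by (intro Suc.IH) auto
  \<comment> \<open>The value 1 at \<open>r n\<close> says that the current function vanishes there,
    so the new factor \<open>(p n - z) / (r n - z)\<close> creates no pole.\<close>
  have wr: "(\<lambda>j. w j / (x j - r n)) sums 1"
    unfolding w_def using Suc.IH[of "r n" 1] Suc.prems inj rn by auto
  have "(\<lambda>j. w j / (x j - r n) * ((r n - p n) / (r n - z)) + w j / (x j - z) * ((p n - z) / (r n - z)))
      sums (1 * ((r n - p n) / (r n - z)) + t * ((p n - z) / (r n - z)))"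
    by (intro sums_add sums_mult2 wz wr)
  moreover have "w j / (x j - r n) * ((r n - p n) / (r n - z)) + w j / (x j - z) * ((p n - z) / (r n - z))
      = a j * (\<Prod>k<Suc n. (p k - x j) / (r k - x j)) / (x j - z)" for j
  proof -
    have ne: "x j - z \<noteq> 0" "r n - x j \<noteq> 0" "x j - r n \<noteq> 0" "r n - z \<noteq> 0"
      using z(2) z(3)[of j] rx[of j] by auto
    have "w j / (x j - r n) * ((r n - p n) / (r n - z)) + w j / (x j - z) * ((p n - z) / (r n - z))
      = w j * ((p n - x j) / (r n - x j)) / (x j - z)"
      using ne by (simp add: divide_simps) (simp add: algebra_simps)
    then show ?thesis
      by (simp add: w_def)
  qed
  moreover have "1 * ((r n - p n) / (r n - z)) + t * ((p n - z) / (r n - z)) =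
      1 - (1 - s) * (\<Prod>k<Suc n. (p k - z) / (r k - z))"
  proof -
    have "1 * ((r n - p n) / (r n - z)) + t * ((p n - z) / (r n - z)) = 1 - (1 - t) * ((p n - z) / (r n - z))"
      using z(2) by (simp add: divide_simps) (simp add: algebra_simps)
    then show ?thesis
      by (simp add: t_def)
  qed
  ultimately show ?case
    by simp
qed auto

section \<open>Order relations between interlaced sequences\<close>

locale interlacing =
  fixes x y :: "nat \<Rightarrow> real"
  assumes y_less_x: "y j < x j" and x_less_y: "x (Suc j) < y j" and x_lim: "x \<longlonglongrightarrow> 0"
begin

lemma x_strict: "i < j \<Longrightarrow> x j < x i"
proof (induction j)
  case (Suc j)
  then show ?case
    using x_less_y[of j] y_less_x[of j] by (cases "i = j") auto
qed simp

lemma x_le: "i \<le> j \<Longrightarrow> x j \<le> x i"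
  using x_strict by (cases "i = j") (auto simp: less_le)

lemma x_less_iff [simp]: "x i < x j \<longleftrightarrow> j < i"
  by (metis x_strict linorder_neqE_nat order_less_asym less_irrefl)

lemma x_eq_iff [simp]: "x i = x j \<longleftrightarrow> i = j"
  by (metis x_less_iff linorder_neqE_nat less_irrefl)

lemma y_less: "i \<le> j \<Longrightarrow> y j < x i"
  using y_less_x x_le by (meson less_le_trans)

lemma less_y: "i < j \<Longrightarrow> x j < y i"
  using x_less_y x_le by (meson Suc_leI le_less_trans)

lemma y_strict: "i < j \<Longrightarrow> y j < y i"
  using less_y[of i j] y_less_x[of j] by linarith

lemma x_pos: "0 < x j"
proof -
  have "decseq x"
    using x_le by (simp add: decseq_def)
  then have "0 \<le> x (Suc j)"
    using x_lim by (rule decseq_ge)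
  also have "\<dots> < x j"
    by simp
  finally show ?thesis .
qed

lemma y_pos: "0 < y j"
  using x_pos x_less_y by (meson less_trans)

lemma y_lim: "y \<longlonglongrightarrow> 0"
  by (rule tendsto_sandwich[OF _ _ tendsto_const x_lim])
    (auto intro!: always_eventually less_imp_le y_pos y_less_x)

lemma x_ne_y: "x i \<noteq> y j"
  by (metis less_irrefl less_y not_less y_less)

lemma between: "\<exists>m. x (Suc m) < t \<and> t < x m" if t: "0 < t" "t < x 0" "t \<notin> range x"
proof -
  have "eventually (\<lambda>n. x n < t) sequentially"
    using x_lim t(1) by (rule order_tendstoD)
  then obtain n where "x n < t"
    by (auto simp: eventually_sequentially)
  define k where "k = (LEAST n. x n < t)"
  have k: "x k < t"
    unfolding k_def using \<open>x n < t\<close> by (rule LeastI)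
  then obtain m where m: "k = Suc m"
    using t(2) by (cases k) auto
  have "\<not> x m < t"
    unfolding k_def[symmetric] using m not_less_Least[of m "\<lambda>n. x n < t"] k_def by simp
  then have "t < x m"
    using t(3) by (metis linorder_neqE_linordered_idom rangeI)
  then show ?thesis
    using k m by auto
qed

section \<open>Monotone limits of the residues\<close>

abbreviation ratio_prod :: "nat \<Rightarrow> real" where
  "ratio_prod n \<equiv> \<Prod>k<n. y k / x k"

lemma ratio_prod_pos: "0 < ratio_prod n"
  using x_pos y_pos by (intro prod_pos) simp

text \<open>By interlacing, \<open>y k\<close> and \<open>x k\<close> lie on the same side of
  \<open>x j\<close> whenever \<open>k \<noteq> j\<close>.\<close>

lemma residue_pos: "0 < residue x y n j"
  unfolding residue_def
proof (intro mult_pos_pos prod_pos)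
  fix k assume "k \<in> {..<n} - {j}"
  then show "0 < (y k - x j) / (x k - x j)"
    by (cases "k < j") (auto simp: less_y y_less divide_neg_neg)
qed (simp add: y_less_x)

lemma residue_ratio: "(y n - x j) / (x n - x j) = (x j - y n) / (x j - x n)"
  using minus_divide_divide[of "x j - y n" "x j - x n"] by simp

text \<open>The new factor is \<open>(x j - y n) / (x j - x n)\<close>, and
  \<open>y n < x n < x j\<close> makes it at least 1.\<close>

lemma residue_mono: "j < n \<Longrightarrow> residue x y n j \<le> residue x y (Suc n) j"
proof -
  assume j: "j < n"
  have "0 < x j - x n" "x n > y n"
    using j y_less_x by simp_all
  then have "1 \<le> (x j - y n) / (x j - x n)"
    by simp
  then show ?thesis
    unfolding residue_Suc_less[OF j] residue_ratio
    using residue_pos[of n j] mult_left_mono[of 1 "(x j - y n) / (x j - x n)" "residue x y n j"] by simp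
qed

text \<open>The residue at \<open>x j\<close> of the product with the further factor
  \<open>(0 - z) / (x n - z)\<close>: the next zero \<open>y n\<close> is replaced by the extreme
  value 0. These numbers bound the residues from above and decrease with \<open>n\<close>.\<close>

definition upper_residue :: "nat \<Rightarrow> nat \<Rightarrow> real" where
  "upper_residue n j = residue x y n j * (x j / (x j - x n))"

lemma upper_residue_antimono: "j < n \<Longrightarrow> upper_residue (Suc n) j \<le> upper_residue n j"
proof -
  assume j: "j < n"
  have pos: "0 < x j - x n" "0 < x j - x (Suc n)" "x (Suc n) < y n"
    using j x_less_y by (simp_all add: less_SucI)
  have "(x j - y n) / (x j - x n) * (x j / (x j - x (Suc n))) \<le> x j / (x j - x n)"
    using pos x_pos[of j] by (simp add: divide_simps)
  then show ?thesis
    unfolding upper_residue_def residue_Suc_less[OF j] residue_ratio mult.assoc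
    using residue_pos[of n j] by (intro mult_left_mono) auto
qed

lemma residue_le_upper: "j < n \<Longrightarrow> residue x y n j \<le> upper_residue n j"
proof -
  assume "j < n"
  then have "1 \<le> x j / (x j - x n)"
    using x_pos[of n] by (simp add: divide_simps)
  then show ?thesis
    unfolding upper_residue_def using residue_pos[of n j] mult_left_mono[of 1 "x j / (x j - x n)" "residue x y n j"] by simp
qed

lemma residue_mono_le:
  assumes "j < n" "n \<le> k" shows "residue x y n j \<le> residue x y k j"
  using assms(2)
proof (induction k rule: dec_induct)
  case (step k)
  then show ?case
    using residue_mono[of j k] assms(1) by simp
qed simp

lemma upper_residue_antimono_le:
  assumes "j < n" "n \<le> k" shows "upper_residue k j \<le> upper_residue n j"
  using assms(2)
proof (induction k rule: dec_induct)
  case (step k)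
  then show ?case
    using upper_residue_antimono[of j k] assms(1) by simp
qed simp

text \<open>The limit exists because for \<open>n > j\<close> the residues increase and stay below
  \<open>upper_residue\<close>.\<close>

definition weight :: "nat \<Rightarrow> real" where
  "weight j = lim (\<lambda>n. residue x y n j)"

lemma residue_bounded: "j < n \<Longrightarrow> residue x y k j \<le> upper_residue n j" if "n \<le> k"
  using residue_le_upper[of j k] upper_residue_antimono_le[of j n k] that by simp

lemma residue_tendsto: "(\<lambda>n. residue x y n j) \<longlonglongrightarrow> weight j"
proof -
  have "incseq (\<lambda>n. residue x y (n + Suc j) j)"
    by (intro incseq_SucI) (simp add: residue_mono)
  moreover have "\<forall>n. residue x y (n + Suc j) j \<le> upper_residue (Suc j) j"
    using residue_bounded by simp
  ultimately obtain L where "(\<lambda>n. residue x y (n + Suc j) j) \<longlonglongrightarrow> L"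
    using incseq_convergent by metis
  then have "(\<lambda>n. residue x y n j) \<longlonglongrightarrow> L"
    by (rule LIMSEQ_offset)
  then show ?thesis
    by (simp add: weight_def limI)
qed

lemma residue_le_weight: "j < n \<Longrightarrow> residue x y n j \<le> weight j"
  by (rule Lim_bounded2[OF residue_tendsto[of j], of n]) (auto intro: residue_mono_le)

lemma weight_pos: "0 < weight j"
  using residue_pos[of "Suc j" j] residue_le_weight[of j "Suc j"] by simp

lemma weight_le_upper: "j < n \<Longrightarrow> weight j \<le> upper_residue n j"
  by (rule Lim_bounded[OF residue_tendsto[of j], of n]) (auto intro: residue_bounded)

lemma sum_residue: "z \<notin> x ` {..<n} \<Longrightarrow>
    (\<Sum>j<n. residue x y n j / (x j - z)) = 1 - (\<Prod>k<n. (y k - z) / (x k - z))"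
  using residue_partial_fractions[of x n z y] by (simp add: inj_on_def)

lemma sum_residue_x: "(\<Sum>j<n. residue x y n j / x j) = 1 - ratio_prod n"
  using sum_residue[of 0 n] x_pos by (force simp: less_le)

text \<open>With residues in place of weights the sums are at most \<open>1 - ratio_prod k\<close>;
  for a fixed number of terms the bound 1 survives the limit in \<open>k\<close>.\<close>

lemma summable_weight_x: "summable (\<lambda>j. weight j / x j)"
proof (rule summableI_nonneg_bounded)
  show "0 \<le> weight n / x n" for n
    using weight_pos x_pos by (simp add: less_imp_le)
  show "(\<Sum>j<n. weight j / x j) \<le> 1" for n
  proof (rule Lim_bounded)
    show "(\<lambda>k. \<Sum>j<n. residue x y k j / x j) \<longlonglongrightarrow> (\<Sum>j<n. weight j / x j)"
      by (intro tendsto_intros residue_tendsto) (use x_pos in \<open>auto simp: less_le\<close>)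
    show "\<forall>k\<ge>n. (\<Sum>j<n. residue x y k j / x j) \<le> 1"
    proof (intro allI impI)
      fix k assume "n \<le> k"
      then have "(\<Sum>j<n. residue x y k j / x j) \<le> (\<Sum>j<k. residue x y k j / x j)"
        by (intro sum_mono2) (auto simp: residue_pos x_pos less_imp_le)
      also have "\<dots> \<le> 1"
        unfolding sum_residue_x using ratio_prod_pos[of k] by simp
      finally show "(\<Sum>j<n. residue x y k j / x j) \<le> 1" .
    qed
  qed
qed

lemma summable_weight: "summable weight"
proof (rule summable_comparison_test'[where N=0])
  show "summable (\<lambda>j. x 0 * (weight j / x j))"
    by (intro summable_mult summable_weight_x)
  show "norm (weight j) \<le> x 0 * (weight j / x j)" for j
    using weight_pos[of j] x_pos[of j] x_le[of 0 j] by (simp add: field_simps mult_left_mono)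
qed

text \<open>Dominated convergence: the residues lie below the weights, which are summable.\<close>

lemma sum_residue_tendsto:
  assumes "\<And>j. \<bar>g j\<bar> \<le> C"
  shows "(\<lambda>n. \<Sum>j<n. residue x y n j * g j) \<longlonglongrightarrow> (\<Sum>j. weight j * g j)"
    and "summable (\<lambda>j. weight j * g j)"
proof -
  \<comment> \<open>Terms with \<open>j \<ge> n\<close> are set to 0, which turns the finite sums
    into series with a common majorant.\<close>
  define f where "f j n = (if j < n then residue x y n j * g j else 0)" for j n
  have "eventually (\<lambda>n. summable (\<lambda>j. norm (f j n))) sequentially \<and>
      summable (\<lambda>j. norm (weight j * g j)) \<and>
      ((\<lambda>n. \<Sum>j. f j n) \<longlonglongrightarrow> (\<Sum>j. weight j * g j))"
  proof (rule tannerys_theorem)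
    show "(\<lambda>n. f j n) \<longlonglongrightarrow> weight j * g j" for j
    proof (rule Lim_transform_eventually)
      show "(\<lambda>n. residue x y n j * g j) \<longlonglongrightarrow> weight j * g j"
        by (intro tendsto_intros residue_tendsto)
      show "eventually (\<lambda>n. residue x y n j * g j = f j n) sequentially"
        using eventually_gt_at_top[of j] by eventually_elim (simp add: f_def)
    qed
    have "norm (f j n) \<le> weight j * C" for j n
    proof -
      have "residue x y n j * \<bar>g j\<bar> \<le> weight j * C" if "j < n"
        by (intro mult_mono residue_le_weight that assms) (use weight_pos[of j] in auto)
      then show ?thesis
        using assms[of j] weight_pos[of j] residue_pos[of n j]
        by (auto simp: f_def abs_mult zero_le_mult_iff)
    qed
    then show "eventually (\<lambda>(j, n). norm (f j n) \<le> weight j * C) (at_top \<times>\<^sub>F sequentially)"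
      by (intro always_eventually) auto
    show "summable (\<lambda>j. weight j * C)"
      by (intro summable_mult2 summable_weight)
  qed simp
  moreover have "(\<Sum>j. f j n) = (\<Sum>j<n. residue x y n j * g j)" for n
    by (subst suminf_finite[of "{..<n}"]) (auto simp: f_def)
  ultimately show "(\<lambda>n. \<Sum>j<n. residue x y n j * g j) \<longlonglongrightarrow> (\<Sum>j. weight j * g j)"
    "summable (\<lambda>j. weight j * g j)"
    by (auto intro: summable_norm_cancel)
qed

lemma inverse_distance_bounded: "\<exists>C. \<forall>j. \<bar>1 / (x j - y m)\<bar> \<le> C"
proof -
  have "(\<lambda>j. 1 / (x j - y m)) \<longlonglongrightarrow> 1 / (0 - y m)"
    by (intro tendsto_intros x_lim) (use y_pos[of m] in auto)
  then have "Bseq (\<lambda>j. 1 / (x j - y m))"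
    by (rule convergent_imp_Bseq[OF convergentI])
  then show ?thesis
    by (auto simp: Bseq_def)
qed

text \<open>For \<open>n > m\<close> the product vanishes at \<open>z = y m\<close>, so the finite
  sums are exactly 1; the limit is taken termwise.\<close>

lemma weight_sums_1: "(\<lambda>j. weight j / (x j - y m)) sums 1"
proof -
  obtain C where C: "\<And>j. \<bar>1 / (x j - y m)\<bar> \<le> C"
    using inverse_distance_bounded by blast
  have "(\<Sum>j<n. residue x y n j * (1 / (x j - y m))) = 1" if "m < n" for n
  proof -
    have "y m \<notin> x ` {..<n}"
      using x_ne_y by (metis imageE)
    moreover have "(\<Prod>k<n. (y k - y m) / (x k - y m)) = 0"
      using that by auto
    ultimately show ?thesis
      using sum_residue[of "y m" n] by simp
  qed
  then have "eventually (\<lambda>n. (\<Sum>j<n. residue x y n j * (1 / (x j - y m))) = 1) sequentially"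
    by (auto intro!: eventually_mono[OF eventually_gt_at_top[of m]])
  then have "(\<lambda>n. \<Sum>j<n. residue x y n j * (1 / (x j - y m))) \<longlonglongrightarrow> 1"
    by (simp add: tendsto_eventually)
  then have "(\<Sum>j. weight j * (1 / (x j - y m))) = 1"
    by (rule LIMSEQ_unique[OF sum_residue_tendsto(1)[OF C]])
  then show ?thesis
    using sum_residue_tendsto(2)[OF C] by (simp add: sums_iff)
qed

text \<open>
  Not an instance of \<open>sum_residue_tendsto\<close> because \<open>1 / x j\<close> is unbounded.
\<close>

lemma ratio_prod_tendsto: "ratio_prod \<longlonglongrightarrow> 1 - (\<Sum>j. weight j / x j)"
proof -
  define f where "f j n = (if j < n then residue x y n j / x j else 0)" for j n
  have "eventually (\<lambda>n. summable (\<lambda>j. norm (f j n))) sequentially \<and>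
      summable (\<lambda>j. norm (weight j / x j)) \<and>
      ((\<lambda>n. \<Sum>j. f j n) \<longlonglongrightarrow> (\<Sum>j. weight j / x j))"
  proof (rule tannerys_theorem)
    show "(\<lambda>n. f j n) \<longlonglongrightarrow> weight j / x j" for j
    proof (rule Lim_transform_eventually)
      show "(\<lambda>n. residue x y n j / x j) \<longlonglongrightarrow> weight j / x j"
        by (intro tendsto_intros residue_tendsto) (use x_pos[of j] in auto)
      show "eventually (\<lambda>n. residue x y n j / x j = f j n) sequentially"
        using eventually_gt_at_top[of j] by eventually_elim (simp add: f_def)
    qed
    have "norm (f j n) \<le> weight j / x j" for j n
      using residue_pos[of n j] weight_pos[of j] x_pos[of j] residue_le_weight[of j n]
      by (auto simp: f_def divide_right_mono)
    then show "eventually (\<lambda>(j, n). norm (f j n) \<le> weight j / x j) (at_top \<times>\<^sub>F sequentially)"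
      by (intro always_eventually) auto
  qed (simp_all add: summable_weight_x)
  moreover have "(\<Sum>j. f j n) = 1 - ratio_prod n" for n
    unfolding sum_residue_x[symmetric]
    by (subst suminf_finite[of "{..<n}"]) (auto simp: f_def)
  ultimately have "(\<lambda>n. 1 - (1 - ratio_prod n)) \<longlonglongrightarrow> 1 - (\<Sum>j. weight j / x j)"
    by (intro tendsto_diff) auto
  then show ?thesis
    by simp
qed

lemma weight_x_le_1: "(\<Sum>j. weight j / x j) \<le> 1"
proof -
  have "0 \<le> 1 - (\<Sum>j. weight j / x j)"
    by (rule Lim_bounded2[OF ratio_prod_tendsto, of 0]) (simp add: ratio_prod_pos less_imp_le)
  then show ?thesis
    by simp
qed

section \<open>Uniqueness of the weights\<close>

text \<open>What any realization imposes on the squared components of \<Gamma>\<delta> in its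
  eigenbasis, as checked in \<open>s_eq\<close>. The condition at 0 is an inequality because
  \<delta> may have a component in the kernel of \<Gamma>.\<close>

definition admissible :: "(nat \<Rightarrow> real) \<Rightarrow> bool" where
  "admissible a \<longleftrightarrow> (\<forall>j. 0 \<le> a j) \<and> summable (\<lambda>j. a j / x j) \<and> (\<Sum>j. a j / x j) \<le> 1 \<and>
     (\<forall>m. (\<lambda>j. a j / (x j - y m)) sums 1)"

lemma admissible_weight: "admissible weight"
  unfolding admissible_def
  using weight_pos summable_weight_x weight_x_le_1 weight_sums_1 by (auto intro: less_imp_le)

text \<open>
  Cancelling the zeros \<open>y k\<close>, \<open>k < n\<close>, against the poles \<open>x k\<close>, \<open>k \<le> n\<close>, \<open>k \<noteq> i\<close>, leaves the single
  term \<open>i\<close> and terms of known sign.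
\<close>

lemma admissible_bounds:
  assumes a: "admissible a" and n: "i \<le> n"
  defines "C \<equiv> \<Prod>k<n. ((if k < i then x k else x (Suc k)) - x i) / (y k - x i)"
  shows "x i - y n \<le> a i * C" "a i * C \<le> x i"
proof -
  \<comment> \<open>The poles \<open>x 0\<close>, ..., \<open>x n\<close> other than
    \<open>x i\<close>, renumbered by \<open>k < n\<close>.\<close>
  define p where "p k = (if k < i then x k else x (Suc k))" for k
  define w where "w j = a j * (\<Prod>k<n. (p k - x j) / (y k - x j))" for j
  have inj: "inj_on y {..<n}"
    by (auto simp: inj_on_def) (metis y_strict linorder_neqE_nat less_irrefl)
  have yx: "y k \<notin> range x" for k
    using x_ne_y by (metis rangeE)
  have w_zero: "w j = 0" if "j \<le> n" "j \<noteq> i" for j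
  proof -
    have "\<exists>k<n. p k = x j"
    proof (cases "j < i")
      case True
      then show ?thesis
        using n by (auto simp: p_def intro!: exI[of _ j])
    next
      case False
      then show ?thesis
        using that by (auto simp: p_def intro!: exI[of _ "j - 1"])
    qed
    then show ?thesis
      by (auto simp: w_def)
  qed
  have w_nonneg: "0 \<le> w j" if "n < j" for j
  proof -
    have "0 \<le> (\<Prod>k<n. (p k - x j) / (y k - x j))"
    proof (intro prod_nonneg ballI)
      fix k assume "k \<in> {..<n}"
      then have k: "k < n"
        by simp
      have "x j \<le> p k"
        using k that by (auto simp: p_def intro!: x_le)
      moreover have "x j < y k"
        using k that by (intro less_y) simp
      ultimately show "0 \<le> (p k - x j) / (y k - x j)"
        by simp
    qed
    then show ?thesis
      using a by (simp add: w_def admissible_def)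
  qed
  have wi: "w i = a i * C"
    by (simp add: w_def C_def p_def)
  \<comment> \<open>At \<open>y n\<close> the terms beyond \<open>n\<close> are at most 0 and those
    up to \<open>n\<close> vanish except the term \<open>i\<close>, which is therefore at least
    1.\<close>
  have 1: "(\<lambda>j. w j / (x j - y n)) sums 1"
  proof -
    have "y n \<notin> y ` {..<n}"
      using y_strict by force
    then show ?thesis
      unfolding w_def using sums_cancel_zeros[of n a x y "y n" 1 p] a inj yx
      by (auto simp: admissible_def)
  qed
  have "(\<lambda>j. if j = i then w j / (x j - y n) else 0) sums (w i / (x i - y n))"
    using sums_If_finite_set[of "{i}" "\<lambda>j. w j / (x j - y n)"] by simp
  then have "1 \<le> w i / (x i - y n)"
  proof (rule sums_le[rotated, OF 1])
    show "w j / (x j - y n) \<le> (if j = i then w j / (x j - y n) else 0)" for j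
    proof (cases "j \<le> n")
      case False
      then have "x j < y n"
        by (intro less_y) simp
      then show ?thesis
        using w_nonneg[of j] False n by (simp add: divide_nonneg_neg)
    qed (use w_zero in auto)
  qed
  moreover have "0 < x i - y n"
    using y_less n by simp
  ultimately show "x i - y n \<le> a i * C"
    by (simp add: wi)
  \<comment> \<open>At 0 the terms beyond \<open>n\<close> are nonnegative, and
    \<open>s \<le> 1\<close> keeps the total at most 1, so the term \<open>i\<close> is at most
    1.\<close>
  define s where "s = (\<Sum>j. a j / x j)"
  have 0: "(\<lambda>j. w j / (x j - 0)) sums (1 - (1 - s) * (\<Prod>k<n. (p k - 0) / (y k - 0)))"
    unfolding w_def
  proof (rule sums_cancel_zeros)
    show "0 \<notin> y ` {..<n}" "0 \<notin> range x"
      using x_pos y_pos by (force simp: less_le)+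
    show "(\<lambda>j. a j / (x j - 0)) sums s"
      using a by (simp add: s_def admissible_def summable_sums)
  qed (use a inj yx in \<open>auto simp: admissible_def\<close>)
  have "0 \<le> (1 - s) * (\<Prod>k<n. (p k - 0) / (y k - 0))"
    using a x_pos y_pos
    by (intro mult_nonneg_nonneg prod_nonneg)
      (auto simp: s_def admissible_def p_def intro!: divide_nonneg_nonneg less_imp_le)
  moreover have "w i / x i \<le> 1 - (1 - s) * (\<Prod>k<n. (p k - 0) / (y k - 0))"
  proof (rule sums_le)
    show "(\<lambda>j. if j = i then w j / x j else 0) sums (w i / x i)"
      using sums_If_finite_set[of "{i}" "\<lambda>j. w j / x j"] by simp
    show "(if j = i then w j / x j else 0) \<le> w j / (x j - 0)" for j
      using w_zero[of j] w_nonneg[of j] x_pos[of j] by (cases "j \<le> n") auto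
  qed (rule 0)
  ultimately have "w i / x i \<le> 1"
    by linarith
  then show "a i * C \<le> x i"
    using x_pos[of i] by (simp add: wi)
qed

text \<open>The product \<open>C n\<close> cancels between the lower bound for \<open>a\<close> and
  the upper bound for \<open>b\<close>; the remaining gap \<open>y n\<close> tends to 0. By symmetry
  two admissible sequences agree.\<close>

lemma admissible_le:
  assumes a: "admissible a" and b: "admissible b"
  shows "b i \<le> a i"
proof -
  define C where "C n = (\<Prod>k<n. ((if k < i then x k else x (Suc k)) - x i) / (y k - x i))" for n
  have "b i * (x i - y n) \<le> a i * x i" if "i \<le> n" for n
  proof -
    have "b i * (x i - y n) \<le> b i * (a i * C n)"
      using admissible_bounds(1)[OF a that] b
      by (intro mult_left_mono) (auto simp: C_def admissible_def)
    also have "\<dots> = a i * (b i * C n)"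
      by simp
    also have "\<dots> \<le> a i * x i"
      using admissible_bounds(2)[OF b that] a
      by (intro mult_left_mono) (auto simp: C_def admissible_def)
    finally show ?thesis .
  qed
  moreover have "(\<lambda>n. b i * (x i - y n)) \<longlonglongrightarrow> b i * (x i - 0)"
    by (intro tendsto_intros y_lim)
  ultimately have "b i * (x i - 0) \<le> a i * x i"
    by (metis Lim_bounded)
  then show ?thesis
    using x_pos[of i] by simp
qed

lemma admissible_unique: "admissible a \<Longrightarrow> a = weight"
  using admissible_le admissible_weight by (intro ext antisym) auto

section \<open>The two conditions of the kernel criterion in terms of the weights\<close>

text \<open>Since \<open>1 / (x j * (x j - x n))\<close> is \<open>1 / (x j - x n) - 1 / x j\<close>
  divided by \<open>x n\<close>, the partial fraction identity at \<open>x n\<close> and at 0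
  evaluates the sum.\<close>

lemma sum_upper_residue:
  "(\<Sum>j<n. upper_residue n j / (x j)\<^sup>2) + (\<Prod>k<n. (y k - x n) / (x k - x n)) / x n = ratio_prod n / x n"
proof -
  have "upper_residue n j / (x j)\<^sup>2 =
      (residue x y n j / (x j - x n) - residue x y n j / x j) / x n" if "j < n" for j
  proof -
    have "x j \<noteq> 0" "x n \<noteq> 0" "x j - x n \<noteq> 0"
      using x_pos[of j] x_pos[of n] that by auto
    then show ?thesis
      unfolding upper_residue_def
      by (simp add: divide_simps) (simp add: algebra_simps power2_eq_square)
  qed
  then have "(\<Sum>j<n. upper_residue n j / (x j)\<^sup>2) =
      ((\<Sum>j<n. residue x y n j / (x j - x n)) - (\<Sum>j<n. residue x y n j / x j)) / x n"
    by (simp add: sum_divide_distrib sum_subtractf[symmetric] diff_divide_distrib)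
  also have "\<dots> = (ratio_prod n - (\<Prod>k<n. (y k - x n) / (x k - x n))) / x n"
    by (subst sum_residue) (auto simp: sum_residue_x)
  finally show ?thesis
    by (simp add: diff_divide_distrib)
qed

lemma sum_weight_le_ratio: "(\<Sum>j<n. weight j / (x j)\<^sup>2) \<le> ratio_prod n / x n"
proof -
  have "(\<Sum>j<n. weight j / (x j)\<^sup>2) \<le> (\<Sum>j<n. upper_residue n j / (x j)\<^sup>2)"
    by (intro sum_mono divide_right_mono weight_le_upper) auto
  moreover have "0 \<le> (\<Prod>k<n. (y k - x n) / (x k - x n)) / x n"
    by (intro divide_nonneg_pos prod_nonneg x_pos)
      (auto intro!: divide_nonneg_pos less_imp_le simp: less_y)
  ultimately show ?thesis
    using sum_upper_residue[of n] by linarith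
qed

text \<open>Let F be 1 minus the transform of the weights. The first hypothesis says that F vanishes
  at 0, and \<open>E\<close> is minus its derivative there. The factors
  \<open>(x k - z) / (y k - z)\<close> with \<open>k < n\<close> keep this zero and divide the
  derivative by \<open>ratio_prod n\<close>.\<close>

lemma sums_square_cancel_zeros:
  assumes one: "(\<Sum>j. weight j / x j) = 1" and E: "(\<lambda>j. weight j / (x j)\<^sup>2) sums E"
  defines "w \<equiv> \<lambda>n j. weight j * (\<Prod>k<n. (x k - x j) / (y k - x j))"
  shows "(\<lambda>j. w n j / x j) sums 1 \<and> (\<lambda>j. w n j / (x j)\<^sup>2) sums (E / ratio_prod n)"
proof -
  have inj: "inj_on y {..<n}" for n
    by (auto simp: inj_on_def) (metis y_strict linorder_neqE_nat less_irrefl)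
  have yx: "y k \<notin> range x" for k
    using x_ne_y by (metis rangeE)
  have 1: "(\<lambda>j. w n j / x j) sums 1" for n
  proof -
    have "0 \<notin> y ` {..<n}" "0 \<notin> range x"
      using x_pos y_pos by (force simp: less_le)+
    moreover have "(\<lambda>j. weight j / (x j - 0)) sums 1"
      using one summable_weight_x by (simp add: sums_iff)
    ultimately show ?thesis
      using sums_cancel_zeros[of n weight x y 0 1 x] inj yx weight_sums_1 by (simp add: w_def)
  qed
  have yn: "(\<lambda>j. w n j / (x j - y n)) sums 1" for n
  proof -
    have "y n \<notin> y ` {..<n}"
      using y_strict by force
    then show ?thesis
      using sums_cancel_zeros[of n weight x y "y n" 1 x] inj yx weight_sums_1
      by (simp add: w_def)
  qed
  have "(\<lambda>j. w n j / (x j)\<^sup>2) sums (E / ratio_prod n)"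
  proof (induction n)
    case (Suc n)
    let ?A = "(y n - x n) / y n"
    let ?q = "x n / y n"
    \<comment> \<open>The first two sums both equal 1 and cancel; the last one carries the factor
      \<open>x n / y n\<close>.\<close>
    have "(\<lambda>j. (w n j / (x j - y n)) * (?A / y n) - (w n j / x j) * (?A / y n) + (w n j / (x j)\<^sup>2) * ?q)
        sums (1 * (?A / y n) - 1 * (?A / y n) + E / ratio_prod n * ?q)"
      by (intro sums_add sums_diff sums_mult2 yn 1 Suc.IH)
    moreover have "(w n j / (x j - y n)) * (?A / y n) - (w n j / x j) * (?A / y n) + (w n j / (x j)\<^sup>2) * ?q
        = w (Suc n) j / (x j)\<^sup>2" for j
    proof -
      have ne: "x j \<noteq> 0" "y n \<noteq> 0" "x j - y n \<noteq> 0" "y n - x j \<noteq> 0"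
        using x_pos[of j] y_pos[of n] x_ne_y[of j n] by auto
      have "(w n j / (x j - y n)) * (?A / y n) - (w n j / x j) * (?A / y n) + (w n j / (x j)\<^sup>2) * ?q
        = w n j * ((x n - x j) / (y n - x j)) / (x j)\<^sup>2"
        using ne by (simp add: divide_simps) (simp add: algebra_simps power2_eq_square)
      then show ?thesis
        by (simp add: w_def)
    qed
    moreover have "1 * (?A / y n) - 1 * (?A / y n) + E / ratio_prod n * ?q = E / ratio_prod (Suc n)"
      by simp
    ultimately show ?case
      by simp
  qed (use E in \<open>simp add: w_def\<close>)
  then show ?thesis
    using 1 by simp
qed

text \<open>After the cancellation the weights with \<open>j < n\<close> vanish. For the others
  \<open>x j \<le> x n\<close> compares the sum over \<open>1 / x j\<close>, which is 1, with the
  sum over \<open>1 / (x j)\<^sup>2\<close>.\<close>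

lemma ratio_le_sum_weight:
  assumes one: "(\<Sum>j. weight j / x j) = 1" and E: "(\<lambda>j. weight j / (x j)\<^sup>2) sums E"
  shows "ratio_prod n / x n \<le> E"
proof -
  define w where "w j = weight j * (\<Prod>k<n. (x k - x j) / (y k - x j))" for j
  have w: "(\<lambda>j. w j / x j) sums 1" "(\<lambda>j. w j / (x j)\<^sup>2) sums (E / ratio_prod n)"
    using sums_square_cancel_zeros[OF one E, of n] by (simp_all add: w_def)
  have "w j / x j \<le> x n * (w j / (x j)\<^sup>2)" for j
  proof (cases "j < n")
    case True
    then have "w j = 0"
      by (auto simp: w_def)
    then show ?thesis
      by simp
  next
    case False
    then have "x j \<le> x n"
      by (intro x_le) simp
    moreover have "0 \<le> w j"
      unfolding w_def using False weight_pos[of j]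
      by (intro mult_nonneg_nonneg prod_nonneg) (auto intro!: divide_nonneg_pos x_le simp: less_y)
    ultimately have "w j * x j \<le> x n * w j"
      by (simp add: mult_left_mono mult.commute)
    then show ?thesis
      using x_pos[of j] by (simp add: field_simps power2_eq_square)
  qed
  then have "1 \<le> x n * (E / ratio_prod n)"
    using w by (intro sums_le[OF _ w(1) sums_mult[OF w(2)]]) auto
  then show ?thesis
    using ratio_prod_pos[of n] x_pos[of n] by (simp add: field_simps)
qed

lemma summable_weight_square_iff:
  assumes "(\<Sum>j. weight j / x j) = 1"
  shows "summable (\<lambda>j. weight j / (x j)\<^sup>2) \<longleftrightarrow> bdd_above (range (\<lambda>n. ratio_prod n / x n))"
proof
  assume "summable (\<lambda>j. weight j / (x j)\<^sup>2)"
  then show "bdd_above (range (\<lambda>n. ratio_prod n / x n))"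
    using ratio_le_sum_weight[OF assms summable_sums] by (intro bdd_aboveI2) auto
next
  assume "bdd_above (range (\<lambda>n. ratio_prod n / x n))"
  then obtain M where M: "\<And>n. ratio_prod n / x n \<le> M"
    by (auto simp: bdd_above_def)
  show "summable (\<lambda>j. weight j / (x j)\<^sup>2)"
    using sum_weight_le_ratio M weight_pos
    by (intro summableI_nonneg_bounded[where x=M]) (auto intro: order_trans simp: less_imp_le)
qed

lemma SUP_ratio_eq_infinity_iff:
  "(SUP n. ereal (1 / x n * ratio_prod n)) = \<infinity> \<longleftrightarrow> \<not> bdd_above (range (\<lambda>n. ratio_prod n / x n))"
proof
  assume inf: "(SUP n. ereal (1 / x n * ratio_prod n)) = \<infinity>"
  show "\<not> bdd_above (range (\<lambda>n. ratio_prod n / x n))"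
  proof
    assume "bdd_above (range (\<lambda>n. ratio_prod n / x n))"
    then obtain M where "\<And>n. ratio_prod n / x n \<le> M"
      by (auto simp: bdd_above_def)
    then have "(SUP n. ereal (1 / x n * ratio_prod n)) \<le> ereal M"
      by (intro SUP_least) simp
    then show False
      using inf by simp
  qed
next
  assume unb: "\<not> bdd_above (range (\<lambda>n. ratio_prod n / x n))"
  show "(SUP n. ereal (1 / x n * ratio_prod n)) = \<infinity>"
  proof (rule SUP_PInfty)
    fix N :: nat
    obtain n where "real N \<le> ratio_prod n / x n"
      using unb by (force simp: bdd_above_def not_le dest: less_imp_le)
    then show "\<exists>n\<in>UNIV. ereal (real N) \<le> ereal (1 / x n * ratio_prod n)"
      by (auto intro!: exI[of _ n])
  qed
qed

text \<open>Both sides say that \<open>ratio_prod\<close> tends to 0: its limit is 1 minus the sum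
  on the right, and a product of numbers \<open>1 - t j\<close> with \<open>0 < t j < 1\<close>
  tends to 0 iff the \<open>t j\<close> have infinite sum.\<close>

lemma suminf_ereal_eq_infinity_iff:
  "(\<Sum>j. ereal (1 - y j / x j)) = \<infinity> \<longleftrightarrow> (\<Sum>j. weight j / x j) = 1"
proof -
  define t where "t j = 1 - y j / x j" for j
  have t: "0 < t j" "t j < 1" for j
    using y_less_x[of j] x_pos[of j] y_pos[of j] by (simp_all add: t_def)
  have P: "ratio_prod n = (\<Prod>k<n. 1 - t k)" for n
    by (simp add: t_def)
  have "(\<Sum>j. ereal (t j)) = \<infinity> \<longleftrightarrow> \<not> summable t"
  proof
    assume inf: "(\<Sum>j. ereal (t j)) = \<infinity>"
    show "\<not> summable t"
      using inf suminf_ereal'[of t] by auto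
  next
    assume "\<not> summable t"
    then show "(\<Sum>j. ereal (t j)) = \<infinity>"
      using summable_ereal[of t] t by (meson less_imp_le ereal_less_eq zero_ereal_def)
  qed
  moreover have "\<not> summable t \<longleftrightarrow> ratio_prod \<longlonglongrightarrow> 0"
  proof
    assume ns: "\<not> summable t"
    \<comment> \<open>From \<open>1 - t \<le> exp (- t)\<close>; a positive limit of the product
      would bound the partial sums of \<open>t\<close>.\<close>
    have le: "ratio_prod n \<le> exp (- (\<Sum>k<n. t k))" for n
    proof -
      have "ratio_prod n \<le> (\<Prod>k<n. exp (- t k))"
        unfolding P using t exp_ge_add_one_self[of "- t _"]
        by (intro prod_mono) (auto intro: less_imp_le)
      then show ?thesis
        by (simp add: exp_sum[symmetric] sum_negf)
    qed
    define L where "L = 1 - (\<Sum>j. weight j / x j)"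
    have L: "ratio_prod \<longlonglongrightarrow> L"
      using ratio_prod_tendsto by (simp add: L_def)
    have "decseq ratio_prod"
    proof (rule decseq_SucI)
      fix n
      have "ratio_prod n * (y n / x n) \<le> ratio_prod n * 1"
        using ratio_prod_pos[of n] y_less_x[of n] x_pos[of n] by (intro mult_left_mono) auto
      then show "ratio_prod (Suc n) \<le> ratio_prod n"
        by simp
    qed
    then have L_le: "L \<le> ratio_prod n" for n
      using L by (rule decseq_ge)
    have "\<not> 0 < L"
    proof
      assume "0 < L"
      have "(\<Sum>k<n. t k) \<le> - ln L" for n
      proof -
        have "L \<le> exp (- (\<Sum>k<n. t k))"
          using L_le le by (rule order_trans)
        then have "ln L \<le> - (\<Sum>k<n. t k)"
          using \<open>0 < L\<close> by (metis exp_ge_zero ln_exp ln_mono exp_gt_zero)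
        then show ?thesis
          by simp
      qed
      then have "summable t"
        by (rule summableI_nonneg_bounded[rotated]) (simp add: t less_imp_le)
      then show False
        using ns by simp
    qed
    moreover have "0 \<le> L"
      using weight_x_le_1 by (simp add: L_def)
    ultimately show "ratio_prod \<longlonglongrightarrow> 0"
      using L by (metis less_eq_real_def)
  next
    assume lim0: "ratio_prod \<longlonglongrightarrow> 0"
    show "\<not> summable t"
    proof
      assume s: "summable t"
      \<comment> \<open>With a tail sum below 1/2 the Weierstrass inequality keeps the tail products
        at least 1/2.\<close>
      obtain N where N: "(\<Sum>k. t (k + N)) < 1 / 2"
      proof -
        have "eventually (\<lambda>N. (\<Sum>k. t (k + N)) < 1 / 2) sequentially"
          using suminf_exist_split2[OF s] by (rule order_tendstoD) simp
        then show ?thesis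
          using that by (auto simp: eventually_sequentially)
      qed
      have "ratio_prod N / 2 \<le> ratio_prod (n + N)" for n
      proof -
        have "(\<Sum>k<n. t (k + N)) \<le> (\<Sum>k. t (k + N))"
          using s t by (intro sum_le_suminf) (auto intro: less_imp_le simp: summable_iff_shift)
        then have "1 / 2 \<le> 1 - (\<Sum>k<n. t (k + N))"
          using N by simp
        also have "\<dots> \<le> (\<Prod>k<n. 1 - t (k + N))"
          by (rule Weierstrass_prod_ineq) (use t in \<open>auto intro: less_imp_le\<close>)
        finally have "ratio_prod N * (1 / 2) \<le> ratio_prod N * (\<Prod>k<n. 1 - t (k + N))"
          using ratio_prod_pos by (intro mult_left_mono) (auto intro: less_imp_le)
        also have "\<dots> = ratio_prod (n + N)"
          unfolding P by (induction n) (simp_all add: mult.assoc)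
        finally show ?thesis
          by simp
      qed
      moreover have "(\<lambda>n. ratio_prod (n + N)) \<longlonglongrightarrow> 0"
        using lim0 by (rule LIMSEQ_ignore_initial_segment)
      ultimately have "ratio_prod N / 2 \<le> 0"
        by (intro Lim_bounded2[where N=0]) auto
      then show False
        using ratio_prod_pos[of N] by simp
    qed
  qed
  moreover have "ratio_prod \<longlonglongrightarrow> 0 \<longleftrightarrow> (\<Sum>j. weight j / x j) = 1"
    using ratio_prod_tendsto LIMSEQ_unique by fastforce
  ultimately show ?thesis
    by (simp add: t_def)
qed

end

section \<open>Bounded and compact operators on the sequence space\<close>

lemma ell2_scaleR_scaleC: "r *\<^sub>R x = complex_of_real r *\<^sub>C x"
  by (rule ell2_eqI) simp

lemma cinner_add_right: "cinner x (y + z) = cinner x y + cinner x z"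
  by (metis cinner_add_left cinner_commute complex_cnj_add)

lemma cinner_scaleC_left [simp]: "cinner (a *\<^sub>C x) y = a * cinner x y"
  using sums_mult[OF cinner_sums[of x y], of a] cinner_sums[of "a *\<^sub>C x" y]
  by (simp add: mult.assoc sums_unique2)

lemma cinner_scaleC_right [simp]: "cinner x (a *\<^sub>C y) = cnj a * cinner x y"
  by (metis cinner_scaleC_left cinner_commute complex_cnj_mult)

lemma cinner_self: "cinner x x = complex_of_real ((norm x)\<^sup>2)"
proof -
  have "Im (cinner x x) = 0"
    using arg_cong[OF cinner_commute[of x x], of Im] by simp
  moreover have "Re (cinner x x) = (norm x)\<^sup>2"
    by (simp add: power2_norm_eq_inner inner_ell2_def)
  ultimately show ?thesis
    by (simp add: complex_eq_iff)
qed

lemma norm_sums: "(\<lambda>n. (cmod (coord x n))\<^sup>2) sums (norm x)\<^sup>2"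
  using Re_cinner_self_sums[of x] by (simp add: cinner_self)

lemma norm_scaleC [simp]: "norm (a *\<^sub>C x) = cmod a * norm x"
proof -
  have "complex_of_real ((norm (a *\<^sub>C x))\<^sup>2) = (a * cnj a) * cinner x x"
    by (simp add: cinner_self[symmetric] del: of_real_power)
  also have "\<dots> = complex_of_real ((cmod a * norm x)\<^sup>2)"
    by (simp only: power_mult_distrib of_real_mult complex_norm_square cinner_self)
  finally have "(norm (a *\<^sub>C x))\<^sup>2 = (cmod a * norm x)\<^sup>2"
    by (simp only: of_real_eq_iff)
  then show ?thesis
    by (rule power2_eq_imp_eq) simp_all
qed

text \<open>A unimodular multiple of \<open>x\<close> makes the inner product real and nonnegative,
  where the real Cauchy-Schwarz inequality applies.\<close>

lemma cmod_cinner_le: "cmod (cinner x y) \<le> norm x * norm y"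
proof (cases "cinner x y = 0")
  case False
  define a where "a = cnj (cinner x y) / cmod (cinner x y)"
  have a: "cmod a = 1"
    using False by (simp add: a_def norm_divide)
  have "a * cinner x y = complex_of_real ((cmod (cinner x y))\<^sup>2) / cmod (cinner x y)"
    unfolding complex_norm_square by (simp add: a_def mult.commute)
  also have "\<dots> = complex_of_real (cmod (cinner x y))"
    using False by (simp add: power2_eq_square)
  finally have "cmod (cinner x y) = Re (a * cinner x y)"
    by simp
  also have "\<dots> = inner (a *\<^sub>C x) y"
    by (simp add: inner_ell2_def)
  also have "\<dots> \<le> norm (a *\<^sub>C x) * norm y"
    by (rule norm_cauchy_schwarz)
  finally show ?thesis
    by (simp add: a)
qed simp

interpretation cinner: bounded_bilinear cinner
proof
  show "\<exists>K. \<forall>a b. norm (cinner a b) \<le> norm a * norm b * K"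
    by (rule exI[of _ 1]) (simp add: cmod_cinner_le)
qed (simp_all add: cinner_add_left cinner_add_right ell2_scaleR_scaleC scaleR_conv_of_real)

interpretation scaleC: bounded_bilinear scaleC
proof
  show "\<exists>K. \<forall>a b. norm (a *\<^sub>C b) \<le> norm a * norm b * K"
    by (rule exI[of _ 1]) simp
qed (auto intro!: ell2_eqI simp: algebra_simps scaleR_conv_of_real)

lemma coord_sum: "coord (\<Sum>i\<in>A. f i) n = (\<Sum>i\<in>A. coord (f i) n)"
  by (induction A rule: infinite_finite_induct) auto

lemma cinner_ext: "(\<And>z. cinner x z = cinner y z) \<Longrightarrow> x = y"
  by (metis cinner.diff_left cinner_self eq_iff_diff_eq_0 of_real_eq_0_iff power_eq_0_iff norm_eq_zero)

definition unit_vec :: "nat \<Rightarrow> ell2" where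
  "unit_vec j = Abs_ell2 (\<lambda>n. if n = j then 1 else 0)"

lemma coord_unit_vec [simp]: "coord (unit_vec j) n = (if n = j then 1 else 0)"
proof -
  have "square_summable (\<lambda>n. if n = j then 1 else 0)"
    unfolding square_summable_def
    by (rule summable_finite[of "{j}"]) auto
  then show ?thesis
    by (simp add: unit_vec_def coord_Abs_ell2)
qed

lemma cinner_unit_vec [simp]: "cinner x (unit_vec j) = coord x j"
proof -
  have "(\<lambda>n. if n = j then coord x n else 0) sums coord x j"
    using sums_If_finite_set[of "{j}" "coord x"] by simp
  then show ?thesis
    using cinner_sums[of x "unit_vec j"]
    by (simp add: if_distrib[of cnj] mult_delta_right sums_unique2 cong: if_cong)
qed

lemma cinner_unit_vec_left [simp]: "cinner (unit_vec j) x = cnj (coord x j)"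
  by (metis cinner_commute cinner_unit_vec)

definition fin_comb :: "nat \<Rightarrow> (nat \<Rightarrow> complex) \<Rightarrow> (nat \<Rightarrow> ell2) \<Rightarrow> ell2" where
  "fin_comb n a g = (\<Sum>j<n. a j *\<^sub>C g j)"

lemma coord_fin_comb_unit [simp]: "coord (fin_comb n a unit_vec) k = (if k < n then a k else 0)"
  by (simp add: fin_comb_def coord_sum if_distrib[of "(*) _"] cong: if_cong)

lemma norm_fin_comb_orthonormal:
  assumes "\<And>i j. cinner (e i) (e j) = (if i = j then 1 else 0)"
  shows "(norm (fin_comb n a e))\<^sup>2 = (\<Sum>j<n. (cmod (a j))\<^sup>2)"
proof -
  have "complex_of_real ((norm (fin_comb n a e))\<^sup>2) = (\<Sum>j<n. a j * cnj (a j))"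
    unfolding cinner_self[symmetric] fin_comb_def cinner.sum_left cinner.sum_right
    by (simp add: assms if_distrib[of "(*) _"] mult.commute cong: if_cong)
  also have "\<dots> = complex_of_real (\<Sum>j<n. (cmod (a j))\<^sup>2)"
    by (simp only: complex_norm_square of_real_sum)
  finally show ?thesis
    by (simp only: of_real_eq_iff)
qed

lemma cinner_unit_vec_unit_vec: "cinner (unit_vec i) (unit_vec j) = (if i = j then 1 else 0)"
  by simp

lemma fin_comb_tendsto: "(\<lambda>n. fin_comb n (coord x) unit_vec) \<longlonglongrightarrow> x"
proof -
  define s where "s = (\<lambda>j. (cmod (coord x j))\<^sup>2)"
  have s: "s sums (norm x)\<^sup>2"
    unfolding s_def by (rule norm_sums)
  have "(norm (x - fin_comb n (coord x) unit_vec))\<^sup>2 = (norm x)\<^sup>2 - (\<Sum>j<n. s j)" for n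
  proof -
    have "(\<lambda>j. s j - (if j \<in> {..<n} then s j else 0)) sums ((norm x)\<^sup>2 - (\<Sum>j<n. s j))"
      by (intro sums_diff s sums_If_finite_set) simp
    moreover have "(\<lambda>j. s j - (if j \<in> {..<n} then s j else 0)) =
        (\<lambda>j. (cmod (coord (x - fin_comb n (coord x) unit_vec) j))\<^sup>2)"
      by (auto simp: s_def)
    ultimately show ?thesis
      using sums_unique2[OF norm_sums] by simp
  qed
  moreover have "(\<lambda>n. (norm x)\<^sup>2 - (\<Sum>j<n. s j)) \<longlonglongrightarrow> (norm x)\<^sup>2 - (norm x)\<^sup>2"
    using s by (intro tendsto_intros) (simp add: sums_def)
  ultimately have "(\<lambda>n. (norm (x - fin_comb n (coord x) unit_vec))\<^sup>2) \<longlonglongrightarrow> 0"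
    by simp
  then have "(\<lambda>n. sqrt ((norm (x - fin_comb n (coord x) unit_vec))\<^sup>2)) \<longlonglongrightarrow> sqrt 0"
    by (rule tendsto_real_sqrt)
  then have "(\<lambda>n. norm (fin_comb n (coord x) unit_vec - x)) \<longlonglongrightarrow> 0"
    by (simp add: norm_minus_commute)
  then show ?thesis
    by (simp add: LIM_zero_iff tendsto_norm_zero_iff)
qed

lemma cmod_coord_le: "cmod (coord x n) \<le> norm x"
proof -
  have "norm (unit_vec n) = 1"
    by (simp add: norm_ell2_def)
  then show ?thesis
    using cmod_cinner_le[of x "unit_vec n"] by simp
qed

lemma sum_coord_le: "(\<Sum>j<n. (cmod (coord x j))\<^sup>2) \<le> (norm x)\<^sup>2"
  using norm_sums[of x] sum_le_suminf[of "\<lambda>j. (cmod (coord x j))\<^sup>2" "{..<n}"]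
  by (simp add: sums_iff)

lemma norm_le_finite:
  assumes "0 \<le> C" "\<And>n. (\<Sum>j<n. (cmod (coord x j))\<^sup>2) \<le> C\<^sup>2"
  shows "norm x \<le> C"
proof -
  have "(norm x)\<^sup>2 \<le> C\<^sup>2"
    using norm_sums[of x] assms(2) by (auto simp: sums_def intro: Lim_bounded)
  then show ?thesis
    using assms(1) by (rule power2_le_imp_le)
qed

lemma square_summableI:
  assumes "\<And>n. (\<Sum>j<n. (cmod (x j))\<^sup>2) \<le> C"
  shows "square_summable x"
  unfolding square_summable_def by (rule summableI_nonneg_bounded[OF _ assms]) simp

section \<open>Completeness of the sequence space\<close>

instance ell2 :: complete_space
proof
  fix X :: "nat \<Rightarrow> ell2"
  assume X: "Cauchy X"
  have "Cauchy (\<lambda>m. coord (X m) n)" for n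
  proof (rule metric_CauchyI)
    fix e :: real assume "0 < e"
    then obtain M where M: "\<forall>m\<ge>M. \<forall>k\<ge>M. dist (X m) (X k) < e"
      using metric_CauchyD[OF X] by blast
    have "dist (coord (X m) n) (coord (X k) n) \<le> dist (X m) (X k)" for m k
      using cmod_coord_le[of "X m - X k" n] by (simp add: dist_norm)
    then show "\<exists>M. \<forall>m\<ge>M. \<forall>k\<ge>M. dist (coord (X m) n) (coord (X k) n) < e"
      using M by (meson le_less_trans)
  qed
  then have "\<exists>l. (\<lambda>m. coord (X m) n) \<longlonglongrightarrow> l" for n
    using Cauchy_convergent_iff convergent_def by blast
  then obtain y where y: "\<And>n. (\<lambda>m. coord (X m) n) \<longlonglongrightarrow> y n"
    by metis
  \<comment> \<open>On a finite block of coordinates the Cauchy bound passes to the coordinatewise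
    limit \<open>y\<close>; a bound for all blocks gives membership and convergence.\<close>
  have tail: "(\<Sum>j<n. (cmod (coord (X k) j - y j))\<^sup>2) \<le> e\<^sup>2"
    if M: "\<forall>m\<ge>M. \<forall>k\<ge>M. dist (X m) (X k) < e" and k: "M \<le> k" for M e k n
  proof (rule Lim_bounded)
    show "(\<lambda>m. \<Sum>j<n. (cmod (coord (X k) j - coord (X m) j))\<^sup>2) \<longlonglongrightarrow> (\<Sum>j<n. (cmod (coord (X k) j - y j))\<^sup>2)"
      by (intro tendsto_intros y)
    show "\<forall>m\<ge>M. (\<Sum>j<n. (cmod (coord (X k) j - coord (X m) j))\<^sup>2) \<le> e\<^sup>2"
    proof (intro allI impI)
      fix m assume "M \<le> m"
      have "(\<Sum>j<n. (cmod (coord (X k - X m) j))\<^sup>2) \<le> (norm (X k - X m))\<^sup>2"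
        by (rule sum_coord_le)
      also have "\<dots> \<le> e\<^sup>2"
        using M k \<open>M \<le> m\<close> by (intro power_mono) (auto simp: dist_norm less_imp_le)
      finally show "(\<Sum>j<n. (cmod (coord (X k) j - coord (X m) j))\<^sup>2) \<le> e\<^sup>2"
        by simp
    qed
  qed
  obtain M where M: "\<forall>m\<ge>M. \<forall>k\<ge>M. dist (X m) (X k) < 1"
    using metric_CauchyD[OF X, of 1] by auto
  have "square_summable (\<lambda>j. coord (X M) j - y j)"
    using tail[OF M order_refl] by (rule square_summableI)
  from square_summable_diff[OF square_summable_coord[of "X M"] this] have "square_summable y"
    by simp
  then obtain Y where Y: "\<And>n. coord Y n = y n"
    by (metis coord_Abs_ell2)
  have "X \<longlonglongrightarrow> Y"
  proof (rule metric_LIMSEQ_I)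
    fix e :: real assume "0 < e"
    then obtain M where M: "\<forall>m\<ge>M. \<forall>k\<ge>M. dist (X m) (X k) < e / 2"
      using metric_CauchyD[OF X, of "e / 2"] by auto
    have "dist (X k) Y < e" if "M \<le> k" for k
    proof -
      have "norm (X k - Y) \<le> e / 2"
        using tail[OF M that] \<open>0 < e\<close> by (intro norm_le_finite) (auto simp: Y)
      then show ?thesis
        using \<open>0 < e\<close> by (simp add: dist_norm)
    qed
    then show "\<exists>M. \<forall>k\<ge>M. dist (X k) Y < e"
      by blast
  qed
  then show "convergent X"
    by (rule convergentI)
qed

section \<open>Bounded complex-linear operators and their adjoints\<close>

definition bounded_op :: "(ell2 \<Rightarrow> ell2) \<Rightarrow> bool" where
  "bounded_op T \<longleftrightarrow> bounded_linear T \<and> (\<forall>a x. T (a *\<^sub>C x) = a *\<^sub>C T x)"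

lemma bounded_op_linear: "bounded_op T \<Longrightarrow> bounded_linear T"
  and bounded_op_scaleC: "bounded_op T \<Longrightarrow> T (a *\<^sub>C x) = a *\<^sub>C T x"
  by (simp_all add: bounded_op_def)

lemma bounded_opI:
  assumes "\<And>x y. T (x + y) = T x + T y" "\<And>a x. T (a *\<^sub>C x) = a *\<^sub>C T x"
    "\<And>x. norm (T x) \<le> C * norm x"
  shows "bounded_op T"
  unfolding bounded_op_def
proof (intro conjI allI bounded_linear_intro[where K=C])
  show "norm (T x) \<le> norm x * C" for x
    using assms(3)[of x] by (simp add: mult.commute)
qed (simp_all add: assms ell2_scaleR_scaleC)

lemma bounded_op_compose: "bounded_op S \<Longrightarrow> bounded_op T \<Longrightarrow> bounded_op (\<lambda>x. S (T x))"
  by (simp add: bounded_op_def bounded_linear_compose)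

lemma bounded_op_Vector_Spaces_linear: "bounded_op T \<Longrightarrow> Vector_Spaces.linear scaleC scaleC T"
  by unfold_locales (simp_all add: bounded_op_def linear_simps)

lemma bounded_op_fin_comb: "bounded_op T \<Longrightarrow> T (fin_comb n a g) = fin_comb n a (\<lambda>j. T (g j))"
  by (simp add: fin_comb_def linear_sum bounded_linear.linear bounded_op_def)

text \<open>The condition under which the map to the coefficients against \<open>g\<close> is an
  operator of norm at most \<open>C\<close>.\<close>

definition bessel :: "(nat \<Rightarrow> ell2) \<Rightarrow> real \<Rightarrow> bool" where
  "bessel g C \<longleftrightarrow> 0 \<le> C \<and> (\<forall>x n. (\<Sum>j<n. (cmod (cinner x (g j)))\<^sup>2) \<le> (C * norm x)\<^sup>2)"

definition analysis :: "(nat \<Rightarrow> ell2) \<Rightarrow> ell2 \<Rightarrow> ell2" where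
  "analysis g x = Abs_ell2 (\<lambda>n. cinner x (g n))"

text \<open>Coordinate \<open>j\<close> of the adjoint at \<open>x\<close> has to be
  \<open>cinner x (T (unit_vec j))\<close>, so the adjoint is the analysis map of the columns of
  \<open>T\<close>.\<close>

definition adj :: "(ell2 \<Rightarrow> ell2) \<Rightarrow> ell2 \<Rightarrow> ell2" where
  "adj T = analysis (\<lambda>j. T (unit_vec j))"

text \<open>Duality of synthesis and analysis: for the coefficients
  \<open>a j = cinner x (g j)\<close> the inner product of \<open>x\<close> with their combination
  is their square sum, and Cauchy-Schwarz bounds it by its own square root.\<close>

lemma besselI:
  assumes C: "0 \<le> C" and le: "\<And>n a. (norm (fin_comb n a g))\<^sup>2 \<le> C\<^sup>2 * (\<Sum>j<n. (cmod (a j))\<^sup>2)"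
  shows "bessel g C"
  unfolding bessel_def
proof (intro conjI allI C)
  fix x n
  define a where "a j = cinner x (g j)" for j
  define s where "s = (\<Sum>j<n. (cmod (a j))\<^sup>2)"
  have s: "0 \<le> s"
    unfolding s_def by (intro sum_nonneg) simp
  have "cinner x (fin_comb n a g) = complex_of_real s"
    by (simp add: fin_comb_def cinner.sum_right s_def a_def[symmetric] complex_norm_square[symmetric] mult.commute flip: of_real_power)
  then have "s \<le> norm x * norm (fin_comb n a g)"
    using cmod_cinner_le[of x "fin_comb n a g"] s by simp
  then have "s\<^sup>2 \<le> (norm x * norm (fin_comb n a g))\<^sup>2"
    using s by (intro power_mono) auto
  also have "\<dots> \<le> (norm x)\<^sup>2 * (C\<^sup>2 * s)"
    unfolding power_mult_distrib s_def by (intro mult_left_mono le) simp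
  finally have "s * s \<le> (C * norm x)\<^sup>2 * s"
    by (simp add: power2_eq_square algebra_simps)
  then show "s \<le> (C * norm x)\<^sup>2"
    using s by (cases "s = 0") auto
qed

lemma coord_analysis:
  assumes "bessel g C" shows "coord (analysis g x) n = cinner x (g n)"
proof -
  have "square_summable (\<lambda>n. cinner x (g n))"
    using assms unfolding bessel_def by (intro square_summableI) blast
  then show ?thesis
    by (simp add: analysis_def coord_Abs_ell2)
qed

lemma norm_analysis_le:
  assumes "bessel g C" shows "norm (analysis g x) \<le> C * norm x"
  using assms by (intro norm_le_finite) (auto simp: coord_analysis[OF assms] bessel_def)

lemma bounded_op_analysis:
  assumes "bessel g C" shows "bounded_op (analysis g)"
  by (rule bounded_opI[OF _ _ norm_analysis_le[OF assms]])
    (auto intro!: ell2_eqI simp: coord_analysis[OF assms] cinner_add_left)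

lemma bounded_op_bound:
  assumes "bounded_op T" shows "\<exists>C\<ge>0. \<forall>x. norm (T x) \<le> C * norm x"
  using bounded_linear.nonneg_bounded[OF bounded_op_linear[OF assms]] by (metis mult.commute)

lemma bessel_op:
  assumes "bounded_op T" "0 \<le> C" "\<And>x. norm (T x) \<le> C * norm x"
  shows "bessel (\<lambda>j. T (unit_vec j)) C"
proof (rule besselI[OF assms(2)])
  fix n a
  have "(norm (T (fin_comb n a unit_vec)))\<^sup>2 \<le> (C * norm (fin_comb n a unit_vec))\<^sup>2"
    using assms(3) by (intro power_mono) auto
  then show "(norm (fin_comb n a (\<lambda>j. T (unit_vec j))))\<^sup>2 \<le> C\<^sup>2 * (\<Sum>j<n. (cmod (a j))\<^sup>2)"
    by (simp add: bounded_op_fin_comb[OF assms(1)] power_mult_distrib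
        norm_fin_comb_orthonormal[OF cinner_unit_vec_unit_vec])
qed

lemma norm_adj_le:
  assumes "bounded_op T" "0 \<le> C" "\<And>x. norm (T x) \<le> C * norm x"
  shows "norm (adj T x) \<le> C * norm x"
  unfolding adj_def by (rule norm_analysis_le[OF bessel_op[OF assms]])

lemma bounded_op_adj: "bounded_op T \<Longrightarrow> bounded_op (adj T)"
  unfolding adj_def by (metis bounded_op_bound bessel_op bounded_op_analysis)

lemma cinner_adj_right:
  assumes T: "bounded_op T" shows "cinner x (adj T y) = cinner (T x) y"
proof -
  obtain C where C: "0 \<le> C" "\<And>x. norm (T x) \<le> C * norm x"
    using bounded_op_bound[OF T] by blast
  have coord: "coord (adj T y) j = cinner y (T (unit_vec j))" for j
    unfolding adj_def by (rule coord_analysis[OF bessel_op[OF T C]])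
  have "(\<lambda>n. cinner (T (fin_comb n (coord x) unit_vec)) y) \<longlonglongrightarrow> cinner (T x) y"
    by (intro cinner.tendsto tendsto_const bounded_linear.tendsto[OF bounded_op_linear[OF T]] fin_comb_tendsto)
  moreover have "cinner (T (fin_comb n (coord x) unit_vec)) y = (\<Sum>j<n. coord x j * cnj (coord (adj T y) j))" for n
    by (subst bounded_op_fin_comb[OF T])
      (simp add: fin_comb_def cinner.sum_left coord cinner_commute[of y])
  ultimately have "(\<lambda>j. coord x j * cnj (coord (adj T y) j)) sums cinner (T x) y"
    by (simp add: sums_def)
  then show ?thesis
    using cinner_sums sums_unique2 by blast
qed

lemma cinner_adj_left: "bounded_op T \<Longrightarrow> cinner (adj T x) y = cinner x (T y)"
  by (metis cinner_adj_right cinner_commute)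

lemma selfadjointD: "selfadjoint T \<Longrightarrow> cinner (T x) y = cinner x (T y)"
  by (simp add: selfadjoint_def)

section \<open>Compact operators\<close>

lemma compact_operator_bounded:
  assumes "compact_operator T" shows "bounded_op T"
proof -
  interpret Vector_Spaces.linear scaleC scaleC T
    using assms by (simp add: compact_operator_def)
  have "bounded (T ` cball 0 1)"
    using assms bounded_subset[OF compact_imp_bounded closure_subset] by (auto simp: compact_operator_def)
  then obtain C where "\<forall>z\<in>T ` cball 0 1. norm z \<le> C"
    unfolding bounded_iff by blast
  then have C: "norm (T x) \<le> C" if "norm x \<le> 1" for x
    using that by simp
  show ?thesis
  proof (rule bounded_opI)
    fix x
    show "norm (T x) \<le> C * norm x"
    proof (cases "x = 0")
      case False
      define y where "y = complex_of_real (inverse (norm x)) *\<^sub>C x"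
      have "x = complex_of_real (norm x) *\<^sub>C y"
        using False by (auto intro!: ell2_eqI simp: y_def)
      then have "norm (T x) = norm x * norm (T y)"
        by (metis scale norm_scaleC norm_of_real abs_norm_cancel)
      moreover have "norm (T y) \<le> C"
        using False by (intro C) (simp add: y_def norm_inverse)
      ultimately show ?thesis
        using mult_left_mono[of "norm (T y)" C "norm x"] by (simp add: mult.commute)
    qed (simp add: zero)
  qed (simp_all add: add scale)
qed

lemma compact_operatorI:
  assumes "bounded_op T" "compact K" "T ` cball 0 1 \<subseteq> K"
  shows "compact_operator T"
  unfolding compact_operator_def
proof
  show "Vector_Spaces.linear scaleC scaleC T"
    by (rule bounded_op_Vector_Spaces_linear[OF assms(1)])
  have "closure (T ` cball 0 1) \<subseteq> K"
    using assms by (intro closure_minimal compact_imp_closed)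
  then show "compact (closure (T ` cball 0 1))"
    using compact_Int_closed[OF assms(2) closed_closure] by (metis inf.absorb2)
qed

lemma compact_operator_convergent_subsequence:
  fixes x :: "nat \<Rightarrow> ell2"
  assumes T: "compact_operator T" and x: "\<And>n. norm (x n) \<le> C"
  obtains r L where "strict_mono r" "(\<lambda>n. T (x (r n))) \<longlonglongrightarrow> L"
proof -
  define D where "D = \<bar>C\<bar> + 1"
  have D: "0 < D"
    by (simp add: D_def)
  note bl = bounded_op_scaleC[OF compact_operator_bounded[OF T]]
  have "T (complex_of_real (1 / D) *\<^sub>C x n) \<in> closure (T ` cball 0 1)" for n
  proof -
    have "norm (x n) \<le> D"
      using x[of n] by (simp add: D_def)
    then have "norm (complex_of_real (1 / D) *\<^sub>C x n) \<le> 1"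
      using D by (simp add: norm_divide field_simps)
    then show ?thesis
      by (intro subsetD[OF closure_subset] imageI) simp
  qed
  moreover have "seq_compact (closure (T ` cball 0 1))"
    using T by (simp add: compact_operator_def compact_imp_seq_compact)
  ultimately obtain r L where r: "strict_mono r"
      and L: "((\<lambda>n. T (complex_of_real (1 / D) *\<^sub>C x n)) \<circ> r) \<longlonglongrightarrow> L"
    using seq_compactE[of "closure (T ` cball 0 1)" "\<lambda>n. T (complex_of_real (1 / D) *\<^sub>C x n)"]
    by blast
  have "(\<lambda>n. complex_of_real D *\<^sub>C T (complex_of_real (1 / D) *\<^sub>C x (r n))) \<longlonglongrightarrow> complex_of_real D *\<^sub>C L"
    using L by (intro scaleC.tendsto tendsto_const) (simp add: o_def)
  moreover have "complex_of_real D *\<^sub>C T (complex_of_real (1 / D) *\<^sub>C z) = T z" for z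
    using D by (auto intro!: ell2_eqI simp: bl)
  ultimately show ?thesis
    using r that by simp
qed

lemma compact_operator_rank_one: "compact_operator (\<lambda>x. cinner x g *\<^sub>C h)"
proof (rule compact_operatorI)
  show "bounded_op (\<lambda>x. cinner x g *\<^sub>C h)"
  proof (rule bounded_opI)
    show "norm (cinner x g *\<^sub>C h) \<le> (norm g * norm h) * norm x" for x
      using mult_right_mono[OF cmod_cinner_le[of x g] norm_ge_zero[of h]] by (simp add: algebra_simps)
  qed (simp_all add: cinner_add_left scaleC.add_left)
  show "compact ((\<lambda>a. a *\<^sub>C h) ` cball 0 (norm g))"
    by (intro compact_continuous_image continuous_intros scaleC.continuous_on compact_cball)
  show "(\<lambda>x. cinner x g *\<^sub>C h) ` cball 0 1 \<subseteq> (\<lambda>a. a *\<^sub>C h) ` cball 0 (norm g)"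
  proof (clarsimp, intro imageI)
    fix x :: ell2 assume "norm x \<le> 1"
    then show "cinner x g \<in> cball 0 (norm g)"
      using cmod_cinner_le[of x g] mult_left_le_one_le[of "norm g" "norm x"] by simp
  qed
qed

lemma compact_operator_add:
  assumes "compact_operator S" "compact_operator T"
  shows "compact_operator (\<lambda>x. S x + T x)"
proof (rule compact_operatorI)
  show "bounded_op (\<lambda>x. S x + T x)"
    using assms[THEN compact_operator_bounded]
    by (auto simp: bounded_op_def bounded_linear_add scaleC.add_right)
  show "compact {x + y | x y. x \<in> closure (S ` cball 0 1) \<and> y \<in> closure (T ` cball 0 1)}"
    using assms by (intro compact_sums) (auto simp: compact_operator_def)
  show "(\<lambda>x. S x + T x) ` cball 0 1 \<subseteq>
      {x + y | x y. x \<in> closure (S ` cball 0 1) \<and> y \<in> closure (T ` cball 0 1)}"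
    using closure_subset[of "S ` cball 0 1"] closure_subset[of "T ` cball 0 1"] by blast
qed

lemma compact_operator_sum:
  "finite A \<Longrightarrow> (\<And>i. i \<in> A \<Longrightarrow> compact_operator (T i)) \<Longrightarrow> compact_operator (\<lambda>x. \<Sum>i\<in>A. T i x)"
proof (induction A rule: finite_induct)
  case empty
  have "compact_operator (\<lambda>x. cinner x 0 *\<^sub>C 0)"
    by (rule compact_operator_rank_one)
  then show ?case
    by simp
qed (simp add: compact_operator_add)

lemma compact_operator_compose_left:
  assumes S: "bounded_op S" and T: "compact_operator T"
  shows "compact_operator (\<lambda>x. S (T x))"
proof (rule compact_operatorI)
  show "bounded_op (\<lambda>x. S (T x))"
    by (rule bounded_op_compose[OF S compact_operator_bounded[OF T]])
  show "compact (S ` closure (T ` cball 0 1))"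
    using T linear_continuous_on[OF bounded_op_linear[OF S]]
    by (intro compact_continuous_image) (auto simp: compact_operator_def)
  show "(\<lambda>x. S (T x)) ` cball 0 1 \<subseteq> S ` closure (T ` cball 0 1)"
    using closure_subset[of "T ` cball 0 1"] by blast
qed

lemma compact_operator_compose_right:
  assumes S: "bounded_op S" and T: "compact_operator T"
  shows "compact_operator (\<lambda>x. T (S x))"
proof -
  obtain C where C: "0 \<le> C" "\<And>x. norm (S x) \<le> C * norm x"
    using bounded_op_bound[OF S] by blast
  define D where "D = C + 1"
  have D: "0 < D"
    using C by (simp add: D_def)
  note T' = compact_operator_bounded[OF T]
  show ?thesis
  proof (rule compact_operatorI)
    show "bounded_op (\<lambda>x. T (S x))"
      by (rule bounded_op_compose[OF T' S])
    show "compact ((\<lambda>x. complex_of_real D *\<^sub>C x) ` closure (T ` cball 0 1))"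
      using T by (intro compact_continuous_image scaleC.continuous_on continuous_intros)
        (auto simp: compact_operator_def)
    show "(\<lambda>x. T (S x)) ` cball 0 1 \<subseteq> (\<lambda>x. complex_of_real D *\<^sub>C x) ` closure (T ` cball 0 1)"
    proof clarify
      fix x :: ell2 assume "x \<in> cball 0 1"
      then have "norm (S x) \<le> D"
        using C(2)[of x] C(1) mult_left_le[of "norm x" C] by (simp add: D_def)
      then have "norm (complex_of_real (1 / D) *\<^sub>C S x) \<le> 1"
        using D by (simp add: norm_divide field_simps)
      then have "T (complex_of_real (1 / D) *\<^sub>C S x) \<in> closure (T ` cball 0 1)"
        by (intro subsetD[OF closure_subset] imageI) simp
      moreover have "T (S x) = complex_of_real D *\<^sub>C T (complex_of_real (1 / D) *\<^sub>C S x)"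
        using D by (auto intro!: ell2_eqI simp: bounded_op_scaleC[OF T'])
      ultimately show "T (S x) \<in> (\<lambda>x. complex_of_real D *\<^sub>C x) ` closure (T ` cball 0 1)"
        by (rule rev_image_eqI)
    qed
  qed
qed

text \<open>Total boundedness: a finite \<open>e / 3\<close> net for the image under a nearby
  compact operator serves for \<open>T\<close>. Closed balls of radius \<open>2 * e / 3\<close> also
  cover the closure and fit into open balls of radius \<open>e\<close>.\<close>

lemma compact_operator_limit:
  assumes T: "bounded_op T"
    and approx: "\<And>e. 0 < e \<Longrightarrow> \<exists>T'. compact_operator T' \<and> (\<forall>x. norm (T x - T' x) \<le> e * norm x)"
  shows "compact_operator T"
proof -
  have "compact (closure (T ` cball 0 1))"
    unfolding compact_eq_totally_bounded
  proof (intro conjI allI impI)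
    show "complete (closure (T ` cball 0 1))"
      by (simp add: complete_eq_closed)
    fix e :: real assume e: "0 < e"
    obtain T' where T': "compact_operator T'" and le: "\<And>x. norm (T x - T' x) \<le> e / 3 * norm x"
      using approx[of "e / 3"] e by auto
    have "\<exists>k. finite k \<and> closure (T' ` cball 0 1) \<subseteq> (\<Union>x\<in>k. ball x (e / 3))"
      using T' e by (auto simp: compact_operator_def compact_eq_totally_bounded)
    then obtain k where k: "finite k" "closure (T' ` cball 0 1) \<subseteq> (\<Union>x\<in>k. ball x (e / 3))"
      by blast
    have "T ` cball 0 1 \<subseteq> (\<Union>c\<in>k. cball c (2 * e / 3))"
    proof clarify
      fix x :: ell2 assume x: "x \<in> cball 0 1"
      then have "T' x \<in> closure (T' ` cball 0 1)"
        by (intro subsetD[OF closure_subset] imageI)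
      then obtain c where c: "c \<in> k" "dist c (T' x) < e / 3"
        using k by auto
      have "e / 3 * norm x \<le> e / 3 * 1"
        using x e by (intro mult_left_mono) auto
      then have "dist (T' x) (T x) \<le> e / 3"
        using le[of x] by (simp add: dist_norm norm_minus_commute)
      then have "dist c (T x) \<le> 2 * e / 3"
        using c dist_triangle[of c "T x" "T' x"] by simp
      then show "T x \<in> (\<Union>c\<in>k. cball c (2 * e / 3))"
        using c by auto
    qed
    then have "closure (T ` cball 0 1) \<subseteq> (\<Union>c\<in>k. cball c (2 * e / 3))"
      by (rule closure_minimal) (use k in auto)
    also have "\<dots> \<subseteq> (\<Union>c\<in>k. ball c e)"
      using e by (intro UN_mono) auto
    finally show "\<exists>k. finite k \<and> closure (T ` cball 0 1) \<subseteq> (\<Union>x\<in>k. ball x e)"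
      using k by blast
  qed
  then show ?thesis
    using T by (simp add: compact_operator_def bounded_op_Vector_Spaces_linear)
qed

section \<open>Diagonal operators\<close>

definition diag :: "(nat \<Rightarrow> real) \<Rightarrow> ell2 \<Rightarrow> ell2" where
  "diag d = analysis (\<lambda>j. complex_of_real (d j) *\<^sub>C unit_vec j)"

lemma bessel_diag:
  assumes "\<And>j. \<bar>d j\<bar> \<le> C"
  shows "bessel (\<lambda>j. complex_of_real (d j) *\<^sub>C unit_vec j) C"
  unfolding bessel_def
proof (intro conjI allI)
  show C: "0 \<le> C"
    using assms[of 0] by simp
  fix x n
  have "(\<Sum>j<n. (cmod (cinner x (complex_of_real (d j) *\<^sub>C unit_vec j)))\<^sup>2) \<le> (\<Sum>j<n. C\<^sup>2 * (cmod (coord x j))\<^sup>2)"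
    using assms C
    by (intro sum_mono) (simp add: norm_mult power_mult_distrib mult_right_mono abs_le_square_iff[symmetric])
  also have "\<dots> \<le> C\<^sup>2 * (norm x)\<^sup>2"
    unfolding sum_distrib_left[symmetric]
    by (intro mult_left_mono sum_coord_le) simp
  finally show "(\<Sum>j<n. (cmod (cinner x (complex_of_real (d j) *\<^sub>C unit_vec j)))\<^sup>2) \<le> (C * norm x)\<^sup>2"
    by (simp add: power_mult_distrib)
qed

lemma coord_diag:
  assumes "\<And>j. \<bar>d j\<bar> \<le> C" shows "coord (diag d x) j = complex_of_real (d j) * coord x j"
  unfolding diag_def by (simp add: coord_analysis[OF bessel_diag[of d C]] assms)

lemma norm_diag_le: "(\<And>j. \<bar>d j\<bar> \<le> C) \<Longrightarrow> norm (diag d x) \<le> C * norm x"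
  unfolding diag_def by (rule norm_analysis_le[OF bessel_diag])

lemma bounded_op_diag: "(\<And>j. \<bar>d j\<bar> \<le> C) \<Longrightarrow> bounded_op (diag d)"
  unfolding diag_def by (rule bounded_op_analysis[OF bessel_diag])

lemma selfadjoint_diag:
  assumes "\<And>j. \<bar>d j\<bar> \<le> C" shows "selfadjoint (diag d)"
  unfolding selfadjoint_def cinner_def
  by (simp add: coord_diag[of d C] assms mult.assoc mult.left_commute)

lemma compact_operator_diag:
  assumes d: "d \<longlonglongrightarrow> 0"
  shows "compact_operator (diag d)"
proof -
  have "Bseq d"
    using d by (intro convergent_imp_Bseq convergentI)
  then obtain C where C: "\<And>j. \<bar>d j\<bar> \<le> C"
    by (auto simp: Bseq_def)
  show ?thesis
  proof (rule compact_operator_limit[OF bounded_op_diag[OF C]])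
    fix e :: real assume e: "0 < e"
    then obtain N where N: "\<And>j. N \<le> j \<Longrightarrow> \<bar>d j\<bar> < e"
      using LIMSEQ_D[OF d e] by auto
    define T' where "T' x = (\<Sum>j<N. cinner x (unit_vec j) *\<^sub>C (complex_of_real (d j) *\<^sub>C unit_vec j))" for x
    have T': "compact_operator T'"
      unfolding T'_def by (intro compact_operator_sum compact_operator_rank_one) simp
    have "norm (diag d x - T' x) \<le> e * norm x" for x
    proof -
      \<comment> \<open>The remainder after truncation is again diagonal, with entries at most
        \<open>e\<close> in modulus.\<close>
      define d' where "d' j = (if j < N then 0 else d j)" for j
      have d': "\<bar>d' j\<bar> \<le> e" for j
        using N[of j] e by (auto simp: d'_def)
      have "coord (T' x) j = (if j < N then complex_of_real (d j) * coord x j else 0)" for j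
        by (simp add: T'_def coord_sum if_distrib[of "(*) _"] cong: if_cong)
      then have "diag d x - T' x = diag d' x"
        by (auto intro!: ell2_eqI simp: coord_diag[OF C] coord_diag[OF d'] d'_def)
      then show ?thesis
        using norm_diag_le[OF d'] by simp
    qed
    then show "\<exists>T'. compact_operator T' \<and> (\<forall>x. norm (diag d x - T' x) \<le> e * norm x)"
      using T' by blast
  qed
qed

section \<open>Diagonalization and Hankel operators\<close>

text \<open>Expanding the square of \<open>norm (S (T x) - x)\<close>, with \<open>S\<close> adjoint
  to \<open>T\<close>, leaves nothing positive. This equality case serves recurrent vectors, the
  isometry \<open>V\<close> and the projection of the first unit vector.\<close>

lemma contraction_isometric_point:
  assumes adj: "\<And>x y. cinner (T x) y = cinner x (S y)"
    and S: "\<And>x. norm (S x) \<le> norm x" and x: "norm (T x) = norm x"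
  shows "S (T x) = x"
proof -
  have "inner (S (T x)) x = inner (T x) (T x)"
    by (metis adj inner_commute inner_ell2_def)
  then have "(norm (S (T x) - x))\<^sup>2 = (norm (S (T x)))\<^sup>2 - 2 * (norm (T x))\<^sup>2 + (norm x)\<^sup>2"
    by (simp add: power2_norm_eq_inner inner_diff_left inner_diff_right inner_commute)
  also have "\<dots> \<le> (norm (T x))\<^sup>2 - 2 * (norm (T x))\<^sup>2 + (norm x)\<^sup>2"
    using S[of "T x"] by (simp add: power_mono)
  also have "\<dots> = 0"
    by (simp add: x)
  finally show ?thesis
    by simp
qed

lemma selfadjoint_inner: "selfadjoint T \<Longrightarrow> inner (T x) y = inner x (T y)"
  by (simp add: selfadjoint_def inner_ell2_def)

lemma selfadjoint_compose: "selfadjoint T \<Longrightarrow> bounded_op W \<Longrightarrow> selfadjoint (\<lambda>x. adj W (T (W x)))"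
  by (simp add: selfadjoint_def cinner_adj_left cinner_adj_right)

lemma selfadjoint_compose': "selfadjoint T \<Longrightarrow> bounded_op W \<Longrightarrow> selfadjoint (\<lambda>x. W (T (adj W x)))"
  by (simp add: selfadjoint_def flip: cinner_adj_left cinner_adj_right)

text \<open>A maximizing sequence for \<open>norm (T x)\<close> on the unit sphere of
  \<open>M\<close> has a subsequence with a limit \<open>w\<close> such that
  \<open>T (T w) = s\<^sup>2 *\<^sub>R w\<close>, where \<open>s\<close> is the supremum. Factoring
  the equation gives an eigenvalue \<open>s\<close> or \<open>- s\<close>.\<close>

lemma compact_selfadjoint_eigenvector:
  assumes T: "compact_operator T" "selfadjoint T"
    and M: "closed M" "subspace M" "\<And>x. x \<in> M \<Longrightarrow> T x \<in> M"
    and g: "g \<in> M" "T g \<noteq> 0"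
  obtains h z where "h \<in> M" "h \<noteq> 0" "z \<noteq> 0" "T h = z *\<^sub>R h"
proof -
  have bl: "bounded_linear T"
    by (rule bounded_op_linear[OF compact_operator_bounded[OF T(1)]])
  interpret bounded_linear T
    by (rule bl)
  obtain C where C: "\<And>x. norm (T x) \<le> norm x * C"
    using bounded by blast
  define A where "A = {norm (T x) | x. x \<in> M \<and> norm x = 1}"
  define s where "s = Sup A"
  have "norm (T x) \<le> C" if "norm x = 1" for x
    using C[of x] that by simp
  then have bdd: "bdd_above A"
    by (auto simp: A_def bdd_above_def)
  have le_s: "norm (T x) \<le> s * norm x" if "x \<in> M" for x
  proof (cases "x = 0")
    case False
    have "norm (T (x /\<^sub>R norm x)) \<in> A"
      using False that M(2) by (auto simp: A_def subspace_scale intro!: exI[of _ "x /\<^sub>R norm x"])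
    then have "norm (T (x /\<^sub>R norm x)) \<le> s"
      unfolding s_def using bdd by (rule cSup_upper)
    then show ?thesis
      using False by (simp add: scale divide_simps mult.commute)
  qed (simp add: zero)
  have "0 < norm (T g)"
    using g by simp
  also have "\<dots> \<le> s * norm g"
    by (rule le_s[OF g(1)])
  finally have s: "0 < s"
    using norm_ge_zero[of g] by (simp add: zero_less_mult_iff)
  have "g \<noteq> 0"
    using g zero by auto
  then have "norm (T (g /\<^sub>R norm g)) \<in> A"
    using g M(2) by (auto simp: A_def subspace_scale intro!: exI[of _ "g /\<^sub>R norm g"])
  then have ne: "A \<noteq> {}"
    by blast
  have "\<exists>x. x \<in> M \<and> norm x = 1 \<and> s - 1 / real (Suc n) < norm (T x)" for n
  proof -
    have "\<exists>a\<in>A. s - 1 / real (Suc n) < a"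
      using less_cSup_iff[OF ne bdd, of "s - 1 / real (Suc n)"] by (simp add: s_def)
    then show ?thesis
      by (auto simp: A_def)
  qed
  then obtain x where x: "\<And>n. x n \<in> M" "\<And>n. norm (x n) = 1" "\<And>n. s - 1 / real (Suc n) < norm (T (x n))"
    by metis
  obtain r L where r: "strict_mono r" and L: "(\<lambda>n. T (x (r n))) \<longlonglongrightarrow> L"
    using compact_operator_convergent_subsequence[OF T(1), of x 1] x(2) by auto
  have "(\<lambda>n. norm (T (x n))) \<longlonglongrightarrow> s"
  proof (rule tendsto_sandwich)
    show "eventually (\<lambda>n. s - 1 / real (Suc n) \<le> norm (T (x n))) sequentially"
      using x(3) by (simp add: less_imp_le)
    show "eventually (\<lambda>n. norm (T (x n)) \<le> s) sequentially"
      using le_s[OF x(1)] x(2) by simp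
    have "(\<lambda>n. s - 1 / real (Suc n)) \<longlonglongrightarrow> s - 0"
      by (intro tendsto_intros LIMSEQ_Suc[OF lim_1_over_n])
    then show "(\<lambda>n. s - 1 / real (Suc n)) \<longlonglongrightarrow> s"
      by simp
  qed (rule tendsto_const)
  then have norm_lim: "(\<lambda>n. norm (T (x (r n)))) \<longlonglongrightarrow> s"
    using LIMSEQ_subseq_LIMSEQ[OF _ r] by (auto simp: o_def)
  \<comment> \<open>Where the supremum is almost attained, the eigenvector equation of the square
    almost holds.\<close>
  have diff: "(norm (T (T (x n)) - s\<^sup>2 *\<^sub>R x n))\<^sup>2 \<le> s\<^sup>2 * (s\<^sup>2 - (norm (T (x n)))\<^sup>2)" for n
  proof -
    have "(norm (T (T (x n)) - s\<^sup>2 *\<^sub>R x n))\<^sup>2 =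
        (norm (T (T (x n))))\<^sup>2 - 2 * s\<^sup>2 * (norm (T (x n)))\<^sup>2 + s\<^sup>2 * s\<^sup>2 * (norm (x n))\<^sup>2"
      unfolding power2_norm_eq_inner
      by (simp add: inner_diff_left inner_diff_right inner_commute selfadjoint_inner[OF T(2)] algebra_simps)
    moreover have "(norm (T (T (x n))))\<^sup>2 \<le> s\<^sup>2 * (norm (T (x n)))\<^sup>2"
      using power_mono[OF le_s[OF M(3)[OF x(1)]], of n 2] by (simp add: power_mult_distrib)
    ultimately show ?thesis
      by (simp add: x(2) algebra_simps)
  qed
  have "(\<lambda>n. (norm (T (T (x (r n))) - s\<^sup>2 *\<^sub>R x (r n)))\<^sup>2) \<longlonglongrightarrow> 0"
  proof (rule tendsto_sandwich[where f="\<lambda>_. 0"])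
    show "eventually (\<lambda>n. (norm (T (T (x (r n))) - s\<^sup>2 *\<^sub>R x (r n)))\<^sup>2 \<le>
        s\<^sup>2 * (s\<^sup>2 - (norm (T (x (r n))))\<^sup>2)) sequentially"
      using diff by simp
    have "(\<lambda>n. s\<^sup>2 * (s\<^sup>2 - (norm (T (x (r n))))\<^sup>2)) \<longlonglongrightarrow> s\<^sup>2 * (s\<^sup>2 - s\<^sup>2)"
      by (intro tendsto_intros norm_lim)
    then show "(\<lambda>n. s\<^sup>2 * (s\<^sup>2 - (norm (T (x (r n))))\<^sup>2)) \<longlonglongrightarrow> 0"
      by simp
  qed auto
  then have "(\<lambda>n. sqrt ((norm (T (T (x (r n))) - s\<^sup>2 *\<^sub>R x (r n)))\<^sup>2)) \<longlonglongrightarrow> sqrt 0"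
    by (rule tendsto_real_sqrt)
  then have d0: "(\<lambda>n. T (T (x (r n))) - s\<^sup>2 *\<^sub>R x (r n)) \<longlonglongrightarrow> 0"
    by (simp add: tendsto_norm_zero_iff)
  \<comment> \<open>The vectors themselves converge because \<open>T (T (x (r n)))\<close> does and
    \<open>s\<close> is not 0.\<close>
  define w where "w = (1 / s\<^sup>2) *\<^sub>R T L"
  have "(\<lambda>n. (1 / s\<^sup>2) *\<^sub>R (T (T (x (r n))) - (T (T (x (r n))) - s\<^sup>2 *\<^sub>R x (r n)))) \<longlonglongrightarrow> (1 / s\<^sup>2) *\<^sub>R (T L - 0)"
    by (intro tendsto_intros tendsto L d0)
  then have w: "(\<lambda>n. x (r n)) \<longlonglongrightarrow> w"
    using s by (simp add: w_def)
  have "w \<in> M"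
    using closed_sequentially[OF M(1), of "\<lambda>n. x (r n)" w] x(1) w by blast
  have "norm w = 1"
    using tendsto_norm[OF w] x(2) by (simp add: LIMSEQ_const_iff)
  have TTw: "T (T w) = s\<^sup>2 *\<^sub>R w"
  proof -
    have "(\<lambda>n. T (T (x (r n))) - s\<^sup>2 *\<^sub>R x (r n)) \<longlonglongrightarrow> T (T w) - s\<^sup>2 *\<^sub>R w"
      by (intro tendsto_intros tendsto w)
    then have "T (T w) - s\<^sup>2 *\<^sub>R w = 0"
      using d0 LIMSEQ_unique by blast
    then show ?thesis
      by simp
  qed
  show thesis
  \<comment> \<open>The vector \<open>T w + s *\<^sub>R w\<close> solves the equation for
    \<open>s\<close>; if it is 0, then \<open>w\<close> belongs to \<open>- s\<close>.\<close>
  proof (cases "T w + s *\<^sub>R w = 0")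
    case True
    then have "T w = (- s) *\<^sub>R w"
      by (simp add: eq_neg_iff_add_eq_0)
    moreover have "w \<noteq> 0"
      using \<open>norm w = 1\<close> by auto
    ultimately show thesis
      using that[of w "- s"] \<open>w \<in> M\<close> s by simp
  next
    case False
    have "T (T w + s *\<^sub>R w) = s *\<^sub>R (T w + s *\<^sub>R w)"
      by (simp add: add scale TTw scaleR_add_right power2_eq_square)
    moreover have "T w + s *\<^sub>R w \<in> M"
      using M \<open>w \<in> M\<close> by (simp add: subspace_add subspace_scale)
    ultimately show thesis
      using that[of "T w + s *\<^sub>R w" s] False s by simp
  qed
qed

section \<open>Diagonalization along an orthonormal sequence\<close>

definition orthonormal :: "(nat \<Rightarrow> ell2) \<Rightarrow> bool" where
  "orthonormal e \<longleftrightarrow> (\<forall>i j. cinner (e i) (e j) = (if i = j then 1 else 0))"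

lemma orthonormal_unit_vec: "orthonormal unit_vec"
  by (simp add: orthonormal_def)

lemma bessel_orthonormal: "orthonormal e \<Longrightarrow> bessel e 1"
  by (rule besselI) (simp_all add: norm_fin_comb_orthonormal orthonormal_def)

lemmas coord_analysis_orthonormal = coord_analysis[OF bessel_orthonormal]
lemmas bounded_op_analysis_orthonormal = bounded_op_analysis[OF bessel_orthonormal]

lemma analysis_orthonormal_self: "orthonormal e \<Longrightarrow> analysis e (e j) = unit_vec j"
  by (rule ell2_eqI) (simp add: coord_analysis_orthonormal orthonormal_def)

lemma analysis_adj_analysis:
  assumes "orthonormal e" shows "analysis e (adj (analysis e) w) = w"
  by (rule ell2_eqI)
    (simp add: coord_analysis_orthonormal assms cinner_adj_left bounded_op_analysis_orthonormal
      analysis_orthonormal_self)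

lemma adj_analysis_unit_vec:
  assumes "orthonormal e" shows "adj (analysis e) (unit_vec j) = e j"
proof (rule cinner_ext)
  fix z
  have "cinner (adj (analysis e) (unit_vec j)) z = cinner (unit_vec j) (analysis e z)"
    by (rule cinner_adj_left[OF bounded_op_analysis_orthonormal[OF assms]])
  also have "\<dots> = cnj (cinner z (e j))"
    by (simp add: coord_analysis_orthonormal[OF assms])
  finally show "cinner (adj (analysis e) (unit_vec j)) z = cinner (e j) z"
    by (simp add: cinner_commute[of z])
qed

text \<open>The sequence may be incomplete: what is orthogonal to it lies in the kernel, whose size
  stays open.\<close>

definition diagonalizes :: "(ell2 \<Rightarrow> ell2) \<Rightarrow> (nat \<Rightarrow> real) \<Rightarrow> (nat \<Rightarrow> ell2) \<Rightarrow> bool" where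
  "diagonalizes T l e \<longleftrightarrow> orthonormal e \<and> (\<forall>j. T (e j) = complex_of_real (l j) *\<^sub>C e j) \<and>
     (\<forall>g. (\<forall>j. cinner g (e j) = 0) \<longrightarrow> T g = 0)"

text \<open>The orthogonal complement of the eigenvectors is closed and invariant; if
  \<open>T\<close> were nonzero on it, it would contain an eigenvector with nonzero eigenvalue,
  against the last hypothesis.\<close>

lemma diagonalizesI:
  assumes T: "compact_operator T" "selfadjoint T" and e: "orthonormal e"
    and eig: "\<And>j. T (e j) = complex_of_real (l j) *\<^sub>C e j"
    and max: "\<And>h z. z \<noteq> 0 \<Longrightarrow> T h = complex_of_real z *\<^sub>C h \<Longrightarrow> (\<And>j. cinner h (e j) = 0) \<Longrightarrow> h = 0"
  shows "diagonalizes T l e"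
  unfolding diagonalizes_def
proof (intro conjI allI impI e eig)
  fix g assume g: "\<forall>j. cinner g (e j) = 0"
  define M where "M = {g. \<forall>j. cinner g (e j) = 0}"
  have "closed M"
    unfolding M_def
    by (intro closed_Collect_all closed_Collect_eq cinner.continuous_on continuous_intros)
  have "subspace M"
    by (simp add: M_def subspace_def cinner_add_left cinner_scaleR_left cinner.zero_left)
  have "T x \<in> M" if "x \<in> M" for x
    using that by (simp add: M_def selfadjointD[OF T(2)] eig)
  have "g \<in> M"
    using g by (simp add: M_def)
  show "T g = 0"
  proof (rule ccontr)
    assume "T g \<noteq> 0"
    then obtain h z where h: "h \<in> M" "h \<noteq> 0" "z \<noteq> 0" "T h = z *\<^sub>R h"
      using compact_selfadjoint_eigenvector[OF T \<open>closed M\<close> \<open>subspace M\<close>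
          \<open>\<And>x. x \<in> M \<Longrightarrow> T x \<in> M\<close> \<open>g \<in> M\<close>] by blast
    then show False
      using max[of z h] by (simp add: M_def ell2_scaleR_scaleC)
  qed
qed

lemma diagonalizes_analysis:
  assumes "diagonalizes T l e" "selfadjoint T" "\<And>j. \<bar>l j\<bar> \<le> C"
  shows "analysis e (T x) = diag l (analysis e x)"
proof (rule ell2_eqI)
  have "orthonormal e"
    using assms(1) by (simp add: diagonalizes_def)
  then show "coord (analysis e (T x)) n = coord (diag l (analysis e x)) n" for n
    using assms(1)
    by (simp add: coord_analysis_orthonormal coord_diag[OF assms(3)] selfadjointD[OF assms(2)] diagonalizes_def)
qed

text \<open>The difference between \<open>x\<close> and its projection
  \<open>adj (analysis e) (analysis e x)\<close> is orthogonal to all \<open>e j\<close>, so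
  \<open>T\<close> annihilates it.\<close>

lemma diagonalizes_representation:
  assumes d: "diagonalizes T l e" and T: "bounded_op T" "selfadjoint T" and C: "\<And>j. \<bar>l j\<bar> \<le> C"
  shows "T x = adj (analysis e) (diag l (analysis e x))"
proof -
  have e: "orthonormal e"
    using d by (simp add: diagonalizes_def)
  note U = bounded_op_analysis_orthonormal[OF e]
  define y where "y = adj (analysis e) (analysis e x)"
  have "analysis e (x - y) = 0"
    by (simp add: y_def linear_simps[OF bounded_op_linear[OF U]] analysis_adj_analysis[OF e])
  then have "cinner (x - y) (e j) = 0" for j
    by (metis coord_analysis_orthonormal[OF e] coord_zero)
  then have "T (x - y) = 0"
    using d by (auto simp: diagonalizes_def)
  then have "T x = T y"
    by (simp add: linear_simps[OF bounded_op_linear[OF T(1)]])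
  also have "T y = adj (analysis e) (diag l (analysis e x))"
  proof (rule cinner_ext)
    fix z
    have "cinner (T y) z = cinner (analysis e x) (diag l (analysis e z))"
      by (simp add: y_def selfadjointD[OF T(2)] cinner_adj_left[OF U] diagonalizes_analysis[OF d T(2) C])
    also have "\<dots> = cinner (adj (analysis e) (diag l (analysis e x))) z"
      by (simp add: cinner_adj_left[OF U] selfadjointD[OF selfadjoint_diag[OF C]])
    finally show "cinner (T y) z = cinner (adj (analysis e) (diag l (analysis e x))) z" .
  qed
  finally show ?thesis .
qed

lemma diagonalizes_adj_analysis:
  assumes e: "orthonormal e" and C: "\<And>j. \<bar>l j\<bar> \<le> C"
  shows "diagonalizes (\<lambda>x. adj (analysis e) (diag l (analysis e x))) l e"
  unfolding diagonalizes_def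
proof (intro conjI allI impI e)
  note U = bounded_op_analysis_orthonormal[OF e]
  have "diag l (unit_vec j) = complex_of_real (l j) *\<^sub>C unit_vec j" for j
    by (rule ell2_eqI) (simp add: coord_diag[OF C])
  then show "adj (analysis e) (diag l (analysis e (e j))) = complex_of_real (l j) *\<^sub>C e j" for j
    by (simp add: analysis_orthonormal_self[OF e] bounded_op_scaleC[OF bounded_op_adj[OF U]]
        adj_analysis_unit_vec[OF e])
  fix g assume "\<forall>j. cinner g (e j) = 0"
  then have "analysis e g = 0"
    by (auto intro!: ell2_eqI simp: coord_analysis_orthonormal[OF e])
  then show "adj (analysis e) (diag l (analysis e g)) = 0"
    by (simp add: linear_simps[OF bounded_op_linear[OF bounded_op_adj[OF U]]]
        linear_simps[OF bounded_op_linear[OF bounded_op_diag[OF C]]])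
qed

lemma diagonalizes_diag:
  assumes C: "\<And>j. \<bar>l j\<bar> \<le> C" shows "diagonalizes (diag l) l unit_vec"
  unfolding diagonalizes_def
proof (intro conjI allI impI orthonormal_unit_vec)
  show "diag l (unit_vec j) = complex_of_real (l j) *\<^sub>C unit_vec j" for j
    by (rule ell2_eqI) (simp add: coord_diag[OF C])
  fix g assume "\<forall>j. cinner g (unit_vec j) = 0"
  then have "g = 0"
    by (intro ell2_eqI) simp
  then show "diag l g = 0"
    by (simp add: linear_simps[OF bounded_op_linear[OF bounded_op_diag[OF C]]])
qed

lemma diagonalizes_isometry:
  assumes d: "diagonalizes T l e" and T: "bounded_op T" and V: "bounded_op V" "\<And>h. adj V (V h) = h"
  shows "diagonalizes (\<lambda>x. V (T (adj V x))) l (\<lambda>j. V (e j))"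
  unfolding diagonalizes_def
proof (intro conjI allI impI)
  show "orthonormal (\<lambda>j. V (e j))"
    using d V by (simp add: orthonormal_def diagonalizes_def flip: cinner_adj_right)
  show "V (T (adj V (V (e j)))) = complex_of_real (l j) *\<^sub>C V (e j)" for j
    using d by (simp add: V(2) diagonalizes_def bounded_op_scaleC[OF V(1)])
  fix g assume "\<forall>j. cinner g (V (e j)) = 0"
  then have "T (adj V g) = 0"
    using d by (simp add: diagonalizes_def cinner_adj_left[OF V(1)])
  then show "V (T (adj V g)) = 0"
    by (simp add: linear_simps[OF bounded_op_linear[OF V(1)]])
qed

lemma orthonormal_nonzero: "orthonormal e \<Longrightarrow> e j \<noteq> 0"
  by (metis orthonormal_def cinner.zero_left zero_neq_one)

text \<open>Pairing with \<open>e i\<close> makes the coefficient at \<open>i\<close> vanish unless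
  \<open>z = l i\<close>; injectivity leaves one index.\<close>

lemma diagonalizes_eigenvector:
  assumes d: "diagonalizes T l e" and T: "bounded_op T" "selfadjoint T" and C: "\<And>j. \<bar>l j\<bar> \<le> C"
    and h: "T h = z *\<^sub>C h" "z \<noteq> 0" "h \<noteq> 0" and inj: "inj l"
  obtains j a where "z = complex_of_real (l j)" "h = a *\<^sub>C e j"
proof -
  have e: "orthonormal e"
    using d by (simp add: diagonalizes_def)
  note U = bounded_op_analysis_orthonormal[OF e]
  have eq: "z * cinner h (e j) = complex_of_real (l j) * cinner h (e j)" for j
    using selfadjointD[OF T(2), of h "e j"] d h(1) by (simp add: diagonalizes_def)
  have "\<exists>j. cinner h (e j) \<noteq> 0"
  proof (rule ccontr)
    assume "\<not> (\<exists>j. cinner h (e j) \<noteq> 0)"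
    then have "T h = 0"
      using d by (auto simp: diagonalizes_def)
    then have "coord h n = 0" for n
      using h(1,2) by (metis coord_scaleC coord_zero mult_eq_0_iff)
    then show False
      using h(3) by (metis ell2_eqI coord_zero)
  qed
  then obtain j where j: "cinner h (e j) \<noteq> 0"
    by blast
  then have z: "z = complex_of_real (l j)"
    using eq[of j] by simp
  have "cinner h (e i) = 0" if "i \<noteq> j" for i
    using eq[of i] inj that by (auto simp: z inj_eq)
  then have "analysis e h = cinner h (e j) *\<^sub>C unit_vec j"
    by (auto intro!: ell2_eqI simp: coord_analysis_orthonormal[OF e])
  then have "diag l (analysis e h) = (z * cinner h (e j)) *\<^sub>C unit_vec j"
    by (auto intro!: ell2_eqI simp: coord_diag[OF C] z)
  then have "z *\<^sub>C h = (z * cinner h (e j)) *\<^sub>C e j"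
    using diagonalizes_representation[OF d T C, of h] h(1)
    by (simp add: bounded_op_scaleC[OF bounded_op_adj[OF U]] adj_analysis_unit_vec[OF e])
  then have "coord h n = coord (cinner h (e j) *\<^sub>C e j) n" for n
    using h(2) by (metis coord_scaleC mult.assoc mult_cancel_left)
  then have "h = cinner h (e j) *\<^sub>C e j"
    by (rule ell2_eqI)
  then show thesis
    using that z by blast
qed

lemma diagonalizes_nonzero_eigenvalue_sequence:
  assumes d: "diagonalizes T l e" and T: "bounded_op T" "selfadjoint T" and C: "\<And>j. \<bar>l j\<bar> \<le> C"
    and inj: "inj l" and nz: "\<And>j. l j \<noteq> 0"
  shows "nonzero_eigenvalue_sequence T l"
  unfolding nonzero_eigenvalue_sequence_def
proof (intro conjI allI impI nz)
  fix z :: complex assume z: "z \<noteq> 0"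
  have e: "orthonormal e"
    using d by (simp add: diagonalizes_def)
  have zero: "T 0 = 0"
    by (simp add: linear_simps[OF bounded_op_linear[OF T(1)]])
  show "finite {j. complex_of_real (l j) = z}" (is "finite ?J")
  proof (cases "z \<in> range (\<lambda>j. complex_of_real (l j))")
    case True
    then obtain j where "z = complex_of_real (l j)"
      by blast
    then have "?J = {j}"
      using inj by (auto simp: inj_eq)
    then show ?thesis
      by simp
  next
    case False
    then have "?J = {}"
      by auto
    then show ?thesis
      by simp
  qed
  show "has_multiplicity T z (card ?J)"
  proof (cases "z \<in> range (\<lambda>j. complex_of_real (l j))")
    case True
    then obtain j where j: "z = complex_of_real (l j)"
      by blast
    then have J: "?J = {j}"
      using inj by (auto simp: inj_eq)
    have "eigenspace T z = range (\<lambda>a. a *\<^sub>C e j)"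
    proof (intro set_eqI iffI)
      fix h assume h: "h \<in> eigenspace T z"
      show "h \<in> range (\<lambda>a. a *\<^sub>C e j)"
      proof (cases "h = 0")
        case True
        then show ?thesis
          by (intro range_eqI[of _ _ 0]) simp
      next
        case False
        have "T h = z *\<^sub>C h"
          using h by (simp add: eigenspace_def)
        then obtain i a where i: "z = complex_of_real (l i)" "h = a *\<^sub>C e i"
          using diagonalizes_eigenvector[OF d T C _ z False inj] by blast
        then have "i = j"
          using j inj by (simp add: inj_eq)
        then show ?thesis
          using i by blast
      qed
    next
      fix h assume "h \<in> range (\<lambda>a. a *\<^sub>C e j)"
      then obtain a where "h = a *\<^sub>C e j"
        by blast
      then show "h \<in> eigenspace T z"
        using d j by (simp add: eigenspace_def bounded_op_scaleC[OF T(1)] diagonalizes_def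
            ell2.scale_scale mult.commute)
    qed
    then have "ell2.span {e j} = eigenspace T z"
      by (simp add: ell2.span_singleton)
    moreover have "ell2.independent {e j}"
      using orthonormal_nonzero[OF e] by (simp add: ell2.independent_insert ell2.span_empty ell2.independent_empty)
    ultimately show ?thesis
      unfolding has_multiplicity_def J by (intro exI[of _ "{e j}"]) simp
  next
    case False
    then have J: "?J = {}"
      by auto
    have "eigenspace T z = {0}"
    proof (intro set_eqI iffI)
      fix h assume h: "h \<in> eigenspace T z"
      show "h \<in> {0}"
      proof (rule ccontr)
        assume "h \<notin> {0}"
        then have "h \<noteq> 0" "T h = z *\<^sub>C h"
          using h by (simp_all add: eigenspace_def)
        then obtain j a where "z = complex_of_real (l j)" "h = a *\<^sub>C e j"
          using diagonalizes_eigenvector[OF d T C _ z _ inj] by blast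
        then show False
          using False by blast
      qed
    qed (simp add: eigenspace_def zero ell2.scale_zero_right)
    then show ?thesis
      unfolding has_multiplicity_def J
      by (intro exI[of _ "{}"]) (simp add: ell2.span_empty ell2.independent_empty)
  qed
qed

lemma simple_eigenvalue:
  assumes "has_multiplicity T z 1"
  obtains e where "norm e = 1" "T e = z *\<^sub>C e" "\<And>h. T h = z *\<^sub>C h \<Longrightarrow> \<exists>a. h = a *\<^sub>C e"
proof -
  obtain B where B: "card B = 1" "ell2.independent B" "ell2.span B = eigenspace T z"
    using assms by (auto simp: has_multiplicity_def)
  then obtain b where b: "B = {b}"
    by (auto simp: card_1_singleton_iff)
  then have "b \<noteq> 0"
    using B(2) ell2.dependent_zero by blast
  have E: "eigenspace T z = range (\<lambda>a. a *\<^sub>C b)"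
    using B(3) by (simp add: b ell2.span_singleton)
  define e where "e = complex_of_real (inverse (norm b)) *\<^sub>C b"
  have "norm e = 1"
    using \<open>b \<noteq> 0\<close> by (simp add: e_def norm_inverse)
  moreover have "e \<in> eigenspace T z"
    unfolding E e_def by blast
  then have "T e = z *\<^sub>C e"
    by (simp add: eigenspace_def)
  moreover have "\<exists>a. h = a *\<^sub>C e" if "T h = z *\<^sub>C h" for h
  proof -
    have "h \<in> range (\<lambda>a. a *\<^sub>C b)"
      using that E by (auto simp: eigenspace_def)
    then obtain a where "h = a *\<^sub>C b"
      by blast
    then have "h = (a * complex_of_real (norm b)) *\<^sub>C e"
      using \<open>b \<noteq> 0\<close> by (simp add: e_def ell2.scale_scale)
    then show ?thesis
      by blast
  qed
  ultimately show thesis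
    using that by blast
qed

text \<open>By injectivity each \<open>l j\<close> is a simple eigenvalue, and the unit eigenvectors
  are orthogonal. A further eigenvector orthogonal to all of them would be a multiple of some
  \<open>e j\<close> or belong to a value of multiplicity 0.\<close>

lemma diagonalizes_of_eigenvalue_sequence:
  assumes T: "compact_operator T" "selfadjoint T" and seq: "nonzero_eigenvalue_sequence T l"
    and inj: "inj l"
  obtains e where "diagonalizes T l e"
proof -
  have nz: "l j \<noteq> 0" for j
    using seq by (simp add: nonzero_eigenvalue_sequence_def)
  have mult: "has_multiplicity T z (card {j. complex_of_real (l j) = z})" if "z \<noteq> 0" for z
    using seq that by (simp add: nonzero_eigenvalue_sequence_def)
  have "has_multiplicity T (complex_of_real (l j)) 1" for j
  proof -
    have "{i. complex_of_real (l i) = complex_of_real (l j)} = {j}"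
      using inj by (auto simp: inj_eq)
    then show ?thesis
      using mult[of "complex_of_real (l j)"] nz by simp
  qed
  then have "\<exists>e. norm e = 1 \<and> T e = complex_of_real (l j) *\<^sub>C e \<and>
      (\<forall>h. T h = complex_of_real (l j) *\<^sub>C h \<longrightarrow> (\<exists>a. h = a *\<^sub>C e))" for j
    by (metis simple_eigenvalue)
  then obtain e where e: "\<And>j. norm (e j) = 1" "\<And>j. T (e j) = complex_of_real (l j) *\<^sub>C e j"
      "\<And>j h. T h = complex_of_real (l j) *\<^sub>C h \<Longrightarrow> \<exists>a. h = a *\<^sub>C e j"
    by metis
  have "cinner (e i) (e j) = 0" if "i \<noteq> j" for i j
    using selfadjointD[OF T(2), of "e i" "e j"] inj that by (simp add: e inj_eq)
  then have orth: "orthonormal e"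
    by (simp add: orthonormal_def cinner_self e)
  have "diagonalizes T l e"
  proof (rule diagonalizesI[OF T orth e(2)])
    fix h z assume z: "z \<noteq> 0" and h: "T h = complex_of_real z *\<^sub>C h" and perp: "\<And>j. cinner h (e j) = 0"
    show "h = 0"
    proof (cases "z \<in> range l")
      case True
      then obtain j where "z = l j"
        by blast
      then obtain a where a: "h = a *\<^sub>C e j"
        using e(3) h by blast
      then have "a = 0"
        using perp[of j] by (simp add: cinner_self e)
      then show ?thesis
        by (simp add: a)
    next
      case False
      then have "{j. complex_of_real (l j) = complex_of_real z} = {}"
        by auto
      then have "has_multiplicity T (complex_of_real z) 0"
        using mult[of "complex_of_real z"] z by simp
      then have "eigenspace T (complex_of_real z) = {0}"
        unfolding has_multiplicity_def by (metis card_0_eq ell2.span_empty)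
      moreover have "h \<in> eigenspace T (complex_of_real z)"
        using h by (simp add: eigenspace_def)
      ultimately show ?thesis
        by simp
    qed
  qed
  then show thesis
    by (rule that)
qed

section \<open>Shifts and Hankel matrices\<close>

definition right_shift :: "ell2 \<Rightarrow> ell2" where
  "right_shift x = Abs_ell2 (\<lambda>n. if n = 0 then 0 else coord x (n - 1))"

definition left_shift :: "ell2 \<Rightarrow> ell2" where
  "left_shift x = Abs_ell2 (\<lambda>n. coord x (Suc n))"

lemma coord_right_shift: "coord (right_shift x) n = (if n = 0 then 0 else coord x (n - 1))"
proof -
  have "summable (\<lambda>n. (cmod (coord x n))\<^sup>2)"
    using square_summable_coord[of x] by (simp add: square_summable_def)
  then have "square_summable (\<lambda>n. if n = 0 then 0 else coord x (n - 1))"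
    unfolding square_summable_def by (subst summable_Suc_iff[symmetric]) simp
  then show ?thesis
    by (simp add: right_shift_def coord_Abs_ell2)
qed

lemma coord_left_shift: "coord (left_shift x) n = coord x (Suc n)"
proof -
  have "summable (\<lambda>n. (cmod (coord x n))\<^sup>2)"
    using square_summable_coord[of x] by (simp add: square_summable_def)
  then have "square_summable (\<lambda>n. coord x (Suc n))"
    unfolding square_summable_def by (subst summable_Suc_iff)
  then show ?thesis
    by (simp add: left_shift_def coord_Abs_ell2)
qed

lemma bounded_op_left_shift: "bounded_op left_shift"
proof (rule bounded_opI[where C=1])
  fix x
  have "(\<Sum>j<n. (cmod (coord (left_shift x) j))\<^sup>2) \<le> (norm x)\<^sup>2" for n
  proof -
    have "(\<Sum>j<n. (cmod (coord (left_shift x) j))\<^sup>2) \<le> (\<Sum>j<Suc n. (cmod (coord x j))\<^sup>2)"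
      by (simp add: sum.lessThan_Suc_shift coord_left_shift del: sum.lessThan_Suc)
    then show ?thesis
      using sum_coord_le[of x "Suc n"] by linarith
  qed
  then show "norm (left_shift x) \<le> 1 * norm x"
    by (intro norm_le_finite) simp_all
qed (auto intro!: ell2_eqI simp: coord_left_shift)

lemma coord_Hankel: "hankel_defined c \<Longrightarrow> coord (Hankel c x) n = (\<Sum>p. c (n + p) * coord x p)"
  by (simp add: hankel_defined_def Hankel_def coord_Abs_ell2 hankel_seq_def)

lemma Hankel_sums:
  "hankel_defined c \<Longrightarrow> (\<lambda>p. c (n + p) * coord x p) sums coord (Hankel c x) n"
  by (simp add: coord_Hankel hankel_defined_def summable_sums)

lemma coord_Hankel_unit_vec:
  assumes "hankel_defined c" shows "coord (Hankel c (unit_vec p)) n = c (n + p)"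
proof -
  have "(\<lambda>k. if k = p then c (n + k) else 0) sums c (n + p)"
    using sums_If_finite_set[of "{p}" "\<lambda>k. c (n + k)"] by simp
  then show ?thesis
    using Hankel_sums[OF assms, of n "unit_vec p"]
    by (simp add: if_distrib[of "(*) _"] sums_unique2 cong: if_cong)
qed

text \<open>The entries depend on \<open>n + p\<close> only, so shifting the output to the left and
  shifting the input to the right have the same effect.\<close>

lemma hankel_defined_shift:
  assumes "hankel_defined c" shows "hankel_defined (shift c)"
    and "Hankel (shift c) x = left_shift (Hankel c x)"
    and "Hankel c (right_shift x) = Hankel (shift c) x"
proof -
  have eq: "hankel_seq (shift c) (coord x) = coord (left_shift (Hankel c x))" for x
    by (simp add: fun_eq_iff hankel_seq_def shift_def coord_left_shift coord_Hankel[OF assms])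
  have summ: "summable (\<lambda>p. shift c (n + p) * coord x p)" for n x
    using Hankel_sums[OF assms, of "Suc n" x] by (simp add: shift_def sums_iff)
  show *: "hankel_defined (shift c)"
    unfolding hankel_defined_def eq using summ by simp
  show "Hankel (shift c) x = left_shift (Hankel c x)"
    by (simp add: Hankel_def[of "shift c"] eq coord_inverse)
  show "Hankel c (right_shift x) = Hankel (shift c) x"
  proof (rule ell2_eqI)
    fix n
    have "(\<lambda>p. c (n + Suc p) * coord (right_shift x) (Suc p)) sums coord (Hankel (shift c) x) n"
      using Hankel_sums[OF *, of n x] by (simp add: shift_def coord_right_shift)
    then have "(\<lambda>p. c (n + p) * coord (right_shift x) p) sums coord (Hankel (shift c) x) n"
      using sums_Suc_iff[of "\<lambda>p. c (n + p) * coord (right_shift x) p"] by (simp add: coord_right_shift)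
    then show "coord (Hankel c (right_shift x)) n = coord (Hankel (shift c) x) n"
      using Hankel_sums[OF assms, of n "right_shift x"] sums_unique2 by blast
  qed
qed

text \<open>Conjugating \<open>T\<close> by the analysis map of \<open>g\<close> gives the matrix of
  inner products of \<open>T (g n)\<close> with \<open>g p\<close>; dependence on
  \<open>n + p\<close> alone makes it Hankel.\<close>

lemma Hankel_factorization:
  fixes c :: "nat \<Rightarrow> real"
  assumes g: "bessel g C" and T: "selfadjoint T"
    and c: "\<And>n p. cinner (T (g n)) (g p) = complex_of_real (c (n + p))"
  shows "hankel_defined (\<lambda>n. complex_of_real (c n))"
    and "Hankel (\<lambda>n. complex_of_real (c n)) = (\<lambda>x. analysis g (T (adj (analysis g) x)))"
proof -
  note V = bounded_op_analysis[OF g]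
  have s: "(\<lambda>p. complex_of_real (c (n + p)) * coord x p) sums
      coord (analysis g (T (adj (analysis g) x))) n" for n x
  proof -
    have "coord (analysis g (T (adj (analysis g) x))) n = cinner x (analysis g (T (g n)))"
      by (simp add: coord_analysis[OF g] selfadjointD[OF T] cinner_adj_left[OF V])
    moreover have "(\<lambda>p. coord x p * cnj (coord (analysis g (T (g n))) p)) sums cinner x (analysis g (T (g n)))"
      by (rule cinner_sums)
    ultimately show ?thesis
      by (simp add: coord_analysis[OF g] c mult.commute)
  qed
  then have eq: "hankel_seq (\<lambda>n. complex_of_real (c n)) (coord x) =
      coord (analysis g (T (adj (analysis g) x)))" for x
    by (simp add: fun_eq_iff hankel_seq_def sums_iff)
  show "hankel_defined (\<lambda>n. complex_of_real (c n))"
    unfolding hankel_defined_def eq using s by (auto simp: sums_iff)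
  show "Hankel (\<lambda>n. complex_of_real (c n)) = (\<lambda>x. analysis g (T (adj (analysis g) x)))"
    by (simp add: fun_eq_iff Hankel_def eq coord_inverse)
qed

section \<open>Existence\<close>

text \<open>\<open>Suc n\<close> rules out the trivial return at time 0.\<close>

definition recurrent :: "(ell2 \<Rightarrow> ell2) \<Rightarrow> ell2 \<Rightarrow> bool" where
  "recurrent T w \<longleftrightarrow> (\<forall>e>0. \<exists>n. dist ((T ^^ Suc n) w) w < e)"

lemma funpow_contraction:
  fixes T :: "'a::real_normed_vector \<Rightarrow> 'a"
  assumes "\<And>x y. T (x - y) = T x - T y" "\<And>x. norm (T x) \<le> norm x"
  shows "dist ((T ^^ n) x) ((T ^^ n) y) \<le> dist x y"
proof (induction n)
  case (Suc n)
  have "dist ((T ^^ Suc n) x) ((T ^^ Suc n) y) \<le> dist ((T ^^ n) x) ((T ^^ n) y)"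
    using assms(2)[of "(T ^^ n) x - (T ^^ n) y"] by (simp add: dist_norm assms(1))
  then show ?case
    using Suc by simp
qed simp

lemma recurrent_funpow:
  assumes T: "\<And>x y. T (x - y) = T x - T y" "\<And>x. norm (T x) \<le> norm x" and w: "recurrent T w"
  shows "recurrent T ((T ^^ n) w)"
  unfolding recurrent_def
proof (intro allI impI)
  fix e :: real assume "0 < e"
  then obtain k where k: "dist ((T ^^ Suc k) w) w < e"
    using w by (auto simp: recurrent_def)
  have "(T ^^ Suc k) ((T ^^ n) w) = (T ^^ n) ((T ^^ Suc k) w)"
    by (metis add.commute comp_apply funpow_add)
  then have "dist ((T ^^ Suc k) ((T ^^ n) w)) ((T ^^ n) w) \<le> dist ((T ^^ Suc k) w) w"
    using funpow_contraction[of T n, OF T] by simp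
  then show "\<exists>k. dist ((T ^^ Suc k) ((T ^^ n) w)) ((T ^^ n) w) < e"
    using k le_less_trans by blast
qed

text \<open>Along the orbit \<open>\<phi>\<close> never decreases, so a strict first increase would
  persist, while recurrence and continuity bring \<open>\<phi>\<close> back near its initial
  value.\<close>

lemma recurrent_invariant:
  fixes \<phi> :: "ell2 \<Rightarrow> real"
  assumes T: "\<And>x y. T (x - y) = T x - T y" "\<And>x. norm (T x) \<le> norm x" and w: "recurrent T w"
    and cont: "continuous_on UNIV \<phi>" and mono: "\<And>v. recurrent T v \<Longrightarrow> \<phi> v \<le> \<phi> (T v)"
  shows "\<phi> (T w) = \<phi> w"
proof (rule ccontr)
  assume "\<phi> (T w) \<noteq> \<phi> w"
  then have less: "0 < \<phi> (T w) - \<phi> w"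
    using mono[OF w] by simp
  have le: "\<phi> (T w) \<le> \<phi> ((T ^^ Suc n) w)" for n
  proof (induction n)
    case (Suc n)
    then show ?case
      using mono[OF recurrent_funpow[OF T w, of "Suc n"]] by simp
  qed simp
  have "isCont \<phi> w"
    using cont by (simp add: continuous_on_eq_continuous_at)
  then obtain d where d: "0 < d" "\<And>v. dist v w < d \<Longrightarrow> dist (\<phi> v) (\<phi> w) < \<phi> (T w) - \<phi> w"
    using less unfolding continuous_at_eps_delta by blast
  obtain n where "dist ((T ^^ Suc n) w) w < d"
    using w d(1) by (auto simp: recurrent_def)
  from d(2)[OF this] le[of n] show False
    by (simp add: dist_real_def)
qed

lemma recurrent_isometric:
  assumes "\<And>x y. T (x - y) = T x - T y" "\<And>x. norm (T x) \<le> norm x" "recurrent T w"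
  shows "norm (T w) = norm w"
  using recurrent_invariant[of T w "\<lambda>v. - norm v"] assms by (simp add: continuous_intros)

lemma cinner_real:
  assumes "\<And>j. coord x j = complex_of_real (a j)" "\<And>j. coord y j = complex_of_real (b j)"
    and "(\<lambda>j. a j * b j) sums s"
  shows "cinner x y = complex_of_real s"
proof -
  have "(\<lambda>j. complex_of_real (a j * b j)) sums complex_of_real s"
    using assms(3) by (rule sums_of_real)
  then show ?thesis
    using cinner_sums[of x y] by (simp add: assms(1,2) sums_unique2)
qed

text \<open>After division by \<open>x j ^ k\<close>, earlier terms vanish by induction and later
  ones have ratios below 1; dominated convergence as \<open>k\<close> grows isolates
  \<open>a j\<close>.\<close>

lemma (in interlacing) moments_zero:
  fixes a :: "nat \<Rightarrow> complex"
  assumes summ: "summable (\<lambda>j. cmod (a j))"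
    and moments: "\<And>k. (\<lambda>j. complex_of_real (x j ^ k) * a j) sums 0"
  shows "a j = 0"
proof (induction j rule: less_induct)
  case (less j)
  define t where "t i k = complex_of_real ((x i / x j) ^ k) * a i" for i k
  define b where "b i = (if i = j then a i else 0)" for i
  have "eventually (\<lambda>k. summable (\<lambda>i. norm (t i k))) sequentially \<and> summable (\<lambda>i. norm (b i)) \<and>
      ((\<lambda>k. \<Sum>i. t i k) \<longlonglongrightarrow> (\<Sum>i. b i))"
  proof (rule tannerys_theorem[OF _ _ summ])
    fix i
    show "(\<lambda>k. t i k) \<longlonglongrightarrow> b i"
    proof (cases "j < i")
      case True
      then have "(\<lambda>k. (x i / x j) ^ k) \<longlonglongrightarrow> 0"
        using x_pos[of i] x_pos[of j] by (intro LIMSEQ_realpow_zero) auto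
      then have "(\<lambda>k. complex_of_real ((x i / x j) ^ k) * a i) \<longlonglongrightarrow> complex_of_real 0 * a i"
        by (intro tendsto_mult tendsto_of_real tendsto_const)
      then show ?thesis
        using True by (simp add: t_def b_def)
    next
      case False
      then show ?thesis
        using less.IH[of i] x_pos[of j] by (cases "i = j") (auto simp: t_def b_def)
    qed
    have "norm (t i k) \<le> cmod (a i)" for i k
    proof (cases "i < j")
      case False
      then have "(x i / x j) ^ k \<le> 1"
        using x_pos[of i] x_pos[of j] x_le[of j i] by (intro power_le_one) auto
      moreover have "0 \<le> (x i / x j) ^ k"
        using x_pos[of i] x_pos[of j] by simp
      ultimately show ?thesis
        unfolding t_def norm_mult norm_of_real by (intro mult_left_le_one_le) auto
    qed (simp add: t_def less.IH)
    then show "eventually (\<lambda>(i, k). norm (t i k) \<le> cmod (a i)) (at_top \<times>\<^sub>F sequentially)"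
      by (intro always_eventually) auto
  qed simp
  then have "(\<lambda>k. \<Sum>i. t i k) \<longlonglongrightarrow> (\<Sum>i. b i)"
    by blast
  moreover have "(\<Sum>i. t i k) = 0" for k
  proof -
    have "(\<lambda>i. complex_of_real (1 / x j ^ k) * (complex_of_real (x i ^ k) * a i)) sums (complex_of_real (1 / x j ^ k) * 0)"
      by (intro sums_mult moments)
    then show ?thesis
      by (simp add: t_def power_divide sums_iff)
  qed
  moreover have "(\<Sum>i. b i) = a j"
    by (subst suminf_finite[of "{j}"]) (auto simp: b_def)
  ultimately show ?case
    by (simp add: LIMSEQ_const_iff)
qed

section \<open>The diagonal model and its rank-one perturbation\<close>

locale interlacing_spectra =
  fixes l m :: "nat \<Rightarrow> real"
  assumes l_lim: "l \<longlonglongrightarrow> 0" and l_gt_m: "\<bar>m j\<bar> < \<bar>l j\<bar>" and m_gt_l: "\<bar>l (Suc j)\<bar> < \<bar>m j\<bar>"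
begin

sublocale interlacing "\<lambda>j. (l j)\<^sup>2" "\<lambda>j. (m j)\<^sup>2"
proof
  show "(m j)\<^sup>2 < (l j)\<^sup>2" "(l (Suc j))\<^sup>2 < (m j)\<^sup>2" for j
    using power_strict_mono[OF l_gt_m[of j], of 2] power_strict_mono[OF m_gt_l[of j], of 2] by simp_all
  show "(\<lambda>j. (l j)\<^sup>2) \<longlonglongrightarrow> 0"
    using tendsto_power[OF l_lim, of 2] by simp
qed

lemma l_nonzero [simp]: "l j \<noteq> 0" and m_nonzero [simp]: "m j \<noteq> 0"
  using x_pos[of j] y_pos[of j] by auto

lemma inj_l: "inj l"
  using x_eq_iff by (metis (mono_tags, lifting) injI)

lemma inj_m: "inj m"
  using y_strict by (metis (mono_tags, lifting) injI less_irrefl linorder_neqE_nat)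

lemma l_bound: "\<bar>l j\<bar> \<le> \<bar>l 0\<bar>"
  using x_le[of 0 j] by (simp add: abs_le_square_iff)

lemma m_bound: "\<bar>m j\<bar> \<le> \<bar>l 0\<bar>"
  using l_bound[of j] l_gt_m[of j] by simp

lemma square_bound: "\<bar>(l j)\<^sup>2\<bar> \<le> (l 0)\<^sup>2"
  using x_le[of 0 j] by simp

lemma m_lim: "m \<longlonglongrightarrow> 0"
  using tendsto_real_sqrt[OF y_lim] by (simp add: tendsto_rabs_zero_iff)

lemma weight_sqrt: "sqrt (weight j) * sqrt (weight j) = weight j"
  using weight_pos[of j] by simp

definition Lam :: "ell2 \<Rightarrow> ell2" where
  "Lam = diag l"

text \<open>In an eigenbasis of \<Gamma> with phases making the components of \<Gamma>\<delta>
  positive, \<open>uvec\<close> represents \<Gamma>\<delta> and \<open>qvec\<close> represents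
  \<delta>.\<close>

definition uvec :: ell2 where
  "uvec = Abs_ell2 (\<lambda>j. complex_of_real (sqrt (weight j)))"

definition qvec :: ell2 where
  "qvec = Abs_ell2 (\<lambda>j. complex_of_real (sqrt (weight j) / l j))"

text \<open>The resolvent of the square of \<open>Lam\<close> at \<open>(m k)\<^sup>2\<close>,
  applied to \<open>uvec\<close>: the form that eigenvectors take under a rank-one perturbation
  along \<open>uvec\<close>.\<close>

definition fvec :: "nat \<Rightarrow> ell2" where
  "fvec k = Abs_ell2 (\<lambda>j. complex_of_real (sqrt (weight j) / ((l j)\<^sup>2 - (m k)\<^sup>2)))"

lemma coord_uvec: "coord uvec j = complex_of_real (sqrt (weight j))"
proof -
  have "square_summable (\<lambda>j. complex_of_real (sqrt (weight j)))"
    using summable_weight weight_pos by (simp add: square_summable_def less_imp_le)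
  then show ?thesis
    by (simp add: uvec_def coord_Abs_ell2)
qed

lemma coord_qvec: "coord qvec j = complex_of_real (sqrt (weight j) / l j)"
proof -
  have "square_summable (\<lambda>j. complex_of_real (sqrt (weight j) / l j))"
    using summable_weight_x weight_pos
    unfolding square_summable_def norm_of_real power2_abs by (simp add: power_divide less_imp_le)
  then show ?thesis
    by (simp add: qvec_def coord_Abs_ell2)
qed

lemma coord_fvec: "coord (fvec k) j = complex_of_real (sqrt (weight j) / ((l j)\<^sup>2 - (m k)\<^sup>2))"
proof -
  obtain C where C: "\<And>j. \<bar>1 / ((l j)\<^sup>2 - (m k)\<^sup>2)\<bar> \<le> C"
    using inverse_distance_bounded by blast
  have "summable (\<lambda>j. (sqrt (weight j) / ((l j)\<^sup>2 - (m k)\<^sup>2))\<^sup>2)"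
  proof (rule summable_comparison_test'[where N=0])
    show "summable (\<lambda>j. weight j * C\<^sup>2)"
      by (intro summable_mult2 summable_weight)
    fix j
    have "(1 / ((l j)\<^sup>2 - (m k)\<^sup>2))\<^sup>2 \<le> C\<^sup>2"
      using power_mono[OF C[of j] abs_ge_zero, of 2] by (simp only: power2_abs)
    then have "weight j * (1 / ((l j)\<^sup>2 - (m k)\<^sup>2))\<^sup>2 \<le> weight j * C\<^sup>2"
      using weight_pos[of j] by (intro mult_left_mono) auto
    then show "norm ((sqrt (weight j) / ((l j)\<^sup>2 - (m k)\<^sup>2))\<^sup>2) \<le> weight j * C\<^sup>2"
      using weight_pos[of j] by (simp add: power_divide less_imp_le)
  qed
  then have "square_summable (\<lambda>j. complex_of_real (sqrt (weight j) / ((l j)\<^sup>2 - (m k)\<^sup>2)))"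
    unfolding square_summable_def norm_of_real power2_abs .
  then show ?thesis
    by (simp add: fvec_def coord_Abs_ell2)
qed

lemma coord_Lam [simp]: "coord (Lam h) j = complex_of_real (l j) * coord h j"
  by (simp add: Lam_def coord_diag[OF l_bound])

lemma bounded_op_Lam: "bounded_op Lam"
  unfolding Lam_def by (rule bounded_op_diag[OF l_bound])

lemma selfadjoint_Lam: "selfadjoint Lam"
  unfolding Lam_def by (rule selfadjoint_diag[OF l_bound])

lemma compact_operator_Lam: "compact_operator Lam"
  unfolding Lam_def by (rule compact_operator_diag[OF l_lim])

lemma Lam_qvec: "Lam qvec = uvec"
  by (rule ell2_eqI) (simp add: coord_qvec coord_uvec)

lemma cinner_fvec_uvec: "cinner (fvec k) uvec = 1"
proof -
  have "(\<lambda>j. sqrt (weight j) / ((l j)\<^sup>2 - (m k)\<^sup>2) * sqrt (weight j)) sums 1"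
    using weight_sums_1[of k] by (simp add: weight_sqrt del: real_sqrt_mult_self)
  then show ?thesis
    using cinner_real[OF coord_fvec coord_uvec] by simp
qed

text \<open>The product of the two resolvent factors is a difference quotient, and both sums in its
  numerator equal 1 by \<open>weight_sums_1\<close>.\<close>

lemma fvec_orthogonal:
  assumes "k \<noteq> i" shows "cinner (fvec k) (fvec i) = 0"
proof -
  have ne: "(m k)\<^sup>2 - (m i)\<^sup>2 \<noteq> 0"
    using assms y_strict by (metis eq_iff_diff_eq_0 less_irrefl linorder_neqE_nat)
  have "(\<lambda>j. (weight j / ((l j)\<^sup>2 - (m k)\<^sup>2) - weight j / ((l j)\<^sup>2 - (m i)\<^sup>2)) / ((m k)\<^sup>2 - (m i)\<^sup>2))
      sums ((1 - 1) / ((m k)\<^sup>2 - (m i)\<^sup>2))"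
    by (intro sums_divide sums_diff weight_sums_1)
  moreover have "(weight j / ((l j)\<^sup>2 - (m k)\<^sup>2) - weight j / ((l j)\<^sup>2 - (m i)\<^sup>2)) / ((m k)\<^sup>2 - (m i)\<^sup>2)
      = sqrt (weight j) / ((l j)\<^sup>2 - (m k)\<^sup>2) * (sqrt (weight j) / ((l j)\<^sup>2 - (m i)\<^sup>2))" for j
  proof -
    have "(l j)\<^sup>2 - (m k)\<^sup>2 \<noteq> 0" "(l j)\<^sup>2 - (m i)\<^sup>2 \<noteq> 0"
      using x_ne_y by simp_all
    then have "(weight j / ((l j)\<^sup>2 - (m k)\<^sup>2) - weight j / ((l j)\<^sup>2 - (m i)\<^sup>2)) / ((m k)\<^sup>2 - (m i)\<^sup>2)
        = weight j / (((l j)\<^sup>2 - (m k)\<^sup>2) * ((l j)\<^sup>2 - (m i)\<^sup>2))"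
      using ne by (simp add: divide_simps) (simp add: algebra_simps)
    then show ?thesis
      by (simp add: weight_sqrt del: real_sqrt_mult_self)
  qed
  ultimately have "(\<lambda>j. sqrt (weight j) / ((l j)\<^sup>2 - (m k)\<^sup>2) * (sqrt (weight j) / ((l j)\<^sup>2 - (m i)\<^sup>2))) sums 0"
    by simp
  then show ?thesis
    using cinner_real[OF coord_fvec coord_fvec] by simp
qed

lemma fvec_nonzero: "fvec k \<noteq> 0"
  using cinner_fvec_uvec[of k] by (metis cinner.zero_left zero_neq_one)

definition fhat :: "nat \<Rightarrow> ell2" where
  "fhat k = complex_of_real (1 / norm (fvec k)) *\<^sub>C fvec k"

lemma orthonormal_fhat: "orthonormal fhat"
  using fvec_nonzero
  by (simp add: orthonormal_def fhat_def fvec_orthogonal cinner_self power2_eq_square)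

definition perturbed :: "ell2 \<Rightarrow> ell2" where
  "perturbed h = diag (\<lambda>j. (l j)\<^sup>2) h - cinner h uvec *\<^sub>C uvec"

lemma coord_perturbed:
  "coord (perturbed h) j = complex_of_real ((l j)\<^sup>2) * coord h j - cinner h uvec * complex_of_real (sqrt (weight j))"
  by (simp add: perturbed_def coord_diag[OF square_bound] coord_uvec)

lemma perturbed_Lam: "perturbed h = Lam (Lam h) - cinner h uvec *\<^sub>C uvec"
  by (rule ell2_eqI) (simp add: coord_perturbed coord_uvec power2_eq_square mult.assoc)

lemma compact_operator_perturbed: "compact_operator perturbed"
proof -
  have "compact_operator (\<lambda>h. diag (\<lambda>j. (l j)\<^sup>2) h + cinner h uvec *\<^sub>C (- uvec))"
    by (intro compact_operator_add compact_operator_diag compact_operator_rank_one x_lim)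
  moreover have "(\<lambda>h. diag (\<lambda>j. (l j)\<^sup>2) h + cinner h uvec *\<^sub>C (- uvec)) = perturbed"
    by (simp add: fun_eq_iff perturbed_def scaleC.minus_right)
  ultimately show ?thesis
    by simp
qed

lemma selfadjoint_perturbed: "selfadjoint perturbed"
  unfolding selfadjoint_def perturbed_def
  by (simp add: cinner.diff_left cinner.diff_right selfadjointD[OF selfadjoint_diag[OF square_bound]]
      cinner_commute[of uvec])

lemma perturbed_fvec: "perturbed (fvec k) = complex_of_real ((m k)\<^sup>2) *\<^sub>C fvec k"
proof (rule ell2_eqI)
  fix j
  have "(l j)\<^sup>2 - (m k)\<^sup>2 \<noteq> 0"
    using x_ne_y by simp
  then have "(l j)\<^sup>2 * (sqrt (weight j) / ((l j)\<^sup>2 - (m k)\<^sup>2)) - sqrt (weight j) =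
      (m k)\<^sup>2 * (sqrt (weight j) / ((l j)\<^sup>2 - (m k)\<^sup>2))"
    by (simp add: divide_simps) (simp add: algebra_simps)
  then have "complex_of_real ((l j)\<^sup>2 * (sqrt (weight j) / ((l j)\<^sup>2 - (m k)\<^sup>2)) - sqrt (weight j)) =
      complex_of_real ((m k)\<^sup>2 * (sqrt (weight j) / ((l j)\<^sup>2 - (m k)\<^sup>2)))"
    by (rule arg_cong)
  then show "coord (perturbed (fvec k)) j = coord (complex_of_real ((m k)\<^sup>2) *\<^sub>C fvec k) j"
    unfolding coord_perturbed cinner_fvec_uvec coord_scaleC coord_fvec by simp
qed

text \<open>
  An eigenvector is a multiple of \<open>sqrt (weight j) / ((l j)\<^sup>2 - z)\<close>; by interlacing all terms of its
  inner product with a suitable \<open>fvec k\<close> have the same sign.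
\<close>

lemma perturbed_no_other_eigenvector:
  assumes z: "z \<noteq> 0" and h: "perturbed h = complex_of_real z *\<^sub>C h"
    and perp: "\<And>k. cinner h (fvec k) = 0"
  shows "h = 0"
proof (rule ccontr)
  assume "h \<noteq> 0"
  define g where "g = cinner h uvec"
  have eq: "complex_of_real ((l j)\<^sup>2 - z) * coord h j = g * complex_of_real (sqrt (weight j))" for j
    using arg_cong[OF h, of "\<lambda>x. coord x j"] by (simp add: coord_perturbed g_def algebra_simps)
  \<comment> \<open>Without a component along \<open>uvec\<close>, \<open>h\<close> is an
    eigenvector of the diagonal part, hence a multiple of one unit vector, and no unit vector is
    orthogonal to \<open>uvec\<close>.\<close>
  have g: "g \<noteq> 0"
  proof
    assume "g = 0"
    then have eq0: "(l j)\<^sup>2 = z \<or> coord h j = 0" for j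
      using eq[of j] by (simp flip: of_real_diff of_real_power)
    obtain i where i: "coord h i \<noteq> 0"
      using \<open>h \<noteq> 0\<close> by (metis ell2_eqI coord_zero)
    then have "coord h j = 0" if "j \<noteq> i" for j
      using eq0[of i] eq0[of j] x_eq_iff[of i j] that by metis
    then have "h = coord h i *\<^sub>C unit_vec i"
      by (auto intro!: ell2_eqI)
    then have "g = coord h i * cinner (unit_vec i) uvec"
      unfolding g_def by (metis cinner_scaleC_left)
    then show False
      using \<open>g = 0\<close> i weight_pos[of i] by (simp add: coord_uvec)
  qed
  have zx: "(l j)\<^sup>2 - z \<noteq> 0" for j
    using eq[of j] g weight_pos[of j] by auto
  have hj: "coord h j = g * complex_of_real (sqrt (weight j) / ((l j)\<^sup>2 - z))" for j
  proof -
    have "complex_of_real ((l j)\<^sup>2 - z) \<noteq> 0"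
      using zx by (simp only: of_real_eq_0_iff not_False_eq_True)
    then show ?thesis
      using eq[of j] by (simp add: field_simps)
  qed
  have expand: "(\<lambda>j. sqrt (weight j) / ((l j)\<^sup>2 - z) * b j) sums s"
    if "\<And>j. coord v j = complex_of_real (b j)" "cinner h v = g * complex_of_real s" for v b s
  proof -
    have "(\<lambda>j. inverse g * (coord h j * cnj (coord v j))) sums (inverse g * cinner h v)"
      by (intro sums_mult cinner_sums)
    then have "(\<lambda>j. complex_of_real (sqrt (weight j) / ((l j)\<^sup>2 - z) * b j)) sums complex_of_real s"
      using g unfolding hj that complex_cnj_complex_of_real by (simp add: mult.assoc flip: mult.assoc[of "inverse g"])
    then show ?thesis
      by (simp only: sums_of_real_iff)
  qed
  \<comment> \<open>The secular equation. It forces \<open>z\<close> between 0 and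
    \<open>(l 0)\<^sup>2\<close>: for negative \<open>z\<close> the sum is too small, and from
    \<open>(l 0)\<^sup>2\<close> on it has no positive term.\<close>
  have one: "(\<lambda>j. weight j / ((l j)\<^sup>2 - z)) sums 1"
    using expand[OF coord_uvec, of 1] by (simp add: g_def weight_sqrt del: real_sqrt_mult_self)
  have "0 < z"
  proof (rule ccontr)
    assume "\<not> 0 < z"
    then have "z < 0"
      using z by simp
    have pos: "0 < weight j / (l j)\<^sup>2 - weight j / ((l j)\<^sup>2 - z)" for j
    proof -
      have "weight j / ((l j)\<^sup>2 - z) < weight j / (l j)\<^sup>2"
        using weight_pos[of j] x_pos[of j] \<open>z < 0\<close>
        by (intro divide_strict_left_mono mult_pos_pos) (auto intro: less_trans)
      then show ?thesis
        by simp
    qed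
    have s: "(\<lambda>j. weight j / (l j)\<^sup>2 - weight j / ((l j)\<^sup>2 - z)) sums ((\<Sum>j. weight j / (l j)\<^sup>2) - 1)"
      by (intro sums_diff one summable_sums summable_weight_x)
    then have "0 < (\<Sum>j. weight j / (l j)\<^sup>2) - 1"
      unfolding sums_unique[OF s] by (intro suminf_pos sums_summable[OF s] pos)
    then show False
      using weight_x_le_1 by simp
  qed
  moreover have "z < (l 0)\<^sup>2"
  proof (rule ccontr)
    assume "\<not> z < (l 0)\<^sup>2"
    then have "weight j / ((l j)\<^sup>2 - z) \<le> 0" for j
      using weight_pos[of j] x_le[of 0 j] by (simp add: divide_nonneg_nonpos)
    then have "1 \<le> (0::real)"
      using sums_le[OF _ one sums_zero] by simp
    then show False
      by simp
  qed
  moreover have "z \<notin> range (\<lambda>j. (l j)\<^sup>2)"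
    using zx by force
  \<comment> \<open>The gap containing \<open>z\<close> also contains \<open>(m k)\<^sup>2\<close>,
    so the two denominators agree in sign for each \<open>j\<close>.\<close>
  ultimately obtain k where k: "(l (Suc k))\<^sup>2 < z" "z < (l k)\<^sup>2"
    using between by blast
  have pos: "0 < sqrt (weight j) / ((l j)\<^sup>2 - z) * (sqrt (weight j) / ((l j)\<^sup>2 - (m k)\<^sup>2))" for j
  proof -
    have "0 < ((l j)\<^sup>2 - z) * ((l j)\<^sup>2 - (m k)\<^sup>2)"
    proof (cases "j \<le> k")
      case True
      then show ?thesis
        using k(2) x_le[of j k] y_less[of j k] by (intro mult_pos_pos) auto
    next
      case False
      then show ?thesis
        using k(1) x_le[of "Suc k" j] less_y[of k j] by (intro mult_neg_neg) auto
    qed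
    then show ?thesis
      using weight_pos[of j] by (simp add: weight_sqrt zero_less_divide_iff del: real_sqrt_mult_self)
  qed
  have s0: "(\<lambda>j. sqrt (weight j) / ((l j)\<^sup>2 - z) * (sqrt (weight j) / ((l j)\<^sup>2 - (m k)\<^sup>2))) sums 0"
    using expand[OF coord_fvec, of k 0] perp[of k] by simp
  show False
    using suminf_pos[OF sums_summable[OF s0] pos] sums_unique[OF s0] by simp
qed

lemma diagonalizes_perturbed: "diagonalizes perturbed (\<lambda>k. (m k)\<^sup>2) fhat"
proof (rule diagonalizesI[OF compact_operator_perturbed selfadjoint_perturbed orthonormal_fhat])
  show "perturbed (fhat k) = complex_of_real ((m k)\<^sup>2) *\<^sub>C fhat k" for k
    by (simp add: fhat_def bounded_op_scaleC[OF compact_operator_bounded[OF compact_operator_perturbed]]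
        perturbed_fvec ell2.scale_scale mult.commute)
  fix h z assume "z \<noteq> 0" "perturbed h = complex_of_real z *\<^sub>C h" "\<And>k. cinner h (fhat k) = 0"
  then show "h = 0"
    using fvec_nonzero by (intro perturbed_no_other_eigenvector) (auto simp: fhat_def)
qed

section \<open>The square root and its factorization through the diagonal operator\<close>

text \<open>A square root of \<open>perturbed\<close> with the signs of the \<open>m k\<close>, in
  general not the positive one.\<close>

definition Gam :: "ell2 \<Rightarrow> ell2" where
  "Gam h = adj (analysis fhat) (diag m (analysis fhat h))"

lemmas bounded_op_fhat = bounded_op_analysis_orthonormal[OF orthonormal_fhat]

lemma bounded_op_Gam: "bounded_op Gam"
  unfolding Gam_def
  by (rule bounded_op_compose[OF bounded_op_adj[OF bounded_op_fhat]
        bounded_op_compose[OF bounded_op_diag[OF m_bound] bounded_op_fhat]])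

lemma selfadjoint_Gam: "selfadjoint Gam"
  unfolding Gam_def by (rule selfadjoint_compose[OF selfadjoint_diag[OF m_bound] bounded_op_fhat])

lemma diagonalizes_Gam: "diagonalizes Gam m fhat"
  unfolding Gam_def by (rule diagonalizes_adj_analysis[OF orthonormal_fhat m_bound])

lemma Gam_Gam: "Gam (Gam h) = perturbed h"
proof -
  have bound: "\<bar>(m k)\<^sup>2\<bar> \<le> (l 0)\<^sup>2" for k
    using m_bound[of k] by (simp add: abs_le_square_iff)
  have "diag m (diag m w) = diag (\<lambda>k. (m k)\<^sup>2) w" for w
    by (rule ell2_eqI) (simp add: coord_diag[OF m_bound] coord_diag[OF bound], simp add: power2_eq_square)
  then show ?thesis
    unfolding Gam_def analysis_adj_analysis[OF orthonormal_fhat]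
    by (simp add: diagonalizes_representation[OF diagonalizes_perturbed
          compact_operator_bounded[OF compact_operator_perturbed] selfadjoint_perturbed bound])
qed

lemma norm_Gam: "(norm (Gam h))\<^sup>2 = (norm (Lam h))\<^sup>2 - (cmod (cinner h uvec))\<^sup>2"
proof -
  have "complex_of_real ((norm (Gam h))\<^sup>2) = cinner (perturbed h) h"
    unfolding cinner_self[symmetric] by (simp add: Gam_Gam flip: selfadjointD[OF selfadjoint_Gam])
  also have "\<dots> = cinner (Lam h) (Lam h) - cinner h uvec * cnj (cinner h uvec)"
    by (simp add: perturbed_Lam cinner.diff_left selfadjointD[OF selfadjoint_Lam] cinner_commute[of h uvec])
  also have "\<dots> = complex_of_real ((norm (Lam h))\<^sup>2 - (cmod (cinner h uvec))\<^sup>2)"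
    by (simp only: cinner_self complex_norm_square of_real_diff)
  finally show ?thesis
    by (simp only: of_real_eq_iff)
qed

lemma norm_Gam_le: "norm (Gam h) \<le> norm (Lam h)"
  by (rule power2_le_imp_le) (simp_all add: norm_Gam)

text \<open>Formally the inverse of \<open>Lam\<close> after \<open>Gam\<close>. That inverse is
  unbounded, so the coordinates \<open>coord (Gam h) j / l j\<close> are prescribed instead;
  contractivity rests on \<open>norm_Gam_le\<close>.\<close>

definition D :: "ell2 \<Rightarrow> ell2" where
  "D = analysis (\<lambda>j. complex_of_real (1 / l j) *\<^sub>C Gam (unit_vec j))"

abbreviation B :: "ell2 \<Rightarrow> ell2" where
  "B \<equiv> adj D"

lemma bessel_D: "bessel (\<lambda>j. complex_of_real (1 / l j) *\<^sub>C Gam (unit_vec j)) 1"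
proof (rule besselI)
  fix n a
  define v where "v = fin_comb n (\<lambda>j. a j / complex_of_real (l j)) unit_vec"
  have "fin_comb n a (\<lambda>j. complex_of_real (1 / l j) *\<^sub>C Gam (unit_vec j)) =
      fin_comb n (\<lambda>j. a j / complex_of_real (l j)) (\<lambda>j. Gam (unit_vec j))"
    by (simp add: fin_comb_def ell2.scale_scale)
  also have "\<dots> = Gam v"
    by (simp add: v_def bounded_op_fin_comb[OF bounded_op_Gam])
  finally have "norm (fin_comb n a (\<lambda>j. complex_of_real (1 / l j) *\<^sub>C Gam (unit_vec j))) \<le> norm (Lam v)"
    using norm_Gam_le by simp
  moreover have "Lam v = fin_comb n a unit_vec"
    by (rule ell2_eqI) (simp add: v_def)
  ultimately have "(norm (fin_comb n a (\<lambda>j. complex_of_real (1 / l j) *\<^sub>C Gam (unit_vec j))))\<^sup>2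
      \<le> (norm (fin_comb n a unit_vec))\<^sup>2"
    by (simp add: power_mono)
  then show "(norm (fin_comb n a (\<lambda>j. complex_of_real (1 / l j) *\<^sub>C Gam (unit_vec j))))\<^sup>2
      \<le> 1\<^sup>2 * (\<Sum>j<n. (cmod (a j))\<^sup>2)"
    by (simp add: norm_fin_comb_orthonormal[OF cinner_unit_vec_unit_vec])
qed simp

lemma bounded_op_D: "bounded_op D"
  unfolding D_def by (rule bounded_op_analysis[OF bessel_D])

lemma norm_D_le: "norm (D h) \<le> norm h"
  unfolding D_def using norm_analysis_le[OF bessel_D, of h] by simp

lemma norm_B_le: "norm (B h) \<le> norm h"
  using norm_adj_le[OF bounded_op_D, of 1 h] norm_D_le by simp

lemma bounded_op_B: "bounded_op B"
  by (rule bounded_op_adj[OF bounded_op_D])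

lemma D_diff: "D (x - y) = D x - D y" and B_diff: "B (x - y) = B x - B y"
  and Lam_diff: "Lam (x - y) = Lam x - Lam y"
  by (simp_all add: linear_simps[OF bounded_op_linear[OF bounded_op_D]]
      linear_simps[OF bounded_op_linear[OF bounded_op_B]] linear_simps[OF bounded_op_linear[OF bounded_op_Lam]])

lemma coord_D: "coord (D h) j = coord (Gam h) j / complex_of_real (l j)"
proof -
  have "coord (D h) j = cinner h (complex_of_real (1 / l j) *\<^sub>C Gam (unit_vec j))"
    unfolding D_def by (rule coord_analysis[OF bessel_D])
  also have "\<dots> = coord (Gam h) j / complex_of_real (l j)"
    by (simp flip: selfadjointD[OF selfadjoint_Gam])
  finally show ?thesis .
qed

lemma Lam_D: "Lam (D h) = Gam h"
  by (rule ell2_eqI) (simp add: coord_D)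

lemma B_Lam: "B (Lam h) = Gam h"
  by (rule cinner_ext)
    (simp add: cinner_adj_left[OF bounded_op_D] selfadjointD[OF selfadjoint_Lam] Lam_D
      selfadjointD[OF selfadjoint_Gam])

text \<open>By \<open>B_Lam\<close> a unit vector is sent by \<open>B\<close> to a multiple of its
  image under \<open>Gam\<close>, and \<open>D\<close> after \<open>Gam\<close> divides the
  coordinates of \<open>perturbed\<close> by \<open>l j\<close>, which turns \<open>uvec\<close>
  into \<open>qvec\<close>.\<close>

lemma D_B: "D (B h) = h - cinner h qvec *\<^sub>C qvec"
proof (rule ell2_eqI)
  fix j
  define a where "a = complex_of_real (1 / l j)"
  have "unit_vec j = Lam (a *\<^sub>C unit_vec j)"
    by (rule ell2_eqI) (simp add: a_def)
  then have "B (unit_vec j) = a *\<^sub>C Gam (unit_vec j)"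
    by (metis B_Lam bounded_op_scaleC[OF bounded_op_Gam])
  then have "D (B (unit_vec j)) = a *\<^sub>C D (Gam (unit_vec j))"
    by (simp add: bounded_op_scaleC[OF bounded_op_D])
  moreover have "a *\<^sub>C D (Gam (unit_vec j)) = unit_vec j - coord qvec j *\<^sub>C qvec"
    by (rule ell2_eqI)
      (simp add: coord_D Gam_Gam coord_perturbed a_def coord_qvec coord_uvec power2_eq_square field_simps)
  ultimately have DB: "D (B (unit_vec j)) = unit_vec j - coord qvec j *\<^sub>C qvec"
    by simp
  have "coord (D (B h)) j = cinner (D (B h)) (unit_vec j)"
    by simp
  also have "\<dots> = cinner h (D (B (unit_vec j)))"
    by (simp only: cinner_adj_right[OF bounded_op_D, symmetric] cinner_adj_left[OF bounded_op_D])
  also have "\<dots> = coord (h - cinner h qvec *\<^sub>C qvec) j"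
    by (simp add: DB cinner.diff_right coord_qvec)
  finally show "coord (D (B h)) j = coord (h - cinner h qvec *\<^sub>C qvec) j" .
qed

lemma norm_B: "(norm (B h))\<^sup>2 = (norm h)\<^sup>2 - (cmod (cinner h qvec))\<^sup>2"
proof -
  have "complex_of_real ((norm (B h))\<^sup>2) = cinner (D (B h)) h"
    unfolding cinner_self[symmetric] by (rule cinner_adj_right[OF bounded_op_D])
  also have "\<dots> = cinner h h - cinner h qvec * cnj (cinner h qvec)"
    by (simp add: D_B cinner.diff_left cinner_commute[of h qvec])
  also have "\<dots> = complex_of_real ((norm h)\<^sup>2 - (cmod (cinner h qvec))\<^sup>2)"
    by (simp only: cinner_self complex_norm_square of_real_diff)
  finally show ?thesis
    by (simp only: of_real_eq_iff)
qed

section \<open>Strong convergence of the powers of \<open>B\<close> to 0\<close>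

lemma continuous_norm_Lam: "continuous_on UNIV (\<lambda>v. (norm (Lam v))\<^sup>2)"
  by (intro continuous_intros linear_continuous_on bounded_op_linear bounded_op_Lam)

text \<open>\<open>B\<close> preserves the norm of a recurrent vector, and in this equality case its
  adjoint \<open>D\<close> undoes it.\<close>

lemma recurrent_B_D: "recurrent B w \<Longrightarrow> D (B w) = w"
  by (rule contraction_isometric_point[OF cinner_adj_left[OF bounded_op_D] norm_D_le
        recurrent_isometric[OF B_diff norm_B_le]])

text \<open>By \<open>Lam v = Lam (D (B v)) = Gam (B v)\<close> the norm of \<open>Lam v\<close>
  grows along the orbit by the component of \<open>B v\<close> along \<open>uvec\<close>; recurrence
  allows no growth.\<close>

lemma recurrent_B_uvec:
  assumes w: "recurrent B w" shows "cinner (B w) uvec = 0"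
proof -
  have eq: "(norm (Lam v))\<^sup>2 = (norm (Lam (B v)))\<^sup>2 - (cmod (cinner (B v) uvec))\<^sup>2" if "recurrent B v" for v
    using norm_Gam[of "B v"] recurrent_B_D[OF that] by (simp flip: Lam_D)
  then have "(norm (Lam (B w)))\<^sup>2 = (norm (Lam w))\<^sup>2"
    by (intro recurrent_invariant[OF B_diff norm_B_le w continuous_norm_Lam]) simp
  then show ?thesis
    using eq[OF w] by simp
qed

text \<open>With \<open>w = D (B w)\<close> inserted, the rank-one term of \<open>D_B\<close>
  becomes the component of \<open>B w\<close> along \<open>uvec\<close>, which vanishes. Thus
  \<open>D\<close> acts on \<open>Lam w\<close> as \<open>B\<close> does on
  \<open>w\<close>.\<close>

lemma recurrent_B_D_Lam:
  assumes w: "recurrent B w" shows "D (Lam w) = Lam (B w)"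
proof -
  have "D (Lam w) = D (Gam (B w))"
    using recurrent_B_D[OF w] by (metis Lam_D)
  also have "\<dots> = Lam (B w) - cinner (Lam (B w)) qvec *\<^sub>C qvec"
    by (metis B_Lam D_B)
  also have "cinner (Lam (B w)) qvec = 0"
    using recurrent_B_uvec[OF w] by (simp add: selfadjointD[OF selfadjoint_Lam] Lam_qvec)
  finally show ?thesis
    by simp
qed

lemma recurrent_Lam:
  assumes w: "recurrent S w" and eq: "\<And>n. (T ^^ n) (Lam w) = Lam ((S ^^ n) w)"
  shows "recurrent T (Lam w)"
  unfolding recurrent_def
proof (intro allI impI)
  fix e :: real assume e: "0 < e"
  obtain C where C: "0 \<le> C" "\<And>x. norm (Lam x) \<le> C * norm x"
    using bounded_op_bound[OF bounded_op_Lam] by blast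
  obtain n where n: "dist ((S ^^ Suc n) w) w < e / (C + 1)"
    using w e C(1) by (force simp: recurrent_def)
  have "dist ((T ^^ Suc n) (Lam w)) (Lam w) = norm (Lam ((S ^^ Suc n) w - w))"
    by (simp only: eq dist_norm Lam_diff)
  also have "\<dots> \<le> C * dist ((S ^^ Suc n) w) w"
    unfolding dist_norm by (rule C(2))
  also have "\<dots> \<le> (C + 1) * dist ((S ^^ Suc n) w) w"
    by (intro mult_right_mono) auto
  also have "\<dots> < e"
    using n C(1) by (simp add: field_simps)
  finally show "\<exists>n. dist ((T ^^ Suc n) (Lam w)) (Lam w) < e"
    by blast
qed

lemma funpow_B_Lam: "(B ^^ n) (Lam h) = Lam ((D ^^ n) h)"
  by (induction n) (simp_all add: B_Lam Lam_D)

lemma funpow_D_Lam: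
  assumes w: "recurrent B w" shows "(D ^^ n) (Lam w) = Lam ((B ^^ n) w)"
  by (induction n) (simp_all add: recurrent_B_D_Lam recurrent_funpow[OF B_diff norm_B_le w])

text \<open>Along an orbit of \<open>D\<close> the norm of \<open>Lam v\<close> drops by the
  component along \<open>uvec\<close>, and recurrence allows no drop.\<close>

lemma recurrent_D_uvec:
  assumes v: "recurrent D v" shows "cinner v uvec = 0"
proof -
  have eq: "(norm (Lam (D v)))\<^sup>2 = (norm (Lam v))\<^sup>2 - (cmod (cinner v uvec))\<^sup>2" for v
    using norm_Gam[of v] by (simp add: Lam_D)
  have "- (norm (Lam (D v)))\<^sup>2 = - (norm (Lam v))\<^sup>2"
    by (rule recurrent_invariant[OF D_diff norm_D_le v, of "\<lambda>v. - (norm (Lam v))\<^sup>2"])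
      (simp_all add: eq continuous_on_minus continuous_norm_Lam)
  then show ?thesis
    using eq[of v] by simp
qed

text \<open>\<open>Lam\<close> carries recurrence for \<open>B\<close> to recurrence for
  \<open>D\<close> and, by \<open>funpow_B_Lam\<close>, back again, so the step can be
  iterated.\<close>

lemma recurrent_B_Lam_Lam:
  assumes "recurrent B w"
  shows "recurrent B (Lam (Lam w))" "cinner (Lam w) uvec = 0"
proof -
  have D: "recurrent D (Lam w)"
    by (rule recurrent_Lam[OF assms funpow_D_Lam[OF assms]])
  show "recurrent B (Lam (Lam w))"
    by (rule recurrent_Lam[OF D funpow_B_Lam])
  show "cinner (Lam w) uvec = 0"
    by (rule recurrent_D_uvec[OF D])
qed

text \<open>By iteration all odd powers of \<open>Lam\<close> send \<open>w\<close> into the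
  orthogonal complement of \<open>uvec\<close>. This is a vanishing of moments in the distinct
  values \<open>(l j)\<^sup>2\<close>, and no coordinate of \<open>uvec\<close> is 0.\<close>

lemma recurrent_B_zero:
  assumes w: "recurrent B w" shows "w = 0"
proof (rule ell2_eqI)
  define a where "a j = complex_of_real (l j) * coord w j * complex_of_real (sqrt (weight j))" for j
  have rec: "recurrent B (((\<lambda>v. Lam (Lam v)) ^^ k) w)" for k
    by (induction k) (simp_all add: w recurrent_B_Lam_Lam)
  have coord: "coord (((\<lambda>v. Lam (Lam v)) ^^ k) w) j = complex_of_real (((l j)\<^sup>2) ^ k) * coord w j" for k j
    by (induction k) (simp_all add: power2_eq_square mult.assoc)
  have moments: "(\<lambda>j. complex_of_real (((l j)\<^sup>2) ^ k) * a j) sums 0" for k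
  proof -
    have "(\<lambda>j. coord (Lam (((\<lambda>v. Lam (Lam v)) ^^ k) w)) j * cnj (coord uvec j)) sums 0"
      using cinner_sums recurrent_B_Lam_Lam(2)[OF rec[of k]] by metis
    then show ?thesis
      by (simp add: coord coord_uvec a_def mult_ac)
  qed
  have "summable (\<lambda>j. cmod (a j))"
  proof (rule summable_comparison_test'[where N=0])
    show "summable (\<lambda>j. (cmod (coord (Lam w) j))\<^sup>2 + (cmod (coord uvec j))\<^sup>2)"
      using square_summable_coord unfolding square_summable_def by (intro summable_add)
    fix j
    have "2 * (cmod (coord (Lam w) j) * cmod (coord uvec j)) \<le> (cmod (coord (Lam w) j))\<^sup>2 + (cmod (coord uvec j))\<^sup>2"
      using zero_le_power2[of "cmod (coord (Lam w) j) - cmod (coord uvec j)"] by (simp add: power2_diff)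
    moreover have "cmod (a j) = cmod (coord (Lam w) j) * cmod (coord uvec j)"
      by (simp only: a_def coord_Lam coord_uvec norm_mult)
    moreover have "0 \<le> cmod (a j)"
      by simp
    ultimately show "norm (cmod (a j)) \<le> (cmod (coord (Lam w) j))\<^sup>2 + (cmod (coord uvec j))\<^sup>2"
      unfolding real_norm_def abs_norm_cancel by linarith
  qed
  then have a: "a j = 0" for j
    using moments by (rule moments_zero)
  show "coord w j = coord 0 j" for j
    using a[of j] weight_pos[of j] by (simp add: a_def)
qed

text \<open>The orbit equals \<open>Lam ((D ^^ n) h)\<close> and is relatively compact; its limit
  points are recurrent, hence 0.\<close>

lemma B_Lam_tendsto: "(\<lambda>n. (B ^^ n) (Lam h)) \<longlonglongrightarrow> 0"
proof -
  have D_le: "norm ((D ^^ n) h) \<le> norm h" for n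
    by (induction n) (auto intro: order_trans[OF norm_D_le])
  obtain r w where r: "strict_mono r" and "(\<lambda>n. Lam ((D ^^ r n) h)) \<longlonglongrightarrow> w"
    using compact_operator_convergent_subsequence[OF compact_operator_Lam, of "\<lambda>n. (D ^^ n) h" "norm h"]
      D_le by blast
  then have w: "(\<lambda>n. (B ^^ r n) (Lam h)) \<longlonglongrightarrow> w"
    by (simp add: funpow_B_Lam)
  have "recurrent B w"
    unfolding recurrent_def
  proof (intro allI impI)
    fix e :: real assume "0 < e"
    then obtain N where N: "\<And>n. N \<le> n \<Longrightarrow> dist ((B ^^ r n) (Lam h)) w < e / 2"
      using metric_LIMSEQ_D[OF w, of "e / 2"] by auto
    \<comment> \<open>The orbit is close to \<open>w\<close> at the times \<open>r N\<close> and
      \<open>r (Suc N)\<close>; their positive difference is a return time for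
      \<open>w\<close>.\<close>
    have "r N < r (Suc N)"
      using r by (simp add: strict_mono_def)
    then obtain k where k: "r (Suc N) = Suc k + r N"
      by (metis add.commute add_Suc_right less_iff_Suc_add)
    have "dist ((B ^^ Suc k) w) ((B ^^ r (Suc N)) (Lam h)) \<le> dist w ((B ^^ r N) (Lam h))"
      unfolding k funpow_add comp_apply by (rule funpow_contraction[OF B_diff norm_B_le])
    then have "dist ((B ^^ Suc k) w) w < e"
      using N[of N] N[of "Suc N"] dist_triangle[of "(B ^^ Suc k) w" w "(B ^^ r (Suc N)) (Lam h)"]
      by (simp add: dist_commute)
    then show "\<exists>k. dist ((B ^^ Suc k) w) w < e"
      by blast
  qed
  then have "w = 0"
    by (rule recurrent_B_zero)
  \<comment> \<open>The norms decrease, so their limit along the subsequence is the limit of the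
    whole sequence.\<close>
  have "decseq (\<lambda>n. norm ((B ^^ n) (Lam h)))"
    by (intro decseq_SucI) (simp add: norm_B_le)
  then obtain L where L: "(\<lambda>n. norm ((B ^^ n) (Lam h))) \<longlonglongrightarrow> L"
    using decseq_convergent[of "\<lambda>n. norm ((B ^^ n) (Lam h))" 0] by auto
  then have "(\<lambda>n. norm ((B ^^ r n) (Lam h))) \<longlonglongrightarrow> L"
    using LIMSEQ_subseq_LIMSEQ[OF L r] by (simp add: o_def)
  moreover have "(\<lambda>n. norm ((B ^^ r n) (Lam h))) \<longlonglongrightarrow> 0"
    using tendsto_norm[OF w] \<open>w = 0\<close> by simp
  ultimately have "L = 0"
    by (rule LIMSEQ_unique)
  then show ?thesis
    using L by (simp add: tendsto_norm_zero_iff)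
qed

text \<open>The range of \<open>Lam\<close> contains all finite combinations of unit vectors, so it
  is dense, and the powers of \<open>B\<close> are contractions.\<close>

lemma B_tendsto: "(\<lambda>n. (B ^^ n) h) \<longlonglongrightarrow> 0"
proof (rule metric_LIMSEQ_I)
  fix e :: real assume "0 < e"
  then obtain N where N: "dist (fin_comb N (coord h) unit_vec) h < e / 2"
    using metric_LIMSEQ_D[OF fin_comb_tendsto[of h], of "e / 2"] by auto
  define v where "v = fin_comb N (\<lambda>j. coord h j / complex_of_real (l j)) unit_vec"
  have v: "Lam v = fin_comb N (coord h) unit_vec"
    by (rule ell2_eqI) (simp add: v_def)
  obtain M where M: "\<And>n. M \<le> n \<Longrightarrow> dist ((B ^^ n) (Lam v)) 0 < e / 2"
    using metric_LIMSEQ_D[OF B_Lam_tendsto[of v], of "e / 2"] \<open>0 < e\<close> by auto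
  have "dist ((B ^^ n) h) 0 < e" if "M \<le> n" for n
    using funpow_contraction[OF B_diff norm_B_le, of n h "Lam v"] M[OF that] N
      dist_triangle[of "(B ^^ n) h" 0 "(B ^^ n) (Lam v)"] by (simp add: v dist_commute)
  then show "\<exists>M. \<forall>n\<ge>M. dist ((B ^^ n) h) 0 < e"
    by blast
qed

section \<open>The isometry onto Hankel form\<close>

lemma cinner_funpow_D: "cinner h ((D ^^ n) z) = cinner ((B ^^ n) h) z"
proof (induction n arbitrary: h)
  case (Suc n)
  have "cinner h ((D ^^ Suc n) z) = cinner (B h) ((D ^^ n) z)"
    by (simp add: cinner_adj_left[OF bounded_op_D])
  also have "\<dots> = cinner ((B ^^ Suc n) h) z"
    by (simp add: Suc funpow_swap1[of B])
  finally show ?case .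
qed simp

text \<open>Telescoping of \<open>norm_B\<close>, as each coefficient is
  \<open>cinner ((B ^^ n) h) qvec\<close>. Together with \<open>B_tendsto\<close> it makes
  \<open>V\<close> isometric.\<close>

lemma sum_cinner_funpow:
  "(\<Sum>n<N. (cmod (cinner h ((D ^^ n) qvec)))\<^sup>2) = (norm h)\<^sup>2 - (norm ((B ^^ N) h))\<^sup>2"
  by (induction N) (simp_all add: cinner_funpow_D norm_B)

abbreviation V :: "ell2 \<Rightarrow> ell2" where
  "V \<equiv> analysis (\<lambda>n. (D ^^ n) qvec)"

lemma bessel_V: "bessel (\<lambda>n. (D ^^ n) qvec) 1"
  by (simp add: bessel_def sum_cinner_funpow)

lemmas bounded_op_V = bounded_op_analysis[OF bessel_V]

lemma norm_V: "norm (V h) = norm h"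
proof -
  have "(\<lambda>N. (norm h)\<^sup>2 - (norm ((B ^^ N) h))\<^sup>2) \<longlonglongrightarrow> (norm h)\<^sup>2 - (norm (0::ell2))\<^sup>2"
    by (intro tendsto_intros B_tendsto)
  then have "(\<lambda>n. (cmod (coord (V h) n))\<^sup>2) sums (norm h)\<^sup>2"
    by (simp add: sums_def coord_analysis[OF bessel_V] sum_cinner_funpow)
  then have "(norm (V h))\<^sup>2 = (norm h)\<^sup>2"
    using norm_sums sums_unique2 by blast
  then show ?thesis
    by simp
qed

lemma adj_V_V: "adj V (V h) = h"
proof (rule contraction_isometric_point[where T=V and S="adj V"])
  show "cinner (V x) y = cinner x (adj V y)" for x y
    by (simp add: cinner_adj_right[OF bounded_op_V])
  show "norm (adj V x) \<le> norm x" for x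
    using norm_adj_le[OF bounded_op_V, of 1] by (simp add: norm_V)
qed (rule norm_V)

definition hankel_coeff :: "nat \<Rightarrow> real" where
  "hankel_coeff n = Re (cinner (Lam ((D ^^ n) qvec)) qvec)"

text \<open>\<open>Lam\<close> after a power of \<open>D\<close> is selfadjoint, being equal to the
  same power of \<open>B\<close> after \<open>Lam\<close>.\<close>

lemma cinner_hankel_coeff: "cinner (Lam ((D ^^ n) qvec)) qvec = complex_of_real (hankel_coeff n)"
proof -
  have "cinner (Lam ((D ^^ n) qvec)) qvec = cinner (Lam qvec) ((D ^^ n) qvec)"
    by (simp add: cinner_funpow_D funpow_B_Lam)
  also have "\<dots> = cnj (cinner (Lam ((D ^^ n) qvec)) qvec)"
    by (simp add: selfadjointD[OF selfadjoint_Lam] cinner_commute[of qvec])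
  finally have "Im (cinner (Lam ((D ^^ n) qvec)) qvec) = 0"
    by (metis cnj.sel(2) equal_neg_zero)
  then show ?thesis
    by (simp add: hankel_coeff_def complex_eq_iff)
qed

text \<open>Powers of \<open>D\<close> cross the inner product as powers of \<open>B\<close>, and
  \<open>Lam\<close> converts these back into powers of \<open>D\<close>; only the total exponent
  remains.\<close>

lemma cinner_Lam_funpow:
  "cinner (Lam ((D ^^ n) qvec)) ((D ^^ p) qvec) = complex_of_real (hankel_coeff (n + p))"
proof -
  have "cinner (Lam ((D ^^ n) qvec)) ((D ^^ p) qvec) = cinner (Lam ((D ^^ (p + n)) qvec)) qvec"
    by (simp add: cinner_funpow_D funpow_B_Lam funpow_add)
  then show ?thesis
    by (simp only: cinner_hankel_coeff add.commute)
qed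

lemma cinner_Gam_funpow:
  "cinner (Gam ((D ^^ n) qvec)) ((D ^^ p) qvec) = complex_of_real (hankel_coeff (n + p + 1))"
  using cinner_Lam_funpow[of "Suc n" p] by (simp add: Lam_D)

lemma realizes_hankel_coeff: "realizes_spectra (\<lambda>n. complex_of_real (hankel_coeff n)) l m"
proof -
  \<comment> \<open>One argument for both operators: it is applied to \<open>Gam\<close> with the
    shifted coefficients and to \<open>Lam\<close>.\<close>
  have real: "hankel_defined (\<lambda>n. complex_of_real (c n)) \<and>
      compact_selfadjoint_Hankel (\<lambda>n. complex_of_real (c n)) \<and>
      nonzero_eigenvalue_sequence (Hankel (\<lambda>n. complex_of_real (c n))) d"
    if T: "compact_operator T" "selfadjoint T"
      and c: "\<And>n p. cinner (T ((D ^^ n) qvec)) ((D ^^ p) qvec) = complex_of_real (c (n + p))"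
      and d: "diagonalizes T d e" "\<And>j. \<bar>d j\<bar> \<le> C" "inj d" "\<And>j. d j \<noteq> 0" for T c d e C
  proof -
    note H = Hankel_factorization[OF bessel_V T(2) c]
    have cpt: "compact_operator (\<lambda>x. V (T (adj V x)))"
      by (rule compact_operator_compose_left[OF bounded_op_V
            compact_operator_compose_right[OF bounded_op_adj[OF bounded_op_V] T(1)]])
    have sa: "selfadjoint (\<lambda>x. V (T (adj V x)))"
      by (rule selfadjoint_compose'[OF T(2) bounded_op_V])
    have "nonzero_eigenvalue_sequence (\<lambda>x. V (T (adj V x))) d"
      by (rule diagonalizes_nonzero_eigenvalue_sequence[OF diagonalizes_isometry[OF d(1)
              compact_operator_bounded[OF T(1)] bounded_op_V adj_V_V]
            compact_operator_bounded[OF cpt] sa d(2,3,4)])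
    then show ?thesis
      using H cpt sa by (simp add: compact_selfadjoint_Hankel_def)
  qed
  have "compact_operator Gam"
    unfolding Gam_def
    by (rule compact_operator_compose_left[OF bounded_op_adj[OF bounded_op_fhat]
          compact_operator_compose_right[OF bounded_op_fhat compact_operator_diag[OF m_lim]]])
  from real[OF this selfadjoint_Gam cinner_Gam_funpow diagonalizes_Gam m_bound inj_m m_nonzero]
  have "compact_selfadjoint_Hankel (shift (\<lambda>n. complex_of_real (hankel_coeff n))) \<and>
      nonzero_eigenvalue_sequence (Hankel (shift (\<lambda>n. complex_of_real (hankel_coeff n)))) m"
    by (simp add: shift_def[abs_def])
  moreover have "diagonalizes Lam l unit_vec"
    unfolding Lam_def by (rule diagonalizes_diag[OF l_bound])
  from real[OF compact_operator_Lam selfadjoint_Lam cinner_Lam_funpow this l_bound inj_l l_nonzero]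
  have "compact_selfadjoint_Hankel (\<lambda>n. complex_of_real (hankel_coeff n)) \<and>
      nonzero_eigenvalue_sequence (Hankel (\<lambda>n. complex_of_real (hankel_coeff n))) l"
    by simp
  ultimately show ?thesis
    by (simp add: realizes_spectra_def)
qed

end

section \<open>Uniqueness and kernels\<close>

lemma unit_vec_Suc: "unit_vec (Suc n) = right_shift (unit_vec n)"
  by (rule ell2_eqI) (auto simp: coord_right_shift)

lemma left_shift_eq_zero: "left_shift v = 0 \<Longrightarrow> v = coord v 0 *\<^sub>C unit_vec 0"
proof (rule ell2_eqI)
  fix n assume "left_shift v = 0"
  then have "coord v (Suc k) = 0" for k
    by (metis coord_left_shift coord_zero)
  then show "coord v n = coord (coord v 0 *\<^sub>C unit_vec 0) n"
    by (cases n) simp_all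
qed

lemma cinner_left_shift:
  "cinner (left_shift x) (left_shift y) = cinner x y - coord x 0 * cnj (coord y 0)"
proof -
  have "(\<lambda>n. coord x (Suc n) * cnj (coord y (Suc n))) sums (cinner x y - coord x 0 * cnj (coord y 0))"
    using cinner_sums[of x y] sums_Suc_iff[of "\<lambda>n. coord x n * cnj (coord y n)"] by simp
  then show ?thesis
    using cinner_sums[of "left_shift x" "left_shift y"] by (simp add: coord_left_shift sums_unique2)
qed

lemma diagonalizes_scale:
  assumes d: "diagonalizes T l e" and T: "bounded_op T" and a: "\<And>j. cmod (a j) = 1"
  shows "diagonalizes T l (\<lambda>j. a j *\<^sub>C e j)"
proof -
  have "a j * cnj (a j) = 1" for j
    using complex_norm_square[of "a j"] a by simp
  moreover have "a j \<noteq> 0" for j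
    using a[of j] by auto
  ultimately show ?thesis
    using d by (auto simp: diagonalizes_def orthonormal_def bounded_op_scaleC[OF T] ell2.scale_scale mult.commute)
qed

section \<open>The eigenbasis of an arbitrary realization\<close>

locale realization = interlacing_spectra +
  fixes c :: "nat \<Rightarrow> real"
  assumes realizes: "realizes_spectra (\<lambda>n. complex_of_real (c n)) l m"
begin

abbreviation H :: "ell2 \<Rightarrow> ell2" where
  "H \<equiv> Hankel (\<lambda>n. complex_of_real (c n))"

abbreviation H' :: "ell2 \<Rightarrow> ell2" where
  "H' \<equiv> Hankel (shift (\<lambda>n. complex_of_real (c n)))"

abbreviation e0 :: ell2 where
  "e0 \<equiv> unit_vec 0"

lemma hankel_defined: "hankel_defined (\<lambda>n. complex_of_real (c n))"
  and compact_H: "compact_operator H" and selfadjoint_H: "selfadjoint H"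
  and compact_H': "compact_operator H'" and selfadjoint_H': "selfadjoint H'"
  and eigenvalues_H: "nonzero_eigenvalue_sequence H l"
  and eigenvalues_H': "nonzero_eigenvalue_sequence H' m"
  using realizes by (auto simp: realizes_spectra_def compact_selfadjoint_Hankel_def)

lemmas bounded_H = compact_operator_bounded[OF compact_H]
lemmas bounded_H' = compact_operator_bounded[OF compact_H']
lemmas H'_left_shift = hankel_defined_shift(2)[OF hankel_defined]
lemmas H_right_shift = hankel_defined_shift(3)[OF hankel_defined]

lemma H_zero [simp]: "H 0 = 0"
  by (simp add: linear_simps[OF bounded_op_linear[OF bounded_H]])

lemma left_shift_zero [simp]: "left_shift 0 = 0"
  by (simp add: linear_simps[OF bounded_op_linear[OF bounded_op_left_shift]])

lemma coord_H_0: "coord (H x) 0 = cinner x (H e0)"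
  by (simp flip: selfadjointD[OF selfadjoint_H])

text \<open>\<open>H'\<close> drops the first coordinate of \<open>H x\<close>, and that coordinate
  is \<open>cinner x (H e0)\<close>.\<close>

lemma H'_H': "H' (H' x) = H (H x) - cinner x (H e0) *\<^sub>C H e0"
proof (rule cinner_ext)
  fix z
  have "cinner (H' (H' x)) z = cinner (H' x) (H' z)"
    by (rule selfadjointD[OF selfadjoint_H'])
  also have "\<dots> = cinner (H x) (H z) - cinner x (H e0) * cnj (cinner z (H e0))"
    by (simp only: H'_left_shift cinner_left_shift coord_H_0)
  also have "\<dots> = cinner (H (H x) - cinner x (H e0) *\<^sub>C H e0) z"
    by (simp only: cinner.diff_left cinner_scaleC_left selfadjointD[OF selfadjoint_H, of "H x"]
        cinner_commute[of z] complex_cnj_cnj)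
  finally show "cinner (H' (H' x)) z = cinner (H (H x) - cinner x (H e0) *\<^sub>C H e0) z" .
qed

lemma l_ne_m: "l j \<noteq> m k" "l j \<noteq> - m k"
  using x_ne_y[of j k] by auto

text \<open>If \<open>H e0\<close> were orthogonal to \<open>e j\<close>, the squares of
  \<open>H'\<close> and \<open>H\<close> would agree on \<open>e j\<close>, making
  \<open>l j\<close> or \<open>- l j\<close> an eigenvalue of \<open>H'\<close> against interlacing.
  Unimodular factors then make the components positive.\<close>

lemma eigenbasis:
  "\<exists>e s. diagonalizes H l e \<and> (\<forall>j. 0 < s j) \<and> (\<forall>j. cinner (H e0) (e j) = complex_of_real (s j))"
proof -
  obtain e where e: "diagonalizes H l e"
    using diagonalizes_of_eigenvalue_sequence[OF compact_H selfadjoint_H eigenvalues_H inj_l] .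
  obtain f where f: "diagonalizes H' m f"
    using diagonalizes_of_eigenvalue_sequence[OF compact_H' selfadjoint_H' eigenvalues_H' inj_m] .
  have orth: "orthonormal e" and eig: "\<And>j. H (e j) = complex_of_real (l j) *\<^sub>C e j"
    using e by (simp_all add: diagonalizes_def)
  note lin = linear_simps[OF bounded_op_linear[OF bounded_H']] bounded_op_scaleC[OF bounded_H']
  have no_eig: "v = 0" if z: "H' v = complex_of_real z *\<^sub>C v" "z \<noteq> 0" "\<And>k. z \<noteq> m k" for v z
  proof (rule ccontr)
    assume "v \<noteq> 0"
    then obtain k a where "complex_of_real z = complex_of_real (m k)" "v = a *\<^sub>C f k"
      using diagonalizes_eigenvector[OF f bounded_H' selfadjoint_H' m_bound z(1) _ _ inj_m] z(2)
      by auto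
    then show False
      using z(3)[of k] by simp
  qed
  have ne: "cinner (H e0) (e j) \<noteq> 0" for j
  proof
    assume "cinner (H e0) (e j) = 0"
    then have "cinner (e j) (H e0) = 0"
      by (metis cinner_commute complex_cnj_zero)
    then have sq: "H' (H' (e j)) = complex_of_real ((l j)\<^sup>2) *\<^sub>C e j"
      by (simp add: H'_H' eig bounded_op_scaleC[OF bounded_H] ell2.scale_scale power2_eq_square)
    \<comment> \<open>The square of \<open>H'\<close> minus \<open>(l j)\<^sup>2\<close> is
      factored; \<open>v\<close> is the image of \<open>e j\<close> under the factor that lands in
      the eigenspace of \<open>l j\<close>.\<close>
    define v where "v = H' (e j) + complex_of_real (l j) *\<^sub>C e j"
    have "H' v = complex_of_real (l j) *\<^sub>C v"
      by (rule ell2_eqI) (simp add: v_def lin sq algebra_simps power2_eq_square)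
    then have "v = 0"
      using no_eig[of v "l j"] l_ne_m by simp
    then have "H' (e j) = complex_of_real (- l j) *\<^sub>C e j"
      unfolding v_def by (metis add_eq_0_iff2 of_real_minus scaleC.minus_left)
    then have "e j = 0"
      using no_eig[of "e j" "- l j"] l_ne_m by (metis minus_equation_iff l_nonzero neg_equal_0_iff_equal)
    then show False
      using orthonormal_nonzero[OF orth] by simp
  qed
  define s where "s j = cmod (cinner (H e0) (e j))" for j
  define a where "a j = cinner (H e0) (e j) / complex_of_real (s j)" for j
  have "cmod (a j) = 1" for j
    using ne by (simp add: a_def s_def norm_divide)
  then have "diagonalizes H l (\<lambda>j. a j *\<^sub>C e j)"
    by (rule diagonalizes_scale[OF e bounded_H])
  moreover have "0 < s j" for j
    using ne by (simp add: s_def)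
  moreover have "cinner (H e0) (a j *\<^sub>C e j) = complex_of_real (s j)" for j
  proof -
    have "cinner (H e0) (a j *\<^sub>C e j) = complex_of_real ((s j)\<^sup>2) / complex_of_real (s j)"
      unfolding s_def complex_norm_square by (simp add: a_def s_def mult.commute)
    then show ?thesis
      using ne by (simp add: s_def power2_eq_square)
  qed
  ultimately show ?thesis
    by (intro exI[of _ "\<lambda>j. a j *\<^sub>C e j"] exI[of _ s]) blast
qed

end

section \<open>Identification of a realization with the model\<close>

locale realization_basis = realization +
  fixes e :: "nat \<Rightarrow> ell2" and s :: "nat \<Rightarrow> real"
  assumes e: "diagonalizes H l e" and s_pos: "0 < s j"
    and s: "cinner (H e0) (e j) = complex_of_real (s j)"
begin

abbreviation U :: "ell2 \<Rightarrow> ell2" where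
  "U \<equiv> analysis e"

lemma orthonormal_e: "orthonormal e" and eigenvector: "H (e j) = complex_of_real (l j) *\<^sub>C e j"
  using e by (simp_all add: diagonalizes_def)

lemmas coord_U = coord_analysis_orthonormal[OF orthonormal_e]
lemmas bounded_op_U = bounded_op_analysis_orthonormal[OF orthonormal_e]
lemmas U_adj_U = analysis_adj_analysis[OF orthonormal_e]

lemma norm_U_le: "norm (U x) \<le> norm x"
  using norm_analysis_le[OF bessel_orthonormal[OF orthonormal_e], of x] by simp

lemma norm_adj_U_le: "norm (adj U x) \<le> norm x"
  using norm_adj_le[OF bounded_op_U, of 1 x] norm_U_le by simp

lemma U_H: "U (H x) = Lam (U x)"
  unfolding Lam_def by (rule diagonalizes_analysis[OF e selfadjoint_H l_bound])

lemma H_adj_U: "H x = adj U (Lam (U x))"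
  unfolding Lam_def by (rule diagonalizes_representation[OF e bounded_H selfadjoint_H l_bound])

lemma H_zero_iff: "H x = 0 \<longleftrightarrow> U x = 0"
proof
  assume "H x = 0"
  then have "Lam (U x) = U 0"
    by (metis U_H)
  also have "U 0 = 0"
    by (simp add: linear_simps[OF bounded_op_linear[OF bounded_op_U]])
  finally have "coord (Lam (U x)) j = 0" for j
    by simp
  then show "U x = 0"
    by (intro ell2_eqI) simp
next
  assume "U x = 0"
  then have "cinner x (e j) = 0" for j
    by (metis coord_U coord_zero)
  then show "H x = 0"
    using e by (simp add: diagonalizes_def)
qed

lemma coord_U_e0: "coord (U e0) j = complex_of_real (s j / l j)"
proof -
  have "complex_of_real (s j) = complex_of_real (l j) * cinner e0 (e j)"
    using s[of j] by (simp only: selfadjointD[OF selfadjoint_H] eigenvector cinner_scaleC_right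
        complex_cnj_complex_of_real)
  then show ?thesis
    by (simp add: coord_U del: cinner_unit_vec_left)
qed

text \<open>Pairing the square of \<open>H'\<close> with \<open>e j\<close> determines the
  coefficients of \<open>f\<close> up to the common factor \<open>cinner f (H e0)\<close>; were this
  0, then \<open>H f\<close> and hence \<open>H' f\<close> would vanish.\<close>

lemma shifted_eigenvector:
  assumes f: "H' f = complex_of_real (m k) *\<^sub>C f" and nz: "f \<noteq> 0"
  shows "cinner f (H e0) \<noteq> 0"
    and "coord (U f) j = cinner f (H e0) * complex_of_real (s j / ((l j)\<^sup>2 - (m k)\<^sup>2))"
    and "adj U (U f) = f"
proof -
  have sq: "H' (H' f) = complex_of_real ((m k)\<^sup>2) *\<^sub>C f"
    by (simp add: f bounded_op_scaleC[OF bounded_H'] ell2.scale_scale power2_eq_square)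
  have eq: "complex_of_real ((l j)\<^sup>2 - (m k)\<^sup>2) * cinner f (e j) = cinner f (H e0) * complex_of_real (s j)" for j
  proof -
    have "complex_of_real ((m k)\<^sup>2) * cinner f (e j) = cinner (H' (H' f)) (e j)"
      by (simp add: sq)
    also have "\<dots> = complex_of_real ((l j)\<^sup>2) * cinner f (e j) - cinner f (H e0) * complex_of_real (s j)"
      by (simp add: H'_H' cinner.diff_left s selfadjointD[OF selfadjoint_H, of "H f"]
          selfadjointD[OF selfadjoint_H, of f] eigenvector bounded_op_scaleC[OF bounded_H] power2_eq_square)
    finally show ?thesis
      by (simp add: algebra_simps)
  qed
  have xy: "complex_of_real ((l j)\<^sup>2 - (m k)\<^sup>2) \<noteq> 0" for j
    using x_ne_y[of j k] by (simp only: of_real_eq_0_iff right_minus_eq not_False_eq_True)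
  show "cinner f (H e0) \<noteq> 0"
  proof
    assume "cinner f (H e0) = 0"
    then have "cinner f (e j) = 0" for j
      using eq[of j] xy[of j] by simp
    then have "H f = 0"
      using e by (simp add: diagonalizes_def)
    then have "H' f = 0"
      by (simp add: H'_left_shift)
    then have "coord f n = 0" for n
      using f by (metis coord_scaleC coord_zero m_nonzero mult_eq_0_iff of_real_eq_0_iff)
    then show False
      using nz by (metis coord_zero ell2_eqI)
  qed
  show "coord (U f) j = cinner f (H e0) * complex_of_real (s j / ((l j)\<^sup>2 - (m k)\<^sup>2))"
    using nonzero_eq_divide_eq[OF xy[of j], of "cinner f (e j)"] eq[of j]
    by (simp only: coord_U of_real_divide times_divide_eq_right mult.commute)
  \<comment> \<open>\<open>f\<close> lies in the range of \<open>H\<close>, where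
    \<open>adj U\<close> undoes \<open>U\<close>.\<close>
  have "f = complex_of_real (1 / m k) *\<^sub>C H (right_shift f)"
    by (simp add: H_right_shift f ell2.scale_scale)
  also have "\<dots> = adj U (complex_of_real (1 / m k) *\<^sub>C Lam (U (right_shift f)))"
    by (simp only: H_adj_U[of "right_shift f"] bounded_op_scaleC[OF bounded_op_adj[OF bounded_op_U]])
  finally show "adj U (U f) = f"
    by (metis U_adj_U)
qed

text \<open>The squares are admissible: Bessel's inequality for \<open>e0\<close> bounds the sum at
  0, and expanding \<open>cinner (f k) (H e0)\<close> and dividing by it gives the sums equal to
  1.\<close>

lemma s_eq: "s j = sqrt (weight j)"
proof -
  obtain f where f: "diagonalizes H' m f"
    using diagonalizes_of_eigenvalue_sequence[OF compact_H' selfadjoint_H' eigenvalues_H' inj_m] .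
  have "admissible (\<lambda>j. (s j)\<^sup>2)"
    unfolding admissible_def
  proof (intro conjI allI)
    have eq: "(s j)\<^sup>2 / (l j)\<^sup>2 = (cmod (coord (U e0) j))\<^sup>2" for j
      by (simp only: coord_U_e0 norm_of_real power2_abs power_divide)
    have "norm e0 = 1"
      by (simp add: norm_ell2_def)
    then have "(norm (U e0))\<^sup>2 \<le> 1"
      using norm_U_le[of e0] by (simp add: power_le_one)
    then show "summable (\<lambda>j. (s j)\<^sup>2 / (l j)\<^sup>2)" "(\<Sum>j. (s j)\<^sup>2 / (l j)\<^sup>2) \<le> 1"
      using norm_sums[of "U e0"] unfolding eq by (simp_all add: sums_iff)
    fix k
    define g where "g = cinner (f k) (H e0)"
    have fk: "H' (f k) = complex_of_real (m k) *\<^sub>C f k" "f k \<noteq> 0"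
      using f orthonormal_nonzero by (auto simp: diagonalizes_def)
    note fv = shifted_eigenvector[OF fk]
    have "cinner (f k) (H e0) = cinner (U (f k)) (Lam (U e0))"
      using H_adj_U[of e0] by (simp add: cinner_adj_right[OF bounded_op_U])
    then have "(\<lambda>j. inverse g * (coord (U (f k)) j * cnj (coord (Lam (U e0)) j))) sums (inverse g * g)"
      using cinner_sums[of "U (f k)" "Lam (U e0)"] unfolding g_def by (intro sums_mult) simp
    moreover have "inverse g * (coord (U (f k)) j * cnj (coord (Lam (U e0)) j)) =
        complex_of_real ((s j)\<^sup>2 / ((l j)\<^sup>2 - (m k)\<^sup>2))" for j
      using fv(1) unfolding fv(2) coord_Lam coord_U_e0 g_def[symmetric]
      by (simp add: power2_eq_square)
    moreover have "inverse g * g = complex_of_real 1"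
      using fv(1) by (simp add: g_def)
    ultimately show "(\<lambda>j. (s j)\<^sup>2 / ((l j)\<^sup>2 - (m k)\<^sup>2)) sums 1"
      by (simp only: sums_of_real_iff)
  qed simp
  then have "(\<lambda>j. (s j)\<^sup>2) = weight"
    by (rule admissible_unique)
  then show ?thesis
    using s_pos[of j] by (metis less_imp_le real_sqrt_unique)
qed

lemma U_e0: "U e0 = qvec"
  by (rule ell2_eqI) (simp add: coord_U_e0 coord_qvec s_eq)

text \<open>In the eigenbasis of \<open>H\<close> the eigenvectors of \<open>H'\<close> are
  multiples of \<open>fvec\<close>, hence of \<open>fhat\<close>, so \<open>H'\<close> and
  \<open>Gam\<close> have the same diagonal form.\<close>

lemma U_H': "U (H' x) = Gam (U x)"
proof -
  obtain f where f: "diagonalizes H' m f"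
    using diagonalizes_of_eigenvalue_sequence[OF compact_H' selfadjoint_H' eigenvalues_H' inj_m] .
  define f' where "f' k = adj U (fhat k)" for k
  have multiple: "\<exists>a. a \<noteq> 0 \<and> f' k = a *\<^sub>C f k" for k
  proof -
    have fk: "H' (f k) = complex_of_real (m k) *\<^sub>C f k" "f k \<noteq> 0"
      using f orthonormal_nonzero by (auto simp: diagonalizes_def)
    note fv = shifted_eigenvector[OF fk]
    define g where "g = cinner (f k) (H e0)"
    have "U (f k) = g *\<^sub>C fvec k"
      by (rule ell2_eqI) (simp only: fv(2) coord_scaleC coord_fvec s_eq g_def)
    then have "fvec k = inverse g *\<^sub>C U (f k)"
      using fv(1) by (simp add: ell2.scale_scale g_def)
    then have "f' k = (complex_of_real (1 / norm (fvec k)) * inverse g) *\<^sub>C f k"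
      unfolding f'_def fhat_def
      by (metis bounded_op_scaleC[OF bounded_op_adj[OF bounded_op_U]] ell2.scale_scale fv(3))
    then show ?thesis
      using fv(1) fvec_nonzero[of k]
      by (intro exI[of _ "complex_of_real (1 / norm (fvec k)) * inverse g"]) (simp add: g_def)
  qed
  have f': "diagonalizes H' m f'"
    unfolding diagonalizes_def
  proof (intro conjI allI impI)
    show "orthonormal f'"
      using orthonormal_fhat
      by (simp add: orthonormal_def f'_def cinner_adj_left[OF bounded_op_U] U_adj_U)
    fix k
    obtain a where "f' k = a *\<^sub>C f k"
      using multiple by blast
    then show "H' (f' k) = complex_of_real (m k) *\<^sub>C f' k"
      using f by (simp add: diagonalizes_def bounded_op_scaleC[OF bounded_H'] ell2.scale_scale mult.commute)
  next
    fix g assume g: "\<forall>k. cinner g (f' k) = 0"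
    have "cinner g (f k) = 0" for k
    proof -
      obtain a where "a \<noteq> 0" "f' k = a *\<^sub>C f k"
        using multiple by blast
      then show ?thesis
        using g by (metis cinner_scaleC_right complex_cnj_zero_iff mult_eq_0_iff)
    qed
    then show "H' g = 0"
      using f by (simp add: diagonalizes_def)
  qed
  then have "orthonormal f'"
    by (simp add: diagonalizes_def)
  have an: "analysis f' z = analysis fhat (U z)" for z
    by (rule ell2_eqI)
      (simp add: coord_analysis_orthonormal[OF \<open>orthonormal f'\<close>] coord_analysis_orthonormal[OF orthonormal_fhat]
        f'_def cinner_adj_right[OF bounded_op_U])
  have "H' x = adj U (Gam (U x))"
  proof (rule cinner_ext)
    fix z
    have "cinner (H' x) z = cinner (diag m (analysis f' x)) (analysis f' z)"
      unfolding diagonalizes_representation[OF f' bounded_H' selfadjoint_H' m_bound, of x]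
      by (rule cinner_adj_left[OF bounded_op_analysis_orthonormal[OF \<open>orthonormal f'\<close>]])
    also have "\<dots> = cinner (Gam (U x)) (U z)"
      unfolding an Gam_def by (rule cinner_adj_left[OF bounded_op_fhat, symmetric])
    finally show "cinner (H' x) z = cinner (adj U (Gam (U x))) z"
      by (simp add: cinner_adj_left[OF bounded_op_U])
  qed
  then show ?thesis
    by (simp add: U_adj_U)
qed

text \<open>\<open>Lam (U (right_shift x))\<close> is \<open>U (H' x)\<close>, that is
  \<open>Gam (U x)\<close>, and division by \<open>l j\<close> yields \<open>D\<close>.\<close>

lemma U_right_shift: "U (right_shift x) = D (U x)"
proof (rule ell2_eqI)
  fix j
  have "Lam (U (right_shift x)) = Gam (U x)"
    by (metis H_right_shift U_H U_H')
  then have "complex_of_real (l j) * coord (U (right_shift x)) j = coord (Gam (U x)) j"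
    by (metis coord_Lam)
  then show "coord (U (right_shift x)) j = coord (D (U x)) j"
    by (metis coord_D l_nonzero nonzero_mult_div_cancel_left of_real_eq_0_iff)
qed

lemma U_unit_vec: "U (unit_vec n) = (D ^^ n) qvec"
  by (induction n) (simp_all add: U_e0 unit_vec_Suc U_right_shift)

text \<open>Both factors of \<open>cinner (H (unit_vec n)) e0\<close> are expressed by the model,
  which depends on \<open>l\<close> and \<open>m\<close> only.\<close>

lemma c_eq: "c n = hankel_coeff n"
proof -
  have "complex_of_real (c n) = cinner (H (unit_vec n)) e0"
    by (simp add: coord_Hankel_unit_vec[OF hankel_defined])
  also have "\<dots> = cinner (Lam (U (unit_vec n))) (U e0)"
    unfolding H_adj_U[of "unit_vec n"] by (rule cinner_adj_left[OF bounded_op_U])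
  also have "\<dots> = complex_of_real (hankel_coeff n)"
    by (simp add: U_unit_vec cinner_hankel_coeff)
  finally show ?thesis
    by simp
qed

section \<open>Kernels and the position of \<open>e0\<close> relative to the range of
  \<open>H\<close>\<close>

lemma norm_qvec: "(norm qvec)\<^sup>2 = (\<Sum>j. weight j / (l j)\<^sup>2)"
proof -
  have "(cmod (coord qvec j))\<^sup>2 = weight j / (l j)\<^sup>2" for j
    using weight_pos[of j] unfolding coord_qvec norm_of_real power2_abs
    by (simp add: power_divide less_imp_le)
  then show ?thesis
    using norm_sums[of qvec] by (simp add: sums_iff)
qed

text \<open>\<open>adj U (U e0)\<close> is the projection of \<open>e0\<close> onto the closed span
  of the eigenvectors, the closure of the range of \<open>H\<close>; it is \<open>e0\<close> iff no
  norm is lost.\<close>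

lemma e0_in_closure_iff: "adj U (U e0) = e0 \<longleftrightarrow> (\<Sum>j. weight j / (l j)\<^sup>2) = 1"
proof -
  have e0: "norm e0 = 1"
    by (simp add: norm_ell2_def)
  have "adj U (U e0) = e0 \<longleftrightarrow> norm (U e0) = 1"
  proof
    assume eq: "adj U (U e0) = e0"
    have "norm e0 \<le> norm (U e0)"
      using norm_adj_U_le[of "U e0"] eq by simp
    then show "norm (U e0) = 1"
      using norm_U_le[of e0] e0 by simp
  next
    assume "norm (U e0) = 1"
    then show "adj U (U e0) = e0"
      using e0 by (intro contraction_isometric_point[OF cinner_adj_right[OF bounded_op_U, symmetric] norm_adj_U_le])
        simp
  qed
  then show ?thesis
    unfolding norm_qvec[symmetric] U_e0[symmetric] by (simp add: power2_eq_1_iff)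
      (metis norm_ge_zero neg_0_le_iff_le not_one_le_zero order_trans zero_le_one add.inverse_inverse)
qed

text \<open>In the eigenbasis a preimage of \<open>e0\<close> is forced to have the coordinates
  \<open>sqrt (weight j) / (l j)\<^sup>2\<close>.\<close>

lemma e0_in_range_summable:
  assumes "H g = e0" shows "summable (\<lambda>j. weight j / ((l j)\<^sup>2)\<^sup>2)"
proof -
  have "Lam (U g) = qvec"
    using U_H[of g] by (simp add: assms U_e0)
  then have "complex_of_real (l j) * coord (U g) j = complex_of_real (sqrt (weight j) / l j)" for j
    by (metis coord_Lam coord_qvec)
  then have "coord (U g) j = complex_of_real (sqrt (weight j) / (l j)\<^sup>2)" for j
    by (simp add: field_simps power2_eq_square)
  then have "(cmod (coord (U g) j))\<^sup>2 = weight j / ((l j)\<^sup>2)\<^sup>2" for j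
    using weight_pos[of j] by (simp only: norm_of_real power2_abs) (simp add: power_divide less_imp_le)
  then show ?thesis
    using square_summable_coord[of "U g"] by (simp add: square_summable_def)
qed

lemma e0_in_range:
  assumes cl: "adj U (U e0) = e0" and summ: "summable (\<lambda>j. weight j / ((l j)\<^sup>2)\<^sup>2)"
  shows "\<exists>g. H g = e0"
proof -
  have "square_summable (\<lambda>j. complex_of_real (sqrt (weight j) / (l j)\<^sup>2))"
    using summ weight_pos unfolding square_summable_def norm_of_real power2_abs
    by (simp add: power_divide less_imp_le)
  then have "coord (Abs_ell2 (\<lambda>j. complex_of_real (sqrt (weight j) / (l j)\<^sup>2))) j =
      complex_of_real (sqrt (weight j) / (l j)\<^sup>2)" for j
    by (simp only: coord_Abs_ell2)
  then obtain p where p: "\<And>j. coord p j = complex_of_real (sqrt (weight j) / (l j)\<^sup>2)"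
    by blast
  have "Lam p = qvec"
    by (rule ell2_eqI) (simp add: p coord_qvec power2_eq_square)
  then have "H (adj U p) = adj U (U e0)"
    by (simp add: H_adj_U[of "adj U p"] U_adj_U U_e0)
  then show ?thesis
    using cl by auto
qed

text \<open>A preimage \<open>g\<close> would satisfy
  \<open>H (right_shift g) = left_shift e0 = 0\<close>, hence \<open>g = 0\<close>.\<close>

lemma e0_not_in_range:
  assumes inj: "\<And>h. H h = 0 \<Longrightarrow> h = 0" shows "H g \<noteq> e0"
proof
  assume g: "H g = e0"
  have "left_shift e0 = 0"
    by (rule ell2_eqI) (simp add: coord_left_shift)
  then have "H (right_shift g) = 0"
    by (simp add: H_right_shift H'_left_shift g)
  then have "right_shift g = 0"
    by (rule inj)
  then have "coord g n = 0" for n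
    using coord_right_shift[of g "Suc n"] by simp
  then have "g = 0"
    by (intro ell2_eqI) simp
  then have "coord e0 0 = 0"
    using g by simp
  then show False
    by simp
qed

text \<open>From right to left, kernel vectors are orthogonal to \<open>e0\<close> and the kernel is
  invariant under the left shift, so each coordinate is the first coordinate of a kernel vector and
  vanishes.\<close>

lemma kernel_trivial_iff:
  "(\<forall>h. H h = 0 \<longrightarrow> h = 0) \<longleftrightarrow>
    (\<Sum>j. weight j / (l j)\<^sup>2) = 1 \<and> \<not> summable (\<lambda>j. weight j / ((l j)\<^sup>2)\<^sup>2)"
proof
  assume inj: "\<forall>h. H h = 0 \<longrightarrow> h = 0"
  have "U (e0 - adj U (U e0)) = 0"
    by (simp add: linear_simps[OF bounded_op_linear[OF bounded_op_U]] U_adj_U)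
  then have "e0 - adj U (U e0) = 0"
    using inj H_zero_iff by blast
  then have cl: "adj U (U e0) = e0"
    by simp
  moreover have "\<not> summable (\<lambda>j. weight j / ((l j)\<^sup>2)\<^sup>2)"
    using e0_in_range[OF cl] e0_not_in_range inj by blast
  ultimately show "(\<Sum>j. weight j / (l j)\<^sup>2) = 1 \<and> \<not> summable (\<lambda>j. weight j / ((l j)\<^sup>2)\<^sup>2)"
    using e0_in_closure_iff by blast
next
  assume *: "(\<Sum>j. weight j / (l j)\<^sup>2) = 1 \<and> \<not> summable (\<lambda>j. weight j / ((l j)\<^sup>2)\<^sup>2)"
  then have cl: "adj U (U e0) = e0"
    using e0_in_closure_iff by blast
  have zero: "coord h 0 = 0" if "H h = 0" for h
  proof -
    have "coord h 0 = cinner h (adj U (U e0))"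
      by (simp add: cl)
    also have "\<dots> = 0"
      using that by (simp add: cinner_adj_right[OF bounded_op_U] H_zero_iff cinner.zero_left)
    finally show ?thesis .
  qed
  have step: "H (left_shift h) = 0" if "H h = 0" for h
  proof -
    have h: "right_shift (left_shift h) = h"
      using zero[OF that] by (intro ell2_eqI) (simp add: coord_right_shift coord_left_shift)
    \<comment> \<open>\<open>v\<close> is a multiple of \<open>e0\<close> because
      \<open>left_shift v = H h = 0\<close>; it also lies in the range, which does not contain
      \<open>e0\<close>.\<close>
    define v where "v = H (left_shift h)"
    have "left_shift v = 0"
      using H_right_shift[of "left_shift h"] H'_left_shift[of "left_shift h"] by (simp add: h that v_def)
    then have v: "v = coord v 0 *\<^sub>C e0"
      by (rule left_shift_eq_zero)
    have "coord v 0 = 0"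
    proof (rule ccontr)
      assume ne: "coord v 0 \<noteq> 0"
      have "H (inverse (coord v 0) *\<^sub>C left_shift h) = inverse (coord v 0) *\<^sub>C v"
        by (simp add: bounded_op_scaleC[OF bounded_H] v_def)
      also have "\<dots> = e0"
        using ne by (subst v) (simp add: ell2.scale_scale)
      finally show False
        using e0_in_range_summable * by blast
    qed
    then show ?thesis
      using v unfolding v_def by (simp add: ell2.scale_zero_left)
  qed
  have "coord h n = 0" if "H h = 0" for h n
    using that
  proof (induction n arbitrary: h)
    case (Suc n)
    then show ?case
      using Suc.IH[OF step[OF Suc.prems]] by (simp add: coord_left_shift)
  qed (rule zero)
  then show "\<forall>h. H h = 0 \<longrightarrow> h = 0"
    by (metis coord_zero ell2_eqI)
qed

text \<open>\<open>H' h = 0\<close> makes \<open>H h\<close> a multiple of \<open>e0\<close>, which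
  is not in the range of an injective \<open>H\<close>.\<close>

lemma kernel_shift_trivial:
  assumes inj: "\<And>h. H h = 0 \<Longrightarrow> h = 0" and h: "H' h = 0"
  shows "h = 0"
proof -
  have v: "H h = coord (H h) 0 *\<^sub>C e0"
    using h by (intro left_shift_eq_zero) (simp add: H'_left_shift)
  have "coord (H h) 0 = 0"
  proof (rule ccontr)
    assume ne: "coord (H h) 0 \<noteq> 0"
    have "H (inverse (coord (H h) 0) *\<^sub>C h) = inverse (coord (H h) 0) *\<^sub>C (coord (H h) 0 *\<^sub>C e0)"
      by (subst v[symmetric]) (rule bounded_op_scaleC[OF bounded_H])
    then show False
      using ne e0_not_in_range[OF inj] by (simp add: ell2.scale_scale)
  qed
  then have "H h = 0"
    using v by (simp add: ell2.scale_zero_left)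
  then show ?thesis
    by (rule inj)
qed

end

section \<open>Conclusions for arbitrary realizations\<close>

lemma null_space_eq_zero_iff:
  assumes "T 0 = 0" shows "null_space T = {0} \<longleftrightarrow> (\<forall>h. T h = 0 \<longrightarrow> h = 0)"
  using assms by (auto simp: null_space_def)

context realization
begin

lemma c_eq_hankel_coeff: "c = hankel_coeff"
proof -
  obtain e s where "diagonalizes H l e" "\<And>j. 0 < s j" "\<And>j. cinner (H e0) (e j) = complex_of_real (s j)"
    using eigenbasis by blast
  then interpret realization_basis l m c e s
    by unfold_locales
  show ?thesis
    using c_eq by (rule ext)
qed

text \<open>The first condition puts \<open>e0\<close> into the closure of the range of
  \<open>H\<close>; given this, the second keeps it out of the range. Indices start at 0, so
  \<open>l N\<close> is the eigenvalue number \<open>N + 1\<close>.\<close>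

lemma null_space_iff:
  "null_space H = {0} \<longleftrightarrow>
    (\<Sum>j. ereal (1 - (m j)\<^sup>2 / (l j)\<^sup>2)) = \<infinity> \<and>
    (SUP N. ereal (1 / (l N)\<^sup>2 * (\<Prod>j<N. (m j)\<^sup>2 / (l j)\<^sup>2))) = \<infinity>"
proof -
  obtain e s where "diagonalizes H l e" "\<And>j. 0 < s j" "\<And>j. cinner (H e0) (e j) = complex_of_real (s j)"
    using eigenbasis by blast
  then interpret realization_basis l m c e s
    by unfold_locales
  show ?thesis
    unfolding null_space_eq_zero_iff[of H, OF H_zero] kernel_trivial_iff suminf_ereal_eq_infinity_iff
      SUP_ratio_eq_infinity_iff
    by (rule conj_cong[OF refl]) (simp only: summable_weight_square_iff)
qed

lemma null_space_shift:
  assumes "null_space H = {0}" shows "null_space H' = {0}"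
proof -
  obtain e s where "diagonalizes H l e" "\<And>j. 0 < s j" "\<And>j. cinner (H e0) (e j) = complex_of_real (s j)"
    using eigenbasis by blast
  then interpret realization_basis l m c e s
    by unfold_locales
  have "H' 0 = 0"
    by (simp add: H'_left_shift)
  moreover have "h = 0" if "H h = 0" for h
    using assms that null_space_eq_zero_iff[of H, OF H_zero] by blast
  then have "\<forall>h. H' h = 0 \<longrightarrow> h = 0"
    using kernel_shift_trivial by blast
  ultimately show ?thesis
    using null_space_eq_zero_iff[of H'] by blast
qed

end

theorem theorem2:
  fixes l m :: "nat \<Rightarrow> real"
  assumes l_tendsto: "l \<longlonglongrightarrow> 0" and m_tendsto: "m \<longlonglongrightarrow> 0"
    and l_gt_m: "\<And>j. \<bar>l j\<bar> > \<bar>m j\<bar>"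
    and m_gt_l: "\<And>j. \<bar>m j\<bar> > \<bar>l (Suc j)\<bar>"
  shows "(\<exists>!c :: nat \<Rightarrow> real. realizes_spectra (\<lambda>n. complex_of_real (c n)) l m) \<and>
    (\<forall>c :: nat \<Rightarrow> real. realizes_spectra (\<lambda>n. complex_of_real (c n)) l m \<longrightarrow>
      (null_space (Hankel (\<lambda>n. complex_of_real (c n))) = {0} \<longleftrightarrow>
         (\<Sum>j. ereal (1 - (m j)\<^sup>2 / (l j)\<^sup>2)) = \<infinity> \<and>
         (SUP N. ereal (1 / (l N)\<^sup>2 * (\<Prod>j<N. (m j)\<^sup>2 / (l j)\<^sup>2))) = \<infinity>) \<and>
      (null_space (Hankel (\<lambda>n. complex_of_real (c n))) = {0} \<longrightarrow>
         null_space (Hankel (shift (\<lambda>n. complex_of_real (c n)))) = {0}))"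
proof -
  interpret interlacing_spectra l m
    using l_tendsto l_gt_m m_gt_l by unfold_locales
  have realization: "realization l m c" if "realizes_spectra (\<lambda>n. complex_of_real (c n)) l m" for c
    using that by unfold_locales
  show ?thesis
  proof (intro conjI allI impI)
    show "\<exists>!c :: nat \<Rightarrow> real. realizes_spectra (\<lambda>n. complex_of_real (c n)) l m"
      using realizes_hankel_coeff realization.c_eq_hankel_coeff[OF realization] by (rule ex1I)
  qed (use realization.null_space_iff[OF realization] realization.null_space_shift[OF realization]
      in \<open>simp_all\<close>)
qed

end
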